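(* For every positive integer $r$, the $f$-triangle $\mathcal{F}_r$ of the $r$-colored barycentric subdivision has the strong interlacing property with respect to every $n \in \mathbb{N}$.
   Context: For a $(d-1)$-dimensional simplicial complex $K$, $h(K,x)=\sum_{i=0}^d f_{i-1}(K)x^i(1-x)^{d-i}=\sum_i h_i(K)x^i$ where $f_i(K)$ is the number of $i$-dimensional faces. The barycentric subdivision $\mathrm{sd}(\Delta)$ is the complex of chains of nonempty faces of $\Delta$. The $r$-fold edgewise subdivision $\mathrm{esd}_r(\Delta)$: fix a linear order $v_1,\dots,v_m$ of $V(\Delta)$; $V_r(\Delta)$ is the set of $f:V(\Delta)\to\mathbb{N}$ with $\mathrm{supp}(f)\in\Delta$ and $\sum_j f(v_j)=r$; $\iota(f)(v_j)=f(v_1)+\cdots+f(v_j)$; faces of $\mathrm{esd}_r(\Delta)$ are the $E\subseteq V_r(\Delta)$ with $\bigcup_{f\in E}\mathrm{supp}(f)\in\Delta$ and, for all $f,g\in E$, $\iota(f)-\iota(g)$ or $\iota(g)-\iota(f)$ lies in $\{0,1\}^{V(\Delta)}$. The $r$-colored barycentric subdivision is $\mathrm{sd}_r(\Delta)=\mathrm{esd}_r(\mathrm{sd}(\Delta))$, a triangulation of $\Delta$. An $f$-triangle of size $d\in\mathbb{N}\cup\{\infty\}$ is an array $\mathcal{F}=(f_{\mathcal{F}}(i,j))_{0\le i\le j\le d}$ of nonnegative integers; a triangulation $\Delta'$ of $\Delta$ (of dimension less than $d$) is $\mathcal{F}$-uniform if the restriction of $\Delta'$ to any $(j-1)$-dimensional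 face of $\Delta$ has exactly $f_{\mathcal{F}}(i,j)$ faces of dimension $i-1$; $\mathcal{F}$ is feasible if every simplex of dimension less than $d$ has an $\mathcal{F}$-uniform triangulation. $\mathcal{F}_r$ is the (feasible, infinite-size) $f$-triangle for which $\mathrm{sd}_r(\Delta)$ is $\mathcal{F}_r$-uniform for every $\Delta$. For feasible $\mathcal{F}$ and finite $m\le d$, $\mathcal{D}_{\mathcal{F},m}:\mathbb{R}_m[x]\to\mathbb{R}_m[x]$ is the linear operator with $h(\Delta',x)=\mathcal{D}_{\mathcal{F},m}(h(\Delta,x))$ for every $(m-1)$-dimensional $\Delta$ and $\mathcal{F}$-uniform triangulation $\Delta'$; $h_{\mathcal{F}}(\Delta,x)=\sum_k h_k(\Delta)\mathcal{D}_{\mathcal{F},m}(x^k)$. Let $\sigma_m$ be the simplex on $m$ vertices, $\partial\sigma_m$ its boundary, $\theta_{\mathcal{F}}(\sigma_m,x)=h_{\mathcal{F}}(\sigma_m,x)-h_{\mathcal{F}}(\partial\sigma_m,x)$. $\mathcal{F}$ has the strong interlacing property with respect to $n$ if (i) $h_{\mathcal{F}}(\sigma_m,x)$ is real-rooted for all $2\le m<n$, and (ii) for all $2\le m\le n$, $\theta_{\mathcal{F}}(\sigma_m,x)$ is identically zero or a real-rooted polynomial of degree $m-1$ with nonnegative coefficients interlaced by $h_{\mathcal{F}}(\sigma_{m-1},x)$. Real-rooted means all roots real or the zero polynomial; real-rooted $p$ with roots $\alpha_1\ge\alpha_2\ge\cdots$ interlaces real-rooted $q$ with roots $\beta_1\ge\beta_2\ge\cdots$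 if $\cdots\le\alpha_2\le\beta_2\le\alpha_1\le\beta_1$. *)

theory Defs
  imports Complex_Main "HOL-Library.Multiset" "HOL-Computational_Algebra.Polynomial"
begin

section \<open>Finite abstract simplicial complexes\<close>

text \<open>A complex always contains the empty face, of dimension \<open>-1\<close>.\<close>

definition abstract_complex :: "'a set set \<Rightarrow> bool" where
  "abstract_complex K \<longleftrightarrow> finite K \<and> {} \<in> K \<and> (\<forall>F\<in>K. finite F) \<and>
     (\<forall>F\<in>K. \<forall>G. G \<subseteq> F \<longrightarrow> G \<in> K)"

text \<open>\<open>cx_rank K\<close> is \<open>dim K + 1\<close>, and \<open>face_num K i\<close> is the number \<open>f\<^bsub>i-1\<^esub>(K)\<close> of faces
  with \<open>i\<close> vertices.\<close>

definition cx_rank :: "'a set set \<Rightarrow> nat" where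
  "cx_rank K = Max (card ` K)"

definition face_num :: "'a set set \<Rightarrow> nat \<Rightarrow> nat" where
  "face_num K i = card {F \<in> K. card F = i}"

definition h_poly :: "'a set set \<Rightarrow> real poly" where
  "h_poly K = (\<Sum>i\<le>cx_rank K. of_nat (face_num K i) * [:0, 1:] ^ i * [:1, -1:] ^ (cx_rank K - i))"

definition full_simplex :: "nat \<Rightarrow> nat set set" where
  "full_simplex m = Pow {..<m}"

definition boundary_simplex :: "nat \<Rightarrow> nat set set" where
  "boundary_simplex m = Pow {..<m} - {{..<m}}"

definition supp :: "('a \<Rightarrow> 'b::zero) \<Rightarrow> 'a set" where
  "supp f = {v. f v \<noteq> 0}"

section \<open>Barycentric and edgewise subdivision\<close>

definition sd :: "'a set set \<Rightarrow> 'a set set set" where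
  "sd K = {C. subset.chain (K - {{}}) C}"

text \<open>The linear order of the vertices is given by a list \<open>vs\<close> enumerating them without
  repetition.\<close>

definition esd_vertices :: "nat \<Rightarrow> 'a set set \<Rightarrow> ('a \<Rightarrow> nat) set" where
  "esd_vertices r K = {f. supp f \<in> K \<and> (\<Sum>v\<in>supp f. f v) = r}"

definition partial_sum :: "'a list \<Rightarrow> ('a \<Rightarrow> nat) \<Rightarrow> nat \<Rightarrow> int" where
  "partial_sum vs f j = (\<Sum>k\<le>j. int (f (vs ! k)))"

definition unit_step :: "'a list \<Rightarrow> ('a \<Rightarrow> nat) \<Rightarrow> ('a \<Rightarrow> nat) \<Rightarrow> bool" where
  "unit_step vs f g \<longleftrightarrow> (\<forall>j<length vs. partial_sum vs f j - partial_sum vs g j \<in> {0, 1})"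

definition esd :: "'a list \<Rightarrow> nat \<Rightarrow> 'a set set \<Rightarrow> ('a \<Rightarrow> nat) set set" where
  "esd vs r K = {E. E \<subseteq> esd_vertices r K \<and> (\<Union>f\<in>E. supp f) \<in> K \<and>
     (\<forall>f\<in>E. \<forall>g\<in>E. unit_step vs f g \<or> unit_step vs g f)}"

text \<open>Here \<open>vs\<close> enumerates the vertices of \<open>sd K\<close>, that is, the nonempty faces of \<open>K\<close>.\<close>

definition colored_sd :: "'a set list \<Rightarrow> nat \<Rightarrow> 'a set set \<Rightarrow> ('a set \<Rightarrow> nat) set set" where
  "colored_sd vs r K = esd vs r (sd K)"

section \<open>Triangulations\<close>

definition realization :: "'a set set \<Rightarrow> ('a \<Rightarrow> real) set" where
  "realization K = {\<alpha>. (\<forall>v. 0 \<le> \<alpha> v) \<and> supp \<alpha> \<in> K \<and> (\<Sum>v\<in>supp \<alpha>. \<alpha> v) = 1}"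

definition affine_extension :: "('b \<Rightarrow> 'a \<Rightarrow> real) \<Rightarrow> ('b \<Rightarrow> real) \<Rightarrow> 'a \<Rightarrow> real" where
  "affine_extension p \<beta> = (\<lambda>a. \<Sum>v\<in>supp \<beta>. \<beta> v * p v a)"

text \<open>Geometric triangulations: \<open>p\<close> places the vertices of \<open>K'\<close> in the realization of \<open>K\<close>, the
  vertices of each face of \<open>K'\<close> lie in a common closed face of \<open>K\<close>, and the piecewise
  affine extension of \<open>p\<close> is a bijection of realizations. As the complexes are finite, this bijection is
  continuous between compact Hausdorff spaces, hence a homeomorphism.\<close>

definition geom_triangulation :: "('b \<Rightarrow> 'a \<Rightarrow> real) \<Rightarrow> 'b set set \<Rightarrow> 'a set set \<Rightarrow> bool" where
  "geom_triangulation p K' K \<longleftrightarrow> abstract_complex K' \<and> abstract_complex K \<and>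
     (\<forall>G\<in>K'. \<exists>F\<in>K. \<forall>v\<in>G. p v \<in> realization K \<and> supp (p v) \<subseteq> F) \<and>
     bij_betw (affine_extension p) (realization K') (realization K)"

definition restriction :: "('b \<Rightarrow> 'a \<Rightarrow> real) \<Rightarrow> 'b set set \<Rightarrow> 'a set \<Rightarrow> 'b set set" where
  "restriction p K' F = {G \<in> K'. \<forall>v\<in>G. supp (p v) \<subseteq> F}"

text \<open>An \<open>f\<close>-triangle of infinite size is a function \<open>F :: nat \<Rightarrow> nat \<Rightarrow> nat\<close>, extended by
  \<open>F i j = 0\<close> for \<open>i > j\<close>. The entries with \<open>i > j\<close> impose no further condition below,
  since a triangulation of a \<open>(j-1)\<close>-dimensional simplex has dimension \<open>j-1\<close>.\<close>

definition uniform_triangulation ::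
  "(nat \<Rightarrow> nat \<Rightarrow> nat) \<Rightarrow> ('b \<Rightarrow> 'a \<Rightarrow> real) \<Rightarrow> 'b set set \<Rightarrow> 'a set set \<Rightarrow> bool" where
  "uniform_triangulation F p K' K \<longleftrightarrow> geom_triangulation p K' K \<and>
     (\<forall>S\<in>K. \<forall>i. face_num (restriction p K' S) i = F i (card S))"

text \<open>A vertex \<open>f\<close> of the edgewise subdivision is the point with coordinates \<open>f / r\<close>, and a
  vertex \<open>S\<close> of the barycentric subdivision is the barycenter of \<open>S\<close>.\<close>

definition barycenter :: "'a set \<Rightarrow> 'a \<Rightarrow> real" where
  "barycenter S a = (if a \<in> S then 1 / real (card S) else 0)"

definition colored_sd_placement :: "nat \<Rightarrow> ('a set \<Rightarrow> nat) \<Rightarrow> 'a \<Rightarrow> real" where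
  "colored_sd_placement r f = affine_extension barycenter (\<lambda>S. real (f S) / real r)"

text \<open>The \<open>f\<close>-triangle of the \<open>r\<close>-colored barycentric subdivision. Up to isomorphism
  every finite complex has its vertices in \<open>nat\<close>.\<close>

definition colored_f_triangle :: "nat \<Rightarrow> nat \<Rightarrow> nat \<Rightarrow> nat" where
  "colored_f_triangle r = (THE F. \<forall>(K :: nat set set) vs.
     abstract_complex K \<and> distinct vs \<and> set vs = K - {{}} \<longrightarrow>
     uniform_triangulation F (colored_sd_placement r) (colored_sd vs r K) K)"

section \<open>The operators of an \<open>f\<close>-triangle\<close>

definition is_h_operator ::
  "(nat \<Rightarrow> nat \<Rightarrow> nat) \<Rightarrow> nat \<Rightarrow> (real poly \<Rightarrow> real poly) \<Rightarrow> bool" where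
  "is_h_operator F m D \<longleftrightarrow>
     (\<forall>p. degree p \<le> m \<longrightarrow> degree (D p) \<le> m) \<and>
     (\<forall>p q. degree p \<le> m \<longrightarrow> degree q \<le> m \<longrightarrow> D (p + q) = D p + D q) \<and>
     (\<forall>c p. degree p \<le> m \<longrightarrow> D (smult c p) = smult c (D p)) \<and>
     (\<forall>(K :: nat set set) (K' :: nat set set) p.
        cx_rank K = m \<and> uniform_triangulation F p K' K \<longrightarrow> h_poly K' = D (h_poly K))"

text \<open>Only the values on polynomials of degree at most \<open>m\<close> are specified and used.\<close>

definition h_operator :: "(nat \<Rightarrow> nat \<Rightarrow> nat) \<Rightarrow> nat \<Rightarrow> real poly \<Rightarrow> real poly" where
  "h_operator F m = (SOME D. is_h_operator F m D)"

definition h_uniform :: "(nat \<Rightarrow> nat \<Rightarrow> nat) \<Rightarrow> 'a set set \<Rightarrow> real poly" where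
  "h_uniform F K =
     (\<Sum>k\<le>cx_rank K. smult (coeff (h_poly K) k) (h_operator F (cx_rank K) (monom 1 k)))"

definition theta :: "(nat \<Rightarrow> nat \<Rightarrow> nat) \<Rightarrow> nat \<Rightarrow> real poly" where
  "theta F m = h_uniform F (full_simplex m) - h_uniform F (boundary_simplex m)"

section \<open>Interlacing\<close>

definition real_rooted :: "real poly \<Rightarrow> bool" where
  "real_rooted p \<longleftrightarrow> p = 0 \<or> (\<forall>z. poly (map_poly complex_of_real p) z = 0 \<longrightarrow> z \<in> \<real>)"

definition roots_desc :: "real poly \<Rightarrow> real list" where
  "roots_desc p = rev (sorted_list_of_multiset (proots p))"

text \<open>With roots listed with multiplicity, the chain
  \<open>\<dots> \<le> \<alpha>\<^sub>2 \<le> \<beta>\<^sub>2 \<le> \<alpha>\<^sub>1 \<le> \<beta>\<^sub>1\<close> forces \<open>q\<close> to have as many roots as \<open>p\<close> or one more.\<close>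

definition interlaces :: "real poly \<Rightarrow> real poly \<Rightarrow> bool" where
  "interlaces p q \<longleftrightarrow> p \<noteq> 0 \<and> q \<noteq> 0 \<and> real_rooted p \<and> real_rooted q \<and>
     (let \<alpha> = roots_desc p; \<beta> = roots_desc q in
        (length \<beta> = length \<alpha> \<or> length \<beta> = length \<alpha> + 1) \<and>
        (\<forall>i<length \<alpha>. \<alpha> ! i \<le> \<beta> ! i) \<and>
        (\<forall>i. i + 1 < length \<beta> \<longrightarrow> \<beta> ! (i + 1) \<le> \<alpha> ! i))"

definition strong_interlacing :: "(nat \<Rightarrow> nat \<Rightarrow> nat) \<Rightarrow> nat \<Rightarrow> bool" where
  "strong_interlacing F n \<longleftrightarrow>
     (\<forall>m. 2 \<le> m \<and> m < n \<longrightarrow> real_rooted (h_uniform F (full_simplex m))) \<and>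
     (\<forall>m. 2 \<le> m \<and> m \<le> n \<longrightarrow>
        theta F m = 0 \<or>
        (real_rooted (theta F m) \<and> degree (theta F m) = m - 1 \<and>
         (\<forall>k. 0 \<le> coeff (theta F m) k) \<and>
         interlaces (h_uniform F (full_simplex (m - 1))) (theta F m)))"

end

theory Submission
  imports Defs "HOL-Computational_Algebra.Computational_Algebra" "HOL-Library.FuncSet"
begin

text \<open>A lattice point of the \<open>n\<close>-fold dilation is a unique nonnegative integer combination of the
  vertices of one face of the edgewise subdivision, and a multichain of \<open>n\<close> faces is a height
  function on the vertices. Hence the \<open>n\<close>-th coefficient of the Hilbert series of
  \<open>sd\<^sub>r(\<sigma>\<^sub>m)\<close> is \<open>(r n + 1)\<^sup>m - (r n)\<^sup>m\<close>, with a second difference of \<open>m\<close>-th powers for the boundary.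
  Telescoping such differences shows that the \<open>h\<close>-polynomials of \<open>sd\<^sub>r(\<sigma>\<^sub>m)\<close> and \<open>sd\<^sub>r(\<partial>\<sigma>\<^sub>m)\<close>, and
  therefore \<open>\<theta>\<close>, are sums of polynomials \<open>Q\<^sub>m\<^sub>k\<close> obeying a recursion
  \<open>Q\<^sub>m\<^sub>+\<^sub>1\<^sub>,\<^sub>k = \<Sum>\<^bsub>i<c\<^esub> Q\<^sub>m\<^sub>i + x \<Sum>\<^bsub>i\<ge>c\<^esub> Q\<^sub>m\<^sub>i\<close> in which \<open>c\<close> is nondecreasing in \<open>k\<close>.
  For \<open>z\<close> in the upper half plane the arguments of the values \<open>Q\<^sub>m\<^sub>k(z)\<close> decrease in \<open>k\<close> within a
  sector of width \<open>\<pi> - arg z\<close>; this is a bilinear condition, preserved by the recursion, and it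
  forces real-rootedness and interlacing.\<close>

section \<open>Interlacing from the argument in the upper half plane\<close>

text \<open>All counting passes through one invariant, \<open>hilbert_fps\<close>: (1-x)^d times it
  is the h-polynomial in rank d, it determines every face number, and for a subdivision it can be
  computed by bijections whose result does not see the vertex order. That independence is what makes
  the f-triangle well defined. One tool feeds all the bijections, the unique weights on a chain of
  sets in \<open>layering\<close>. It is applied to points and multichains of the barycentric
  subdivision and, for the edgewise subdivision, to scaled fractional parts of prefix sums. Real and
  integral weights are treated together, so the same lemmas give the geometric bijection and the
  count. The polynomials of interest obey no recursion among themselves. The family is therefore
  enlarged to simplices with some facets removed, at all dilations n r + s with s < r; partial
  summation of their counts then raises the number of vertices by one. The f-triangle is a definite
  description and its operators are a choice, so existence, uniqueness and preservation of the rank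
  must be proved before any h-polynomial can be named.\<close>

abbreviation cpoly :: "real poly \<Rightarrow> complex \<Rightarrow> complex" where
  "cpoly p z \<equiv> poly (map_poly complex_of_real p) z"

lemma map_poly_of_real_mult:
  "map_poly complex_of_real (p * q) = map_poly complex_of_real p * map_poly complex_of_real q"
  by (intro poly_eqI) (simp add: coeff_map_poly coeff_mult)

lemma cpoly_add: "cpoly (p + q) z = cpoly p z + cpoly q z"
proof -
  have "map_poly complex_of_real (p + q) = map_poly complex_of_real p + map_poly complex_of_real q"
    by (intro poly_eqI) (simp add: coeff_map_poly)
  then show ?thesis
    by simp
qed

lemma cpoly_mult: "cpoly (p * q) z = cpoly p z * cpoly q z"
  by (simp add: map_poly_of_real_mult)

lemma cpoly_sum: "cpoly (\<Sum>i\<in>A. p i) z = (\<Sum>i\<in>A. cpoly (p i) z)"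
  by (induction A rule: infinite_finite_induct) (simp_all add: cpoly_add)

lemma cpoly_pCons: "cpoly (pCons a p) z = of_real a + z * cpoly p z"
  by (cases "pCons a p = 0") (auto simp: map_poly_pCons)

lemma cpoly_of_real: "cpoly p (of_real x) = of_real (poly p x)"
  by (induction p) (auto simp: cpoly_pCons)

text \<open>Nonreal roots of a real polynomial come in conjugate pairs, so the open upper half plane
  is the only region that has to be examined.\<close>

lemma real_rooted_if_no_upper_root:
  assumes "\<And>z. Im z > 0 \<Longrightarrow> cpoly p z \<noteq> 0"
  shows "real_rooted p"
  unfolding real_rooted_def
proof (intro disjI2 allI impI)
  fix z assume z: "cpoly p z = 0"
  have "cpoly p (cnj z) = 0"
    using z by (subst real_poly_cnj_root_iff) (auto simp: coeff_map_poly)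
  then have "\<not> Im z > 0" "\<not> Im (cnj z) > 0"
    using z assms by blast+
  then show "z \<in> \<real>"
    by (simp add: complex_is_Real_iff)
qed

text \<open>\<open>proots\<close> sees real roots only. Splitting off one linear factor at a time by
  the fundamental theorem of algebra shows that here they account for the whole degree.\<close>

lemma real_rooted_split:
  assumes "p \<noteq> 0" "real_rooted p"
  shows "p = smult (lead_coeff p) (\<Prod>x\<in>#proots p. [:-x, 1:]) \<and> size (proots p) = degree p"
  using assms
proof (induction "degree p" arbitrary: p)
  case 0
  then obtain c where "p = [:c:]"
    by (metis degree_eq_zeroE)
  then show ?case
    by simp
next
  case (Suc n)
  have "\<not> constant (poly (map_poly complex_of_real p))"
    using Suc.hyps(2) by (simp add: constant_degree degree_map_poly)
  then obtain z where z: "cpoly p z = 0"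
    using fundamental_theorem_of_algebra by blast
  then have "z \<in> \<real>"
    using Suc.prems by (auto simp: real_rooted_def)
  then obtain a where a: "z = of_real a"
    by (auto elim: Reals_cases)
  then have "poly p a = 0"
    using z by (simp add: cpoly_of_real)
  then obtain q where q: "p = [:-a, 1:] * q"
    by (metis poly_eq_0_iff_dvd dvdE)
  then have q0: "q \<noteq> 0"
    using Suc.prems by auto
  have deg: "degree p = Suc (degree q)"
    using degree_mult_eq[of "[:-a, 1:]" q] q q0 by simp
  have "real_rooted q"
    using Suc.prems cpoly_mult[of "[:-a, 1:]" q] unfolding real_rooted_def q by auto
  then have IH: "q = smult (lead_coeff q) (\<Prod>x\<in>#proots q. [:-x, 1:])" "size (proots q) = degree q"
    using Suc.hyps(1)[of q] Suc.hyps(2) deg q0 by auto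
  have pr: "proots p = add_mset a (proots q)"
    using proots_mult[of "[:-a, 1:]" q] q q0 proots_linear_factor[of "-a"] by simp
  have lc: "lead_coeff p = lead_coeff q"
    using lead_coeff_mult[of "[:-a, 1:]" q] q by simp
  have "p = [:-a, 1:] * smult (lead_coeff q) (\<Prod>x\<in>#proots q. [:-x, 1:])"
    using q IH(1) by metis
  also have "\<dots> = smult (lead_coeff p) (\<Prod>x\<in>#proots p. [:-x, 1:])"
    unfolding pr lc by (simp add: mult_smult_right del: mult_pCons_left)
  finally show ?case
    using pr IH(2) deg by simp
qed

lemma cpoly_split:
  assumes "p \<noteq> 0" "real_rooted p"
  shows "cpoly p z = of_real (lead_coeff p) * (\<Prod>x\<in>#proots p. z - of_real x)"
proof -
  have *: "cpoly (smult c (\<Prod>x\<in>#A. [:-x, 1:])) z = of_real c * (\<Prod>x\<in>#A. z - of_real x)" for c A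
  proof (induction A)
    case empty
    then show ?case
      by (cases "c = 0") (simp_all add: map_poly_smult map_poly_pCons)
  next
    case (add x A)
    have "smult c (\<Prod>x\<in>#add_mset x A. [:-x, 1:]) = [:-x, 1:] * smult c (\<Prod>x\<in>#A. [:-x, 1:])"
      by (simp add: mult_smult_right del: mult_pCons_left)
    then show ?case
      using add by (simp add: cpoly_mult cpoly_pCons algebra_simps del: mult_pCons_left mult_smult_right)
  qed
  show ?thesis
    using *[of "lead_coeff p" "proots p"] real_rooted_split[OF assms] by simp
qed

text \<open>The argument of \<open>z - x\<close> at \<open>z = t + i y\<close>, as a continuous function of \<open>y > 0\<close>.\<close>

definition view_angle :: "real \<Rightarrow> real \<Rightarrow> real \<Rightarrow> real" where
  "view_angle t x y = pi / 2 - arctan ((t - x) / y)"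

lemma Complex_eq_view_angle:
  assumes "y > 0"
  shows "\<exists>\<rho>>0. Complex t y - of_real x = of_real \<rho> * cis (view_angle t x y)"
proof (intro exI conjI)
  define s where "s = sqrt (1 + ((t - x) / y)\<^sup>2)"
  have s: "s > 0"
    by (simp add: s_def add_pos_nonneg)
  then show "y * s > 0"
    using assms by simp
  have "cos (view_angle t x y) = ((t - x) / y) / s" "sin (view_angle t x y) = 1 / s"
    by (simp_all add: view_angle_def cos_diff sin_diff sin_arctan cos_arctan s_def)
  then show "Complex t y - of_real x = of_real (y * s) * cis (view_angle t x y)"
    using assms s by (simp add: complex_eq_iff)
qed

lemma prod_mset_view_angle:
  assumes "y > 0"
  shows "\<exists>\<rho>>0. (\<Prod>x\<in>#A. Complex t y - of_real x)
    = of_real \<rho> * cis (\<Sum>x\<in>#A. view_angle t x y)"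
proof (induction A)
  case empty
  then show ?case
    by (intro exI[of _ 1]) simp
next
  case (add x A)
  then obtain \<rho> where "\<rho> > 0" "(\<Prod>x\<in>#A. Complex t y - of_real x)
    = of_real \<rho> * cis (\<Sum>x\<in>#A. view_angle t x y)"
    by blast
  moreover obtain \<sigma> where "\<sigma> > 0" "Complex t y - of_real x = of_real \<sigma> * cis (view_angle t x y)"
    using Complex_eq_view_angle[OF assms] by blast
  ultimately show ?case
    by (intro exI[of _ "\<sigma> * \<rho>"]) (simp add: cis_mult[symmetric] mult_ac)
qed

lemma continuous_on_sum_view_angle:
  "continuous_on {0<..} (\<lambda>y. \<Sum>x\<in>#A. view_angle t x y)"
  by (induction A) (auto intro!: continuous_intros simp: view_angle_def)

lemma view_angle_at_top: "(view_angle t x \<longlongrightarrow> pi / 2) at_top"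
proof -
  have "((\<lambda>y. (t - x) / y) \<longlongrightarrow> 0) at_top"
    by (intro tendsto_divide_0[OF tendsto_const] filterlim_at_top_imp_at_infinity filterlim_ident)
  then have "((\<lambda>y. pi / 2 - arctan ((t - x) / y)) \<longlongrightarrow> pi / 2 - arctan 0) at_top"
    by (intro tendsto_intros)
  then show ?thesis
    by (simp add: view_angle_def[abs_def])
qed

lemma sum_view_angle_at_top:
  "((\<lambda>y. \<Sum>x\<in>#A. view_angle t x y) \<longlongrightarrow> pi / 2 * size A) at_top"
proof (induction A)
  case (add x A)
  then have "((\<lambda>y. view_angle t x y + (\<Sum>x\<in>#A. view_angle t x y)) \<longlongrightarrow> pi / 2 + pi / 2 * size A) at_top"
    by (intro tendsto_add view_angle_at_top)
  then show ?case
    by (simp add: algebra_simps add_divide_distrib)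
qed simp

text \<open>Near the real axis \<open>z - x\<close> points to the left if the root lies to the right
  of \<open>t\<close>, and to the right otherwise. Hence a sum of view angles tends to pi times the
  number of roots beyond \<open>t\<close>.\<close>

lemma view_angle_at_0:
  assumes "x \<noteq> t"
  shows "(view_angle t x \<longlongrightarrow> (if x > t then pi else 0)) (at_right 0)"
proof -
  have inv: "filterlim (\<lambda>y. inverse y :: real) at_top (at_right 0)"
    by (rule filterlim_inverse_at_top_right)
  have eq: "view_angle t x = (\<lambda>y. pi / 2 - arctan ((t - x) * inverse y))"
    unfolding view_angle_def divide_inverse ..
  show ?thesis
  proof (cases "x > t")
    case True
    then have "filterlim (\<lambda>y. (t - x) * inverse y) at_bot (at_right 0)"
      using filterlim_tendsto_neg_mult_at_bot[OF tendsto_const _ inv, of "t - x"] by simp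
    then have "((\<lambda>y. arctan ((t - x) * inverse y)) \<longlongrightarrow> - (pi / 2)) (at_right 0)"
      by (rule filterlim_compose[OF tendsto_arctan_at_bot])
    then have "((\<lambda>y. pi / 2 - arctan ((t - x) * inverse y)) \<longlongrightarrow> pi / 2 - - (pi / 2)) (at_right 0)"
      by (intro tendsto_intros)
    then show ?thesis
      using True unfolding eq by simp
  next
    case False
    then have "t - x > 0"
      using assms by linarith
    then have "filterlim (\<lambda>y. (t - x) * inverse y) at_top (at_right 0)"
      by (rule filterlim_tendsto_pos_mult_at_top[OF tendsto_const _ inv])
    then have "((\<lambda>y. arctan ((t - x) * inverse y)) \<longlongrightarrow> (pi / 2)) (at_right 0)"
      by (rule filterlim_compose[OF tendsto_arctan_at_top])
    then have "((\<lambda>y. pi / 2 - arctan ((t - x) * inverse y)) \<longlongrightarrow> pi / 2 - (pi / 2)) (at_right 0)"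
      by (intro tendsto_intros)
    then show ?thesis
      using False unfolding eq by simp
  qed
qed

lemma sum_view_angle_at_0:
  assumes "t \<notin># A"
  shows "((\<lambda>y. \<Sum>x\<in>#A. view_angle t x y) \<longlongrightarrow> pi * size (filter_mset (\<lambda>x. x > t) A)) (at_right 0)"
  using assms
proof (induction A)
  case (add x A)
  then have "((\<lambda>y. view_angle t x y + (\<Sum>x\<in>#A. view_angle t x y)) \<longlongrightarrow>
     (if x > t then pi else 0) + pi * size (filter_mset (\<lambda>x. x > t) A)) (at_right 0)"
    by (intro tendsto_add view_angle_at_0) auto
  then show ?case
    by (simp add: algebra_simps split: if_splits)
qed simp

text \<open>The intervals on which the sine is nonnegative are separated by gaps that a continuous
  function cannot jump; the limit pi/2 selects the interval from 0 to pi.\<close>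

lemma sin_nonneg_imp_bounded:
  fixes \<Theta> :: "real \<Rightarrow> real"
  assumes cont: "continuous_on {0<..} \<Theta>"
    and lim: "(\<Theta> \<longlongrightarrow> pi / 2) at_top"
    and sin: "\<And>y. y > 0 \<Longrightarrow> sin (\<Theta> y) \<ge> 0"
    and y: "y > 0"
  shows "0 \<le> \<Theta> y \<and> \<Theta> y \<le> pi"
proof -
  have "eventually (\<lambda>u. \<Theta> u > 0 \<and> \<Theta> u < pi \<and> u > y) at_top"
    by (intro eventually_conj order_tendstoD[OF lim] eventually_gt_at_top) auto
  then obtain u where u: "\<Theta> u > 0" "\<Theta> u < pi" "u > y"
    by (auto dest: eventually_happens)
  have cont': "continuous_on {y..u} \<Theta>"
    using y by (intro continuous_on_subset[OF cont]) auto
  show ?thesis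
  proof (rule ccontr)
    assume "\<not> ?thesis"
    then consider "\<Theta> y < 0" | "\<Theta> y > pi"
      by linarith
    then show False
    proof cases
      case 1
      \<comment> \<open>Clipping at -pi/2 keeps \<open>v\<close> strictly between -pi and 0, where
        the sine is negative, and still between the two values needed for the intermediate value
        theorem.\<close>
      define v where "v = max (\<Theta> y) (- (pi / 2))"
      have v: "v < 0" "v > - pi"
        using 1 pi_gt_zero by (auto simp: v_def max_def)
      have "\<exists>x\<ge>y. x \<le> u \<and> \<Theta> x = v"
        using u v cont' by (intro IVT') (auto simp: v_def)
      then obtain w where "w > 0" "\<Theta> w = v"
        using y less_le_trans by blast
      moreover have "sin v < 0"
        using v sin_gt_zero[of "- v"] by simp
      ultimately show False
        using sin[of w] by auto
    next
      case 2
      define v where "v = min (\<Theta> y) (3 * pi / 2)"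
      have v: "v < 2 * pi" "v > pi"
        using 2 pi_gt_zero by (auto simp: v_def min_def)
      have "\<exists>x\<ge>y. x \<le> u \<and> \<Theta> x = v"
        using u v cont' by (intro IVT2') (auto simp: v_def)
      then obtain w where "w > 0" "\<Theta> w = v"
        using y less_le_trans by blast
      moreover have "sin v < 0"
        using v by (intro sin_lt_zero) auto
      ultimately show False
        using sin[of w] by auto
    qed
  qed
qed

section \<open>Root counts along a vertical line\<close>

abbreviation roots_above :: "real \<Rightarrow> real poly \<Rightarrow> nat" where
  "roots_above t p \<equiv> size (filter_mset (\<lambda>x. x > t) (proots p))"

text \<open>An argument in the style of Hermite and Biehler. On the vertical line over
  \<open>t\<close>, the difference of the arguments of \<open>q\<close> and \<open>p\<close> tends
  to pi/2 at infinity because the degrees differ by one, stays between 0 and pi by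
  \<open>im\<close>, and tends at the real axis to pi times the difference of the two root
  counts.\<close>

lemma root_count_of_upper_half_plane:
  fixes p q :: "real poly"
  assumes p: "real_rooted p" "lead_coeff p > 0"
    and q: "real_rooted q" "lead_coeff q > 0"
    and deg: "degree q = degree p + 1"
    and im: "\<And>z. Im z > 0 \<Longrightarrow> 0 \<le> Im (cpoly q z * cnj (cpoly p z))"
  shows "roots_above t p \<le> roots_above t q \<and>
    roots_above t q \<le> roots_above t p + 1"
proof -
  have nz: "p \<noteq> 0" "q \<noteq> 0"
    using p q by auto
  have main: "roots_above t p \<le> roots_above t q \<and>
    roots_above t q \<le> roots_above t p + 1"
    if t: "t \<notin># proots p" "t \<notin># proots q" for t
  proof -
    define \<Theta> where "\<Theta> y = (\<Sum>x\<in>#proots q. view_angle t x y) - (\<Sum>x\<in>#proots p. view_angle t x y)" for y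
    have sin: "sin (\<Theta> y) \<ge> 0" if y: "y > 0" for y
    proof -
      obtain \<rho> where \<rho>: "\<rho> > 0" "(\<Prod>x\<in>#proots q. Complex t y - of_real x)
          = of_real \<rho> * cis (\<Sum>x\<in>#proots q. view_angle t x y)"
        using prod_mset_view_angle[OF y] by blast
      obtain \<sigma> where \<sigma>: "\<sigma> > 0" "(\<Prod>x\<in>#proots p. Complex t y - of_real x)
          = of_real \<sigma> * cis (\<Sum>x\<in>#proots p. view_angle t x y)"
        using prod_mset_view_angle[OF y] by blast
      have cis: "cis (\<Theta> y) = cis (\<Sum>x\<in>#proots q. view_angle t x y) *
          cnj (cis (\<Sum>x\<in>#proots p. view_angle t x y))"
        unfolding \<Theta>_def cis_cnj cis_mult by simp
      have "cpoly q (Complex t y) * cnj (cpoly p (Complex t y)) =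
        of_real (lead_coeff q * lead_coeff p * \<rho> * \<sigma>) * cis (\<Theta> y)"
        unfolding cis by (simp add: cpoly_split nz p q \<rho> \<sigma> mult_ac)
      also have "Im \<dots> = (lead_coeff q * lead_coeff p * \<rho> * \<sigma>) * sin (\<Theta> y)"
        by simp
      finally have "0 \<le> (lead_coeff q * lead_coeff p * \<rho> * \<sigma>) * sin (\<Theta> y)"
        using im[of "Complex t y"] y by simp
      moreover have "lead_coeff q * lead_coeff p * \<rho> * \<sigma> > 0"
        using p q \<rho> \<sigma> by simp
      ultimately show ?thesis
        by (simp add: zero_le_mult_iff)
    qed
    have "(\<Theta> \<longlongrightarrow> pi / 2 * size (proots q) - pi / 2 * size (proots p)) at_top"
      unfolding \<Theta>_def by (intro tendsto_diff sum_view_angle_at_top)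
    then have lim: "(\<Theta> \<longlongrightarrow> pi / 2) at_top"
      using real_rooted_split[OF nz(1) p(1)] real_rooted_split[OF nz(2) q(1)] deg
      by (simp add: algebra_simps add_divide_distrib)
    have "continuous_on {0<..} \<Theta>"
      unfolding \<Theta>_def by (intro continuous_on_diff continuous_on_sum_view_angle)
    then have bound: "0 \<le> \<Theta> y \<and> \<Theta> y \<le> pi" if "y > 0" for y
      using sin_nonneg_imp_bounded lim sin that by blast
    let ?P = "roots_above t p"
    let ?Q = "roots_above t q"
    have lim0: "(\<Theta> \<longlongrightarrow> pi * ?Q - pi * ?P) (at_right 0)"
      unfolding \<Theta>_def using t by (intro tendsto_diff sum_view_angle_at_0)
    have "0 \<le> pi * ?Q - pi * ?P"
      using bound
      by (intro tendsto_lowerbound[OF lim0]) (auto intro!: eventually_mono[OF eventually_at_right_less])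
    moreover have "pi * ?Q - pi * ?P \<le> pi"
      using bound
      by (intro tendsto_upperbound[OF lim0]) (auto intro!: eventually_mono[OF eventually_at_right_less])
    ultimately have "0 \<le> pi * (real ?Q - real ?P)" "pi * (real ?Q - real ?P) \<le> pi * 1"
      by (simp_all add: algebra_simps)
    then have "0 \<le> real ?Q - real ?P" "real ?Q - real ?P \<le> 1"
      using pi_gt_zero by (simp_all only: zero_le_mult_iff mult_le_cancel_left_pos) linarith+
    then show ?thesis
      by linarith
  qed
  \<comment> \<open>The limit at the real axis requires that \<open>t\<close> is not a root. Moving
    it to the right, but short of the next root of \<open>p\<close> or \<open>q\<close>, preserves
    both counts because they are strict.\<close>
  define R where "R = {x \<in> {x. poly p x = 0} \<union> {x. poly q x = 0}. x > t}"
  have fin: "finite R"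
    unfolding R_def using nz by (simp add: poly_roots_finite)
  obtain t' where t': "t < t'" "\<And>x. x \<in> R \<Longrightarrow> t' < x"
  proof (cases "R = {}")
    case True
    then show ?thesis
      using that[of "t + 1"] by simp
  next
    case False
    then have "Min R > t"
      using fin by (auto simp: R_def)
    then obtain u where "t < u" "u < Min R"
      using dense by blast
    then show ?thesis
      using that[of u] fin by (metis Min_le less_le_trans)
  qed
  have "t < x \<longleftrightarrow> t' < x" if "poly p x = 0 \<or> poly q x = 0" for x
    using t' that less_trans by (auto simp: R_def)
  then have eq: "filter_mset (\<lambda>x. x > t) (proots f) = filter_mset (\<lambda>x. x > t') (proots f)"
    if "f \<in> {p, q}" for f
    using that nz by (intro filter_mset_cong) auto
  show ?thesis
    using main[of t'] t' nz eq[of p] eq[of q] by (auto simp: R_def)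
qed

lemma length_roots_desc [simp]: "length (roots_desc p) = size (proots p)"
  by (metis length_rev mset_sorted_list_of_multiset roots_desc_def size_mset)

lemma roots_desc_antimono:
  assumes "i \<le> j" "j < length (roots_desc p)"
  shows "roots_desc p ! j \<le> roots_desc p ! i"
proof -
  have "sorted (sorted_list_of_multiset (proots p))"
    by simp
  then show ?thesis
    unfolding roots_desc_def using assms by (simp add: rev_nth roots_desc_def sorted_nth_mono)
qed

lemma root_count_conv_card:
  "roots_above t p = card {i. i < length (roots_desc p) \<and> roots_desc p ! i > t}"
proof -
  have "filter_mset (\<lambda>x. x > t) (proots p) = mset (filter (\<lambda>x. x > t) (roots_desc p))"
    by (simp add: roots_desc_def)
  then show ?thesis
    by (metis length_filter_conv_card size_mset)
qed

text \<open>The two root counts differ by 0 or 1 at every threshold. If \<alpha>_i > \<beta>_i, the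
  threshold \<beta>_i has at least i+1 roots of \<open>p\<close> but at most i roots of
  \<open>q\<close> above it; if \<beta>_(i+1) > \<alpha>_i, the threshold \<alpha>_i has at least
  i+2 roots of \<open>q\<close> but at most i of \<open>p\<close>.\<close>

lemma interlaces_of_upper_half_plane:
  fixes p q :: "real poly"
  assumes p: "\<And>z. Im z > 0 \<Longrightarrow> cpoly p z \<noteq> 0" "lead_coeff p > 0"
    and q: "\<And>z. Im z > 0 \<Longrightarrow> cpoly q z \<noteq> 0" "lead_coeff q > 0"
    and deg: "degree q = degree p + 1"
    and im: "\<And>z. Im z > 0 \<Longrightarrow> 0 \<le> Im (cpoly q z * cnj (cpoly p z))"
  shows "interlaces p q"
proof -
  have nz: "p \<noteq> 0" "q \<noteq> 0"
    using p q by auto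
  have rr: "real_rooted p" "real_rooted q"
    using p q real_rooted_if_no_upper_root by blast+
  note cnt = root_count_of_upper_half_plane[OF rr(1) p(2) rr(2) q(2) deg im]
  define \<alpha> \<beta> where "\<alpha> = roots_desc p" and "\<beta> = roots_desc q"
  have len: "length \<beta> = length \<alpha> + 1"
    using real_rooted_split[OF nz(1) rr(1)] real_rooted_split[OF nz(2) rr(2)] deg
    by (simp add: \<alpha>_def \<beta>_def)
  define NA NB where "NA t = {i. i < length \<alpha> \<and> \<alpha> ! i > t}" and "NB t = {i. i < length \<beta> \<and> \<beta> ! i > t}" for t
  have fin: "finite (NA t)" "finite (NB t)" for t
    by (simp_all add: NA_def NB_def)
  have c: "card (NA t) \<le> card (NB t)" "card (NB t) \<le> card (NA t) + 1" for t
    using cnt[of t] by (simp_all add: root_count_conv_card \<alpha>_def \<beta>_def NA_def NB_def del: length_roots_desc)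
  have mono: "\<And>i j. i \<le> j \<Longrightarrow> j < length \<alpha> \<Longrightarrow> \<alpha> ! j \<le> \<alpha> ! i"
    "\<And>i j. i \<le> j \<Longrightarrow> j < length \<beta> \<Longrightarrow> \<beta> ! j \<le> \<beta> ! i"
    unfolding \<alpha>_def \<beta>_def by (rule roots_desc_antimono; assumption)+
  have 1: "\<alpha> ! i \<le> \<beta> ! i" if i: "i < length \<alpha>" for i
  proof (rule ccontr)
    assume *: "\<not> \<alpha> ! i \<le> \<beta> ! i"
    have "{..i} \<subseteq> NA (\<beta> ! i)"
      using * i mono(1)[of _ i] by (force simp: NA_def)
    then have "card {..i} \<le> card (NA (\<beta> ! i))"
      using fin by (intro card_mono)
    moreover have "NB (\<beta> ! i) \<subseteq> {..<i}"
    proof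
      fix k assume "k \<in> NB (\<beta> ! i)"
      then have "\<not> i \<le> k"
        using mono(2)[of i k] by (auto simp: NB_def)
      then show "k \<in> {..<i}"
        by simp
    qed
    then have "card (NB (\<beta> ! i)) \<le> card {..<i}"
      by (intro card_mono) auto
    ultimately show False
      using c[of "\<beta> ! i"] by simp
  qed
  have 2: "\<beta> ! (i + 1) \<le> \<alpha> ! i" if i: "i + 1 < length \<beta>" for i
  proof (rule ccontr)
    assume *: "\<not> \<beta> ! (i + 1) \<le> \<alpha> ! i"
    have "{..i + 1} \<subseteq> NB (\<alpha> ! i)"
      using * i mono(2)[of _ "i + 1"] by (force simp: NB_def)
    then have "card {..i + 1} \<le> card (NB (\<alpha> ! i))"
      using fin by (intro card_mono)
    moreover have "NA (\<alpha> ! i) \<subseteq> {..<i}"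
    proof
      fix k assume "k \<in> NA (\<alpha> ! i)"
      then have "\<not> i \<le> k"
        using mono(1)[of i k] by (auto simp: NA_def)
      then show "k \<in> {..<i}"
        by simp
    qed
    then have "card (NA (\<alpha> ! i)) \<le> card {..<i}"
      by (intro card_mono) auto
    ultimately show False
      using c[of "\<alpha> ! i"] by simp
  qed
  show ?thesis
    unfolding interlaces_def Let_def using nz rr len 1 2 by (auto simp: \<alpha>_def \<beta>_def)
qed

section \<open>Colored Eulerian polynomials\<close>

text \<open>For nonzero values this says \<open>0 \<le> arg b - arg a \<le> \<pi> - arg z\<close>.\<close>

definition arg_le :: "complex \<Rightarrow> complex \<Rightarrow> complex \<Rightarrow> bool" where
  "arg_le z a b \<longleftrightarrow> 0 \<le> Im (b * cnj a) \<and> 0 \<le> Im (z * a * cnj b)"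

lemma arg_le_0 [simp]: "arg_le z 0 b" "arg_le z a 0"
  by (simp_all add: arg_le_def)

lemma arg_le_add_left: "arg_le z a c \<Longrightarrow> arg_le z b c \<Longrightarrow> arg_le z (a + b) c"
  unfolding arg_le_def complex_cnj_add distrib_left distrib_right by simp

lemma arg_le_add_right: "arg_le z a b \<Longrightarrow> arg_le z a c \<Longrightarrow> arg_le z a (b + c)"
  unfolding arg_le_def complex_cnj_add distrib_left distrib_right by simp

lemma arg_le_sum_left: "(\<And>i. i \<in> A \<Longrightarrow> arg_le z (f i) b) \<Longrightarrow> arg_le z (\<Sum>i\<in>A. f i) b"
  by (induction A rule: infinite_finite_induct) (simp_all add: arg_le_add_left)

lemma arg_le_sum_right: "(\<And>i. i \<in> A \<Longrightarrow> arg_le z a (f i)) \<Longrightarrow> arg_le z a (\<Sum>i\<in>A. f i)"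
  by (induction A rule: infinite_finite_induct) (simp_all add: arg_le_add_right)

text \<open>The second inequality of \<open>arg_le\<close> places \<open>b\<close> between the
  directions of \<open>a\<close> and \<open>z * a\<close>, so the angle from \<open>a\<close> to
  \<open>b\<close> is at most the argument of \<open>z\<close> itself. Here \<open>a\<close>,
  \<open>b\<close>, \<open>g\<close> are the late, middle and early part of a sequence, and two cuts
  are compared, one on either side of \<open>b\<close>. Expanding both products leaves only
  hypotheses with nonnegative factors and squares weighted by \<open>Im z\<close>.\<close>

lemma arg_le_step:
  assumes z: "Im z > 0" and ab: "arg_le z a b" and ag: "arg_le z a g" and bg: "arg_le z b g"
  shows "arg_le z (z * a + b + g) (z * a + z * b + g)"
proof -
  have "Im ((z * a + z * b + g) * cnj (z * a + b + g)) = Im (z * a * cnj b)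
    + (cmod z)\<^sup>2 * Im (b * cnj a) + Im z * (cmod b)\<^sup>2 + Im (z * b * cnj g) + Im (g * cnj b)"
    unfolding cmod_power2 by (simp add: algebra_simps power2_eq_square)
  also have "0 \<le> \<dots>"
    using z ab bg by (simp add: arg_le_def)
  finally have 1: "0 \<le> Im ((z * a + z * b + g) * cnj (z * a + b + g))" .
  have "Im (z * (z * a + b + g) * cnj (z * a + z * b + g)) = Im z * (cmod (z * a + g))\<^sup>2
    + (cmod z)\<^sup>2 * Im (z * a * cnj b) + (cmod z)\<^sup>2 * Im (b * cnj a) + Im (z * b * cnj g)
    + (cmod z)\<^sup>2 * Im (g * cnj b)"
    unfolding cmod_power2 by (simp add: algebra_simps power2_eq_square)
  also have "0 \<le> \<dots>"
    using z ab bg by (simp add: arg_le_def)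
  finally show ?thesis
    using 1 by (simp add: arg_le_def)
qed

text \<open>Nonzero values related by \<open>arg_le\<close> enclose an angle of at most the argument
  of \<open>z\<close>, which is below pi, so they cannot cancel.\<close>

lemma arg_le_add_eq_0:
  assumes z: "Im z > 0" and "arg_le z a b" "a + b = 0"
  shows "a = 0 \<and> b = 0"
proof -
  have "a = - b"
    using assms(3) by (simp add: eq_neg_iff_add_eq_0)
  then have "Im (z * a * cnj b) = - (Im z * (cmod b)\<^sup>2)"
    unfolding cmod_power2 by (simp add: algebra_simps power2_eq_square)
  then have "Im z * (cmod b)\<^sup>2 \<le> 0"
    using assms(2) by (simp add: arg_le_def)
  then have "b = 0"
    using z by (simp add: mult_le_0_iff)
  then show ?thesis
    using \<open>a = - b\<close> by simp
qed

text \<open>The direction of \<open>z * a\<close> is ahead of that of \<open>b\<close> by an angle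
  between 0 and the argument of \<open>z\<close>; again no cancellation is possible.\<close>

lemma arg_le_mult_add_eq_0:
  assumes z: "Im z > 0" and "arg_le z a b" "z * a + b = 0"
  shows "a = 0 \<and> b = 0"
proof -
  have "b = - (z * a)"
    using assms(3) by (simp add: eq_neg_iff_add_eq_0 add.commute)
  then have "Im (b * cnj a) = - (Im z * (cmod a)\<^sup>2)"
    unfolding cmod_power2 by (simp add: algebra_simps power2_eq_square)
  then have "Im z * (cmod a)\<^sup>2 \<le> 0"
    using assms(2) by (simp add: arg_le_def)
  then have "a = 0"
    using z by (simp add: mult_le_0_iff)
  then show ?thesis
    using \<open>b = - (z * a)\<close> by simp
qed

text \<open>All pairs are compared, not only neighbours: \<open>arg_le\<close> holds trivially at 0
  and so is not transitive, and at level 0 every value but the first is 0.\<close>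

definition arg_decreasing :: "complex \<Rightarrow> nat \<Rightarrow> (nat \<Rightarrow> complex) \<Rightarrow> bool" where
  "arg_decreasing z w v \<longleftrightarrow> (\<forall>i j. i < j \<longrightarrow> j < w \<longrightarrow> arg_le z (v j) (v i))"

lemma arg_decreasing_sum_eq_0:
  assumes z: "Im z > 0" and v: "arg_decreasing z w v"
    and "b \<le> w" "(\<Sum>i=a..<b. v i) = 0" "a \<le> i" "i < b"
  shows "v i = 0"
  using assms(3-)
proof (induction b arbitrary: i)
  case (Suc b)
  have ab: "a \<le> b"
    using Suc.prems by simp
  have "arg_le z (v b) (\<Sum>i=a..<b. v i)"
    using v Suc.prems by (intro arg_le_sum_right) (auto simp: arg_decreasing_def)
  moreover have "v b + (\<Sum>i=a..<b. v i) = 0"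
    using Suc.prems ab by (simp add: add.commute)
  ultimately have "v b = 0" "(\<Sum>i=a..<b. v i) = 0"
    using arg_le_add_eq_0[OF z] by blast+
  then show ?case
    using Suc.IH[of i] Suc.prems by (cases "i = b") auto
qed simp

lemma sum_split_at:
  fixes f g :: "nat \<Rightarrow> 'a::comm_monoid_add"
  assumes "c \<le> w"
  shows "(\<Sum>i<w. if i < c then f i else g i) = (\<Sum>i=0..<c. f i) + (\<Sum>i=c..<w. g i)"
proof -
  have "(\<Sum>i<w. if i < c then f i else g i) = (\<Sum>i=0..<c. if i < c then f i else g i)
      + (\<Sum>i=c..<w. if i < c then f i else g i)"
    unfolding lessThan_atLeast0 by (rule sum.atLeastLessThan_concat[OF _ assms, symmetric]) simp
  then show ?thesis
    by simp
qed

text \<open>Cuts move to the right as \<open>k\<close> grows, so the two cuts belonging to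
  \<open>k < l\<close> split the old sequence into three consecutive parts, and the new values are
  the two combinations treated in \<open>arg_le_step\<close>.\<close>

lemma arg_decreasing_step:
  assumes z: "Im z > 0" and v: "arg_decreasing z w v"
    and c: "\<And>k. k < w' \<Longrightarrow> c k \<le> w" "\<And>k l. k \<le> l \<Longrightarrow> c k \<le> c l"
    and v': "\<And>k. k < w' \<Longrightarrow> v' k = (\<Sum>i=0..<c k. v i) + z * (\<Sum>i=c k..<w. v i)"
  shows "arg_decreasing z w' v'"
  unfolding arg_decreasing_def
proof (intro allI impI)
  fix k l assume kl: "k < l" "l < w'"
  define g b a where "g = (\<Sum>i=0..<c k. v i)" and "b = (\<Sum>i=c k..<c l. v i)" and "a = (\<Sum>i=c l..<w. v i)"
  have le: "c k \<le> c l" "c l \<le> w"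
    using kl c by auto
  have rel: "arg_le z (\<Sum>i=s..<t. v i) (\<Sum>i=p..<q. v i)" if "q \<le> s" "t \<le> w" for s t p q
    using v that by (intro arg_le_sum_left arg_le_sum_right) (auto simp: arg_decreasing_def)
  have "arg_le z (z * a + b + g) (z * a + z * b + g)"
    unfolding g_def b_def a_def using z le by (intro arg_le_step rel) auto
  moreover have "(\<Sum>i=0..<c l. v i) = g + b" "(\<Sum>i=c k..<w. v i) = b + a"
    using le by (simp_all add: g_def b_def a_def sum.atLeastLessThan_concat)
  then have "v' l = z * a + b + g" "v' k = z * a + z * b + g"
    using kl v' by (simp_all add: g_def a_def algebra_simps)
  ultimately show "arg_le z (v' l) (v' k)"
    by simp
qed

lemma arg_decreasing_step_nonzero:
  assumes z: "Im z > 0" and v: "arg_decreasing z w v" and "\<exists>i<w. v i \<noteq> 0" and "c \<le> w"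
  shows "(\<Sum>i=0..<c. v i) + z * (\<Sum>i=c..<w. v i) \<noteq> 0"
proof
  assume *: "(\<Sum>i=0..<c. v i) + z * (\<Sum>i=c..<w. v i) = 0"
  have "arg_le z (\<Sum>i=c..<w. v i) (\<Sum>i=0..<c. v i)"
    using v by (intro arg_le_sum_left arg_le_sum_right) (auto simp: arg_decreasing_def)
  then have "(\<Sum>i=c..<w. v i) = 0" "(\<Sum>i=0..<c. v i) = 0"
    using arg_le_mult_add_eq_0[OF z] * by (simp_all add: add.commute)
  then have "v i = 0" if "i < w" for i
    using arg_decreasing_sum_eq_0[OF z v, of c 0 i] arg_decreasing_sum_eq_0[OF z v, of w c i] that \<open>c \<le> w\<close>
    by (cases "i < c") auto
  then show False
    using assms(3) by blast
qed

text \<open>For k = N (m+2) + q with q \<le> m+1 the value is N (m+1) + q. It is the number of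
  initial terms of \<open>gap_seq m\<close> that add up to term \<open>k\<close> of
  \<open>gap_seq (Suc m)\<close>; blocks have m+1 terms at level m and m+2 at the next
  level.\<close>

definition cut_index :: "nat \<Rightarrow> nat \<Rightarrow> nat" where
  "cut_index m k = k div (m + 2) * (m + 1) + k mod (m + 2)"

text \<open>For r = 1 and k \<le> m these are the Eulerian polynomials of permutations of m+1
  letters by descents, refined by the last letter k. The recursion appends a new last letter, which
  creates a descent exactly when the previous letter is not below the cut.\<close>

fun col_eulerian :: "nat \<Rightarrow> nat \<Rightarrow> nat \<Rightarrow> real poly" where
  "col_eulerian r 0 k = (if k = 0 then 1 else 0)"
| "col_eulerian r (Suc m) k =
     (\<Sum>i<r * (m + 1). if i < cut_index m k then col_eulerian r m i else [:0, 1:] * col_eulerian r m i)"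

declare col_eulerian.simps(2) [simp del]

lemma cut_index_mono: "k \<le> l \<Longrightarrow> cut_index m k \<le> cut_index m l"
proof -
  assume kl: "k \<le> l"
  show ?thesis
  proof (cases "k div (m + 2) = l div (m + 2)")
    case True
    have "k mod (m + 2) \<le> l mod (m + 2)"
      using kl div_mult_mod_eq[of k "m + 2"] div_mult_mod_eq[of l "m + 2"] unfolding True by linarith
    then show ?thesis
      unfolding cut_index_def True by simp
  next
    case False
    then have *: "k div (m + 2) + 1 \<le> l div (m + 2)"
      using div_le_mono[OF kl, of "m + 2"] by simp
    have "k mod (m + 2) < m + 2"
      by simp
    then have "cut_index m k \<le> (k div (m + 2) + 1) * (m + 1)"
      unfolding cut_index_def by simp
    also have "\<dots> \<le> l div (m + 2) * (m + 1)"
      using * by (rule mult_le_mono1)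
    finally show ?thesis
      by (simp add: cut_index_def)
  qed
qed

lemma cut_index_le:
  assumes "k < r * (m + 2)"
  shows "cut_index m k \<le> r * (m + 1)"
proof -
  have "k div (m + 2) + 1 \<le> r"
    using assms by (simp add: less_mult_imp_div_less Suc_leI)
  then have "(k div (m + 2) + 1) * (m + 1) \<le> r * (m + 1)"
    by (rule mult_le_mono1)
  moreover have "k mod (m + 2) < m + 2"
    by simp
  then have "cut_index m k \<le> (k div (m + 2) + 1) * (m + 1)"
    unfolding cut_index_def by simp
  ultimately show ?thesis
    by linarith
qed

lemma cut_index_pos: "0 < k \<Longrightarrow> 0 < cut_index m k"
  using div_mult_mod_eq[of k "m + 2"] by (auto simp: cut_index_def)

lemma col_eulerian_Suc:
  assumes "k < r * (m + 2)"
  shows "col_eulerian r (Suc m) k = (\<Sum>i=0..<cut_index m k. col_eulerian r m i)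
    + [:0, 1:] * (\<Sum>i=cut_index m k..<r * (m + 1). col_eulerian r m i)"
  unfolding col_eulerian.simps sum_distrib_left using cut_index_le[OF assms] by (rule sum_split_at)

text \<open>At \<open>m = 0\<close> the values are 1, 0, ..., 0, so for r > 1 only the clause about
  some nonzero value can start the induction. One nonzero value already makes every value of the
  next level nonzero, by \<open>arg_decreasing_step_nonzero\<close>.\<close>

lemma col_eulerian_upper_half_plane:
  assumes z: "Im z > 0" and r: "r > 0"
  shows "arg_decreasing z (r * (m + 1)) (\<lambda>k. cpoly (col_eulerian r m k) z) \<and>
    (\<exists>k<r * (m + 1). cpoly (col_eulerian r m k) z \<noteq> 0) \<and>
    (0 < m \<longrightarrow> (\<forall>k<r * (m + 1). cpoly (col_eulerian r m k) z \<noteq> 0))"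
proof (induction m)
  case 0
  show ?case
    using r by (auto simp: arg_decreasing_def intro!: exI[of _ 0])
next
  case (Suc m)
  have eq: "cpoly (col_eulerian r (Suc m) k) z = (\<Sum>i=0..<cut_index m k. cpoly (col_eulerian r m i) z)
      + z * (\<Sum>i=cut_index m k..<r * (m + 1). cpoly (col_eulerian r m i) z)" if "k < r * (Suc m + 1)" for k
    using that
    by (subst col_eulerian_Suc) (simp_all only: cpoly_add cpoly_mult cpoly_sum, auto simp: cpoly_pCons)
  have "arg_decreasing z (r * (Suc m + 1)) (\<lambda>k. cpoly (col_eulerian r (Suc m) k) z)"
  proof (rule arg_decreasing_step[OF z])
    show "arg_decreasing z (r * (m + 1)) (\<lambda>k. cpoly (col_eulerian r m k) z)"
      using Suc.IH by blast
    show "cut_index m k \<le> r * (m + 1)" if "k < r * (Suc m + 1)" for k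
      using that by (intro cut_index_le) simp
  qed (use cut_index_mono eq in blast)+
  moreover have nz: "cpoly (col_eulerian r (Suc m) k) z \<noteq> 0" if "k < r * (Suc m + 1)" for k
  proof -
    have "cut_index m k \<le> r * (m + 1)"
      using that by (intro cut_index_le) simp
    then show ?thesis
      unfolding eq[OF that] using Suc.IH by (intro arg_decreasing_step_nonzero[OF z]) blast+
  qed
  moreover have "\<exists>k<r * (Suc m + 1). cpoly (col_eulerian r (Suc m) k) z \<noteq> 0"
    using r by (intro exI[of _ 0] conjI nz) auto
  ultimately show ?case
    by blast
qed

section \<open>Degrees and signs of the coefficients\<close>

lemma coeff_col_eulerian_Suc:
  assumes "k < r * (m + 2)"
  shows "coeff (col_eulerian r (Suc m) k) d = (\<Sum>i=0..<cut_index m k. coeff (col_eulerian r m i) d)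
    + (if d = 0 then 0 else \<Sum>i=cut_index m k..<r * (m + 1). coeff (col_eulerian r m i) (d - 1))"
  unfolding col_eulerian_Suc[OF assms] by (simp add: coeff_sum coeff_pCons split: nat.split)

lemma coeff_col_eulerian_nonneg: "k < r * (m + 1) \<Longrightarrow> 0 \<le> coeff (col_eulerian r m k) d"
proof (induction m arbitrary: k d)
  case 0
  then show ?case
    by (simp add: coeff_1)
next
  case (Suc m)
  then have "k < r * (m + 2)"
    by simp
  then show ?case
    using Suc.IH cut_index_le[of k r m]
    by (subst coeff_col_eulerian_Suc) (auto intro!: add_nonneg_nonneg sum_nonneg)
qed

text \<open>A positive index has a positive cut, so the polynomial of index 0, the only one that can
  have degree m, lies below the cut and gains no factor x. At index 0 the cut is 0 and everything
  gains it.\<close>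

lemma coeff_col_eulerian_eq_0:
  "k < r * (m + 1) \<Longrightarrow> m < d \<or> m = d \<and> 0 < k \<Longrightarrow> coeff (col_eulerian r m k) d = 0"
proof (induction m arbitrary: k d)
  case 0
  then show ?case
    by (auto simp: coeff_1)
next
  case (Suc m)
  have k: "k < r * (m + 2)"
    using Suc.prems by simp
  have d: "d > 0" "d > m"
    using Suc.prems by auto
  have "coeff (col_eulerian r m i) d = 0" if "i < cut_index m k" for i
    using that cut_index_le[OF k] d by (intro Suc.IH) auto
  moreover have "coeff (col_eulerian r m i) (d - 1) = 0" if "cut_index m k \<le> i" "i < r * (m + 1)" for i
    using that d Suc.prems(2) cut_index_pos[of k m] by (intro Suc.IH) auto
  ultimately show ?case
    using k d by (subst coeff_col_eulerian_Suc) auto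
qed

lemma coeff_col_eulerian_0_pos: "r > 0 \<Longrightarrow> 0 < coeff (col_eulerian r m 0) m"
proof (induction m)
  case (Suc m)
  have "0 < coeff (col_eulerian r m 0) m"
    using Suc by simp
  also have "\<dots> \<le> (\<Sum>i=0..<r * (m + 1). coeff (col_eulerian r m i) m)"
    using Suc.prems by (intro member_le_sum) (auto intro!: coeff_col_eulerian_nonneg)
  also have "\<dots> = coeff (col_eulerian r (Suc m) 0) (Suc m)"
    using Suc.prems by (subst coeff_col_eulerian_Suc) (auto simp: cut_index_def)
  finally show ?case .
qed simp

lemma coeff_col_eulerian_pos:
  assumes "0 < k" "k < r * (m + 2)"
  shows "0 < coeff (col_eulerian r (Suc m) k) m"
proof -
  have r: "r > 0"
    using assms by (cases r) auto
  have "0 < coeff (col_eulerian r m 0) m"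
    using r by (rule coeff_col_eulerian_0_pos)
  also have "\<dots> \<le> (\<Sum>i=0..<cut_index m k. coeff (col_eulerian r m i) m)"
    using cut_index_pos[OF assms(1), of m] cut_index_le[OF assms(2)]
    by (intro member_le_sum) (auto intro!: coeff_col_eulerian_nonneg)
  also have "\<dots> \<le> coeff (col_eulerian r (Suc m) k) m"
    using assms(2) by (subst coeff_col_eulerian_Suc) (auto intro!: sum_nonneg coeff_col_eulerian_nonneg)
  finally show ?thesis .
qed

text \<open>For q \<le> m this counts height functions on m vertices that have maximum exactly N and
  are positive on m-q prescribed vertices, that is, the contribution of a simplex with m-q facets
  removed. \<open>N = 0\<close> is separated for the sake of m = 0, where the subtracted product
  would be 0^0 * 0^0 = 1 instead of 0.\<close>

definition power_gap :: "nat \<Rightarrow> nat \<Rightarrow> nat \<Rightarrow> real" where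
  "power_gap m N q = real N ^ (m - q) * real (N + 1) ^ q
     - (if N = 0 then 0 else real (N - 1) ^ (m - q) * real N ^ q)"

text \<open>Releasing one vertex from being positive adds exactly the height functions that vanish
  there, and these live on one vertex fewer.\<close>

lemma power_gap_diff:
  assumes "q \<le> m"
  shows "power_gap (Suc m) N (Suc q) - power_gap (Suc m) N q = power_gap m N q"
proof (cases N)
  case 0
  then show ?thesis
    using assms by (cases "q = m") (auto simp: power_gap_def Suc_diff_le)
next
  case (Suc n)
  then show ?thesis
    using assms by (simp add: power_gap_def Suc_diff_le algebra_simps)
qed

text \<open>Lowering all heights by one turns everywhere positive functions with maximum N+1 into
  arbitrary ones with maximum N.\<close>

lemma power_gap_Suc: "0 < m \<Longrightarrow> power_gap m (Suc N) 0 = power_gap m N m"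
  by (cases N) (auto simp: power_gap_def add.commute)

lemma div_mod_mult_add:
  fixes q M :: nat
  assumes "q < M"
  shows "(N * M + q) div M = N" "(N * M + q) mod M = q"
  using assms by simp_all

definition gap_seq :: "nat \<Rightarrow> nat \<Rightarrow> real" where
  "gap_seq m l = power_gap m (l div (m + 1)) (l mod (m + 1))"

text \<open>Inside a block \<open>power_gap_diff\<close> telescopes in q; between blocks
  \<open>power_gap_Suc\<close> identifies the last value q = m+1 for N with the first value q = 0
  for N+1. Partial summation thus raises the level.\<close>

lemma sum_gap_seq:
  assumes "q \<le> m + 1"
  shows "(\<Sum>l<N * (m + 1) + q. gap_seq m l) = power_gap (Suc m) N q"
proof -
  have *: "(\<Sum>l<N * (m + 1) + q. gap_seq m l) = power_gap (Suc m) N q"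
    if "(\<Sum>l<N * (m + 1). gap_seq m l) = power_gap (Suc m) N 0" "q \<le> m + 1" for N q
    using that(2)
  proof (induction q)
    case (Suc q)
    have div: "(N * (m + 1) + q) div (m + 1) = N" "(N * (m + 1) + q) mod (m + 1) = q"
      using Suc.prems by (simp_all add: div_mod_mult_add del: mult_Suc_right)
    have "gap_seq m (N * (m + 1) + q) = power_gap m N q"
      unfolding gap_seq_def div ..
    then show ?case
      using Suc power_gap_diff[of q m N] by simp
  qed (use that in simp)
  have "(\<Sum>l<N * (m + 1). gap_seq m l) = power_gap (Suc m) N 0" for N
  proof (induction N)
    case 0
    then show ?case
      by (simp add: power_gap_def)
  next
    case (Suc N)
    have "(\<Sum>l<Suc N * (m + 1). gap_seq m l) = (\<Sum>l<N * (m + 1) + (m + 1). gap_seq m l)"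
      by (simp add: algebra_simps)
    also have "\<dots> = power_gap (Suc m) N (m + 1)"
      by (rule *[OF Suc.IH]) simp
    finally show ?case
      by (simp add: power_gap_Suc)
  qed
  then show ?thesis
    using * assms by blast
qed

lemma gap_seq_Suc:
  "gap_seq (Suc m) (n * (r * (m + 2)) + k) = (\<Sum>l<n * (r * (m + 1)) + cut_index m k. gap_seq m l)"
proof -
  have div: "(n * (r * (m + 2)) + k) div (m + 2) = n * r + k div (m + 2)"
    "(n * (r * (m + 2)) + k) mod (m + 2) = k mod (m + 2)"
    using div_mult_self3[of "m + 2" "n * r" k] mod_mult_self3[of "n * r" "m + 2" k]
    unfolding mult.assoc by simp_all
  have "k mod (m + 2) < m + 2"
    by simp
  then have "(\<Sum>l<(n * r + k div (m + 2)) * (m + 1) + k mod (m + 2). gap_seq m l) =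
      power_gap (Suc m) (n * r + k div (m + 2)) (k mod (m + 2))"
    by (intro sum_gap_seq) simp
  also have "(n * r + k div (m + 2)) * (m + 1) + k mod (m + 2) = n * (r * (m + 1)) + cut_index m k"
    unfolding cut_index_def by (simp only: algebra_simps)
  finally show ?thesis
    unfolding gap_seq_def using div by simp
qed

lemma sum_shift:
  fixes n :: nat
  shows "(\<Sum>i=a..<b. f (n + i)) = (\<Sum>l=n + a..<n + b. f l :: real)"
  by (rule sum.reindex_bij_witness[of _ "\<lambda>l. l - n" "\<lambda>i. n + i"]) auto

text \<open>Index \<open>k\<close> collects the terms of \<open>gap_seq m\<close> in the residue
  class of \<open>k\<close> modulo r (m+1), a stride of r blocks. Multiplication by 1-x takes
  differences of partial sums over one stride, hence sums over windows of that length, and these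
  meet every residue class once.\<close>

lemma fps_col_eulerian:
  assumes "k < r * (m + 1)"
  shows "fps_of_poly (col_eulerian r m k) =
    (1 - fps_X) ^ m * Abs_fps (\<lambda>n. gap_seq m (n * (r * (m + 1)) + k))"
  using assms
proof (induction m arbitrary: k)
  case 0
  have "gap_seq 0 l = (if l = 0 then 1 else 0)" for l
    by (simp add: gap_seq_def power_gap_def)
  then show ?case
    using 0 by (auto simp: fps_eq_iff)
next
  case (Suc m)
  define w where "w = r * (m + 1)"
  define G where "G i = Abs_fps (\<lambda>n. gap_seq m (n * w + i))" for i
  have k: "k < r * (m + 2)"
    using Suc.prems by simp
  have cut: "cut_index m k \<le> w"
    using cut_index_le[OF k] by (simp add: w_def)
  have IH: "fps_of_poly (col_eulerian r m i) = (1 - fps_X) ^ m * G i" if "i < w" for i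
    using Suc.IH[of i] that by (simp add: G_def w_def)
  have coeffs: "(\<Sum>i=0..<cut_index m k. G i) + fps_X * (\<Sum>i=cut_index m k..<w. G i)
      = (1 - fps_X) * Abs_fps (\<lambda>n. gap_seq (Suc m) (n * (r * (m + 2)) + k))"
  proof (rule fps_ext)
    fix n
    have S: "gap_seq (Suc m) (n * (r * (m + 2)) + k) = (\<Sum>l<n * w + cut_index m k. gap_seq m l)" for n
      unfolding w_def by (rule gap_seq_Suc)
    show "((\<Sum>i=0..<cut_index m k. G i) + fps_X * (\<Sum>i=cut_index m k..<w. G i)) $ n
        = ((1 - fps_X) * Abs_fps (\<lambda>n. gap_seq (Suc m) (n * (r * (m + 2)) + k))) $ n"
    proof (cases n)
      case 0
      then show ?thesis
        using S[of 0] by (simp add: fps_sum_nth G_def algebra_simps lessThan_atLeast0)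
    next
      case (Suc n')
      \<comment> \<open>The window from n' w + c to n w + c, with c the cut, is divided at n w. Its
        first part has the residues at least c of the previous stride, whence the factor x; the
        second part has the residues below c of the current stride.\<close>
      have "(\<Sum>i=0..<cut_index m k. gap_seq m (n * w + i)) + (\<Sum>i=cut_index m k..<w. gap_seq m (n' * w + i))
        = (\<Sum>l=n * w..<n * w + cut_index m k. gap_seq m l) + (\<Sum>l=n' * w + cut_index m k..<n * w. gap_seq m l)"
        unfolding sum_shift using Suc by (simp add: algebra_simps)
      also have "\<dots> = (\<Sum>l=n' * w + cut_index m k..<n * w + cut_index m k. gap_seq m l)"
        using Suc cut by (subst add.commute, intro sum.atLeastLessThan_concat) auto
      also have "\<dots> = (\<Sum>l<n * w + cut_index m k. gap_seq m l) - (\<Sum>l<n' * w + cut_index m k. gap_seq m l)"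
        using sum.atLeastLessThan_concat[of 0 "n' * w + cut_index m k" "n * w + cut_index m k" "gap_seq m"] Suc
        by (simp add: lessThan_atLeast0 algebra_simps)
      finally show ?thesis
        using Suc S[of n] S[of n'] by (simp add: fps_sum_nth G_def algebra_simps)
    qed
  qed
  have "fps_of_poly (col_eulerian r (Suc m) k)
      = (1 - fps_X) ^ m * ((\<Sum>i=0..<cut_index m k. G i) + fps_X * (\<Sum>i=cut_index m k..<w. G i))"
    unfolding col_eulerian_Suc[OF k] fps_of_poly_add fps_of_poly_mult fps_of_poly_sum fps_of_poly_fps_X
      w_def[symmetric]
    using cut IH by (simp add: algebra_simps sum_distrib_left)
  then show ?case
    unfolding coeffs by (simp add: algebra_simps)
qed

section \<open>Real-rootedness and interlacing of the colored Eulerian polynomials\<close>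

lemma less_mult_Suc: "0 < (r::nat) \<Longrightarrow> m < r * (m + 1)"
  using mult_le_mono1[of 1 r "m + 1"] by simp

lemma real_rooted_col_eulerian:
  assumes "r > 0" "k < r * (m + 1)" "0 < m"
  shows "real_rooted (col_eulerian r m k)"
  using assms col_eulerian_upper_half_plane[of _ r m] by (intro real_rooted_if_no_upper_root) blast

text \<open>\<open>q\<close> is the shape that \<theta> takes on m+1 vertices. The polynomials of
  index above m precede index m in argument, and the second inequality of \<open>arg_le\<close>,
  which carries the factor \<open>z\<close>, is exactly the hypothesis of the interlacing criterion
  for \<open>q = x g\<close>. All positive indices have degree m-1, and r > 1 makes the sum
  nonempty.\<close>

lemma col_eulerian_interlaces:
  assumes r: "r > 1" and m: "m > 0"
  defines "q \<equiv> [:0, 1:] * (\<Sum>i=m + 1..<r * (m + 1). col_eulerian r m i)"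
  shows "interlaces (col_eulerian r m m) q" "degree q = m" "0 \<le> coeff q d"
proof -
  let ?w = "r * (m + 1)"
  define g where "g = (\<Sum>i=m + 1..<?w. col_eulerian r m i)"
  have w: "m < ?w" "m + 1 < ?w"
  proof -
    have "2 * (m + 1) \<le> ?w"
      using r by (intro mult_le_mono1) simp
    then show "m < ?w" "m + 1 < ?w"
      using m by simp_all
  qed
  obtain m' where m': "m = Suc m'"
    using m by (cases m) auto
  have pos: "0 < coeff (col_eulerian r m k) m'" if "0 < k" "k < ?w" for k
    using coeff_col_eulerian_pos[of k r m'] that by (simp add: m')
  have zero: "coeff (col_eulerian r m k) d = 0" if "0 < k" "k < ?w" "m' < d" for k d
  proof -
    have "m < d \<or> m = d"
      using that m' by linarith
    then show ?thesis
      using that by (intro coeff_col_eulerian_eq_0) blast+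
  qed
  have g_coeff: "coeff g d = (\<Sum>i=m + 1..<?w. coeff (col_eulerian r m i) d)" for d
    by (simp add: g_def coeff_sum)
  have g_pos: "0 < coeff g m'"
    unfolding g_coeff using w pos by (intro sum_pos) auto
  have g_deg: "degree g = m'"
    using g_pos zero by (intro antisym degree_le le_degree) (auto simp: g_coeff intro!: sum.neutral)
  have h_pos: "0 < coeff (col_eulerian r m m) m'"
    using pos w m by simp
  have h_deg: "degree (col_eulerian r m m) = m'"
    using h_pos zero w m by (intro antisym degree_le le_degree) auto
  have q: "q = pCons 0 g"
    by (simp add: q_def g_def)
  have g0: "g \<noteq> 0"
    using g_pos by auto
  show dq: "degree q = m"
    using g0 g_deg by (simp add: q m')
  show "0 \<le> coeff q d"
    unfolding q by (auto simp: coeff_pCons g_coeff split: nat.split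
        intro!: sum_nonneg coeff_col_eulerian_nonneg)
  show "interlaces (col_eulerian r m m) q"
  proof (rule interlaces_of_upper_half_plane)
    show "lead_coeff (col_eulerian r m m) > 0" "lead_coeff q > 0"
      using h_pos h_deg g_pos g_deg g0 by (auto simp: q)
    show "degree q = degree (col_eulerian r m m) + 1"
      using dq h_deg m' by simp
  next
    fix z assume z: "Im z > 0"
    have dec: "arg_decreasing z ?w (\<lambda>k. cpoly (col_eulerian r m k) z)"
      and nz: "\<And>k. k < ?w \<Longrightarrow> cpoly (col_eulerian r m k) z \<noteq> 0"
      using col_eulerian_upper_half_plane[OF z, of r m] r m by auto
    show "cpoly (col_eulerian r m m) z \<noteq> 0"
      using nz w by simp
    have qz: "cpoly q z = z * cpoly g z" and gz: "cpoly g z = (\<Sum>i=m + 1..<?w. cpoly (col_eulerian r m i) z)"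
      by (simp_all add: q cpoly_pCons g_def cpoly_sum)
    have "cpoly g z \<noteq> 0"
      using arg_decreasing_sum_eq_0[OF z dec order_refl, of "m + 1" "m + 1"] nz[of "m + 1"] w gz by auto
    then show "cpoly q z \<noteq> 0"
      using qz z by auto
    have "arg_le z (cpoly g z) (cpoly (col_eulerian r m m) z)"
      unfolding gz using dec by (intro arg_le_sum_left) (auto simp: arg_decreasing_def)
    then show "0 \<le> Im (cpoly q z * cnj (cpoly (col_eulerian r m m) z))"
      by (simp add: arg_le_def qz)
  qed
qed

section \<open>Layer decompositions\<close>

lemma supp_iff: "v \<in> supp f \<longleftrightarrow> f v \<noteq> 0"
  by (simp add: supp_def)

lemma supp_notin: "v \<notin> supp f \<Longrightarrow> f v = 0"
  by (simp add: supp_def)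

lemma Union_in_finite_chain:
  assumes "finite C" "C \<noteq> {}" "\<forall>S\<in>C. \<forall>T\<in>C. S \<subseteq> T \<or> T \<subseteq> S"
  shows "\<Union>C \<in> C"
  using assms
proof (induction C rule: finite_ne_induct)
  case (insert S C)
  then have "\<Union>C \<in> C" "S \<subseteq> \<Union>C \<or> \<Union>C \<subseteq> S"
    by auto
  then show ?case
    by (elim disjE) (simp_all add: Un_absorb1 Un_absorb2)
qed simp

lemma Inter_in_finite_chain:
  assumes "finite C" "C \<noteq> {}" "\<forall>S\<in>C. \<forall>T\<in>C. S \<subseteq> T \<or> T \<subseteq> S"
  shows "\<Inter>C \<in> C"
  using assms
proof (induction C rule: finite_ne_induct)
  case (insert S C)
  then have "\<Inter>C \<in> C" "S \<subseteq> \<Inter>C \<or> \<Inter>C \<subseteq> S"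
    by auto
  then show ?case
    by (elim disjE) (simp_all add: Int_absorb1 Int_absorb2)
qed simp

text \<open>Decomposition into weighted indicator functions of a chain of sets. The weight of
  \<open>{}\<close> contributes to no value and is left free on purpose: the edgewise subdivision
  stores there what is missing to a prescribed total.\<close>

definition layering :: "('a \<Rightarrow> real) \<Rightarrow> ('a set \<Rightarrow> real) \<Rightarrow> bool" where
  "layering \<alpha> \<gamma> \<longleftrightarrow> (\<forall>S. 0 \<le> \<gamma> S) \<and> finite (supp \<gamma>) \<and>
     (\<forall>S\<in>supp \<gamma>. \<forall>T\<in>supp \<gamma>. S \<subseteq> T \<or> T \<subseteq> S) \<and>
     (\<forall>v. \<alpha> v = (\<Sum>S\<in>supp \<gamma>. if v \<in> S then \<gamma> S else 0))"

lemma layeringD: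
  assumes "layering \<alpha> \<gamma>"
  shows "0 \<le> \<gamma> S" "finite (supp \<gamma>)" "S \<in> supp \<gamma> \<Longrightarrow> T \<in> supp \<gamma> \<Longrightarrow> S \<subseteq> T \<or> T \<subseteq> S"
    "\<alpha> v = (\<Sum>S\<in>supp \<gamma>. if v \<in> S then \<gamma> S else 0)"
  using assms by (auto simp: layering_def)

lemma layering_superset:
  assumes "layering \<alpha> \<gamma>" "finite A" "supp \<gamma> \<subseteq> A"
  shows "\<alpha> v = (\<Sum>S\<in>A. if v \<in> S then \<gamma> S else 0)"
  unfolding layeringD(4)[OF assms(1)] using assms(2,3)
  by (intro sum.mono_neutral_left) (auto simp: supp_iff)

lemma layering_pos:
  assumes "layering \<alpha> \<gamma>" "S \<in> supp \<gamma>"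
  shows "0 < \<gamma> S"
  using layeringD(1)[OF assms(1), of S] assms(2) by (simp add: supp_iff)

lemma layering_le:
  assumes l: "layering \<alpha> \<gamma>" and v: "v \<in> S"
  shows "\<gamma> S \<le> \<alpha> v"
proof (cases "S \<in> supp \<gamma>")
  case True
  have "(if v \<in> S then \<gamma> S else 0) \<le> (\<Sum>S\<in>supp \<gamma>. if v \<in> S then \<gamma> S else 0)"
    using True layeringD[OF l] by (intro member_le_sum) auto
  then show ?thesis
    using v layeringD(4)[OF l, of v] by simp
next
  case False
  have "0 \<le> \<alpha> v"
    unfolding layeringD(4)[OF l, of v] using layeringD[OF l] by (intro sum_nonneg) auto
  then show ?thesis
    using supp_notin[OF False] by simp
qed

lemma layering_subset:
  assumes "layering \<alpha> \<gamma>" "S \<in> supp \<gamma>"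
  shows "S \<subseteq> supp \<alpha>"
proof
  fix v assume "v \<in> S"
  then show "v \<in> supp \<alpha>"
    using layering_le[OF assms(1), of v S] layering_pos[OF assms] by (simp add: supp_iff)
qed

lemma layering_Union:
  assumes l: "layering \<alpha> \<gamma>"
  shows "\<Union>(supp \<gamma>) = supp \<alpha>"
proof
  show "\<Union>(supp \<gamma>) \<subseteq> supp \<alpha>"
    using layering_subset[OF l] by blast
  show "supp \<alpha> \<subseteq> \<Union>(supp \<gamma>)"
  proof
    fix v assume "v \<in> supp \<alpha>"
    then have "(\<Sum>S\<in>supp \<gamma>. if v \<in> S then \<gamma> S else 0) \<noteq> 0"
      unfolding layeringD(4)[OF l, of v, symmetric] by (simp add: supp_iff)
    then obtain S where "S \<in> supp \<gamma>" "(if v \<in> S then \<gamma> S else 0) \<noteq> 0"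
      by (rule sum.not_neutral_contains_not_neutral)
    then show "v \<in> \<Union>(supp \<gamma>)"
      by (cases "v \<in> S") auto
  qed
qed

text \<open>Members of the chain are superlevel sets: if \<open>w\<close> lay outside
  \<open>S\<close>, every member containing \<open>w\<close> would contain \<open>S\<close> and so
  \<open>v\<close>, and \<alpha> would be larger at \<open>v\<close> by at least the weight of
  \<open>S\<close>.\<close>

lemma layering_upclosed:
  assumes l: "layering \<alpha> \<gamma>" and S: "S \<in> supp \<gamma>" and v: "v \<in> S" and le: "\<alpha> v \<le> \<alpha> w"
  shows "w \<in> S"
proof (rule ccontr)
  assume w: "w \<notin> S"
  have eq: "\<alpha> u = (if u \<in> S then \<gamma> S else 0) + (\<Sum>T\<in>supp \<gamma> - {S}. if u \<in> T then \<gamma> T else 0)" for u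
    unfolding layeringD(4)[OF l, of u] using S layeringD(2)[OF l] by (rule sum.remove[rotated])
  have "(\<Sum>T\<in>supp \<gamma> - {S}. if w \<in> T then \<gamma> T else 0) \<le> (\<Sum>T\<in>supp \<gamma> - {S}. if v \<in> T then \<gamma> T else 0)"
  proof (rule sum_mono)
    fix T assume T: "T \<in> supp \<gamma> - {S}"
    then have "S \<subseteq> T" if "w \<in> T"
      using layeringD(3)[OF l S, of T] w that by blast
    then show "(if w \<in> T then \<gamma> T else 0) \<le> (if v \<in> T then \<gamma> T else 0)"
      using v layeringD(1)[OF l] by auto
  qed
  then show False
    using eq[of v] eq[of w] v w le layering_pos[OF l S] by simp
qed

text \<open>The smaller members have a union that is itself a smaller member, so some vertex of the
  support avoids them all, and only the top weight is counted there.\<close>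

lemma layering_top:
  assumes l: "layering \<alpha> \<gamma>" and ne: "supp \<alpha> \<noteq> {}"
  shows "supp \<alpha> \<in> supp \<gamma> \<and> \<gamma> (supp \<alpha>) \<in> \<alpha> ` supp \<alpha>"
proof -
  have "supp \<gamma> \<noteq> {}"
    using layering_Union[OF l] ne by auto
  then have top: "supp \<alpha> \<in> supp \<gamma>"
    using Union_in_finite_chain[OF layeringD(2)[OF l]] layeringD(3)[OF l] layering_Union[OF l] by metis
  have "\<exists>v\<in>supp \<alpha>. \<forall>T\<in>supp \<gamma> - {supp \<alpha>}. v \<notin> T"
  proof (cases "supp \<gamma> - {supp \<alpha>} = {}")
    case False
    then have "\<Union>(supp \<gamma> - {supp \<alpha>}) \<in> supp \<gamma> - {supp \<alpha>}"
      using layeringD[OF l] by (intro Union_in_finite_chain) auto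
    then have "\<Union>(supp \<gamma> - {supp \<alpha>}) \<subset> supp \<alpha>"
      using layering_subset[OF l] by blast
    then show ?thesis
      by blast
  qed (use ne in blast)
  then obtain v where v: "v \<in> supp \<alpha>" "\<And>T. T \<in> supp \<gamma> - {supp \<alpha>} \<Longrightarrow> v \<notin> T"
    by blast
  have "\<alpha> v = (if v \<in> supp \<alpha> then \<gamma> (supp \<alpha>) else 0)
      + (\<Sum>T\<in>supp \<gamma> - {supp \<alpha>}. if v \<in> T then \<gamma> T else 0)"
    unfolding layeringD(4)[OF l, of v] using top layeringD(2)[OF l] by (rule sum.remove[rotated])
  also have "\<dots> = \<gamma> (supp \<alpha>)"
    using v by simp
  finally show ?thesis
    using top v by (metis imageI)
qed

lemma layering_top_eq_Min:
  assumes l: "layering \<alpha> \<gamma>" and "supp \<alpha> \<noteq> {}" "finite (supp \<alpha>)"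
  shows "\<gamma> (supp \<alpha>) = Min (\<alpha> ` supp \<alpha>)"
  using layering_top[OF assms(1,2)] layering_le[OF l, of _ "supp \<alpha>"] assms(3)
  by (intro Min_eqI[symmetric]) auto

lemma layering_remove:
  assumes l: "layering \<alpha> \<gamma>"
  shows "layering (\<lambda>v. \<alpha> v - (if v \<in> S then \<gamma> S else 0)) (\<gamma>(S := 0))"
proof -
  have supp: "supp (\<gamma>(S := 0)) = supp \<gamma> - {S}"
    by (auto simp: supp_def)
  have "\<alpha> v - (if v \<in> S then \<gamma> S else 0) = (\<Sum>T\<in>supp \<gamma> - {S}. if v \<in> T then (\<gamma>(S := 0)) T else 0)" for v
  proof -
    have "\<alpha> v = (\<Sum>T\<in>insert S (supp \<gamma>). if v \<in> T then \<gamma> T else 0)"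
      using layeringD(2)[OF l] by (intro layering_superset[OF l]) auto
    also have "\<dots> = (if v \<in> S then \<gamma> S else 0) + (\<Sum>T\<in>supp \<gamma> - {S}. if v \<in> T then \<gamma> T else 0)"
      using layeringD(2)[OF l] by (simp add: sum.insert_remove)
    also have "(\<Sum>T\<in>supp \<gamma> - {S}. if v \<in> T then \<gamma> T else 0)
        = (\<Sum>T\<in>supp \<gamma> - {S}. if v \<in> T then (\<gamma>(S := 0)) T else 0)"
      by (intro sum.cong) auto
    finally show ?thesis
      by simp
  qed
  then show ?thesis
    unfolding layering_def supp using layeringD[OF l] by auto
qed

text \<open>Either end of the chain admits a new member: a set above the whole support, as in the
  greedy construction, or \<open>{}\<close>, which changes no value.\<close>

lemma layering_add:
  assumes l: "layering \<alpha> \<gamma>" and c: "0 \<le> c" and S: "supp \<alpha> \<subseteq> S \<or> S = {}" and g: "\<gamma> S = 0"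
  shows "layering (\<lambda>v. \<alpha> v + (if v \<in> S then c else 0)) (\<gamma>(S := c))"
proof -
  have supp: "supp (\<gamma>(S := c)) \<subseteq> insert S (supp \<gamma>)"
    by (auto simp: supp_def)
  have fin: "finite (insert S (supp \<gamma>))"
    using layeringD(2)[OF l] by simp
  have nS: "S \<notin> supp \<gamma>"
    using g by (simp add: supp_iff)
  have "\<alpha> v + (if v \<in> S then c else 0) = (\<Sum>T\<in>supp (\<gamma>(S := c)). if v \<in> T then (\<gamma>(S := c)) T else 0)" for v
  proof -
    have "(\<Sum>T\<in>supp (\<gamma>(S := c)). if v \<in> T then (\<gamma>(S := c)) T else 0)
      = (\<Sum>T\<in>insert S (supp \<gamma>). if v \<in> T then (\<gamma>(S := c)) T else 0)"
      using fin supp by (intro sum.mono_neutral_left) (auto simp: supp_def)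
    also have "\<dots> = (if v \<in> S then c else 0) + (\<Sum>T\<in>supp \<gamma>. if v \<in> T then (\<gamma>(S := c)) T else 0)"
      using nS layeringD(2)[OF l] by simp
    also have "(\<Sum>T\<in>supp \<gamma>. if v \<in> T then (\<gamma>(S := c)) T else 0) = \<alpha> v"
      unfolding layeringD(4)[OF l, of v] using nS by (intro sum.cong) auto
    finally show ?thesis
      by (simp only: add.commute)
  qed
  moreover have "T \<subseteq> S \<or> S \<subseteq> T" if "T \<in> supp \<gamma>" for T
    using layering_subset[OF l that] S by blast
  ultimately show ?thesis
    unfolding layering_def using layeringD(1,3)[OF l] c finite_subset[OF supp fin] supp
    by (intro conjI ballI allI) (auto simp del: fun_upd_apply, auto, (metis insert_iff subsetD order_refl)+)
qed

text \<open>The weight of the support is forced to be the minimum of \<alpha> on it; removing that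
  layer shrinks the support. \<open>T = {}\<close> is excluded since its weight is invisible in
  \<alpha>.\<close>

lemma layering_unique:
  assumes "layering \<alpha> \<gamma>" "layering \<alpha> \<gamma>'" "finite (supp \<alpha>)" "T \<noteq> {}"
  shows "\<gamma> T = \<gamma>' T"
  using assms(1-3)
proof (induction "card (supp \<alpha>)" arbitrary: \<alpha> \<gamma> \<gamma>' rule: less_induct)
  case less
  show ?case
  proof (cases "supp \<alpha> = {}")
    case True
    then show ?thesis
      using layering_subset[OF less.prems(1), of T] layering_subset[OF less.prems(2), of T] assms(4)
      by (metis subset_empty supp_notin)
  next
    case False
    let ?S = "supp \<alpha>"
    have eq: "\<gamma> ?S = \<gamma>' ?S"
      using False less.prems layering_top_eq_Min by metis
    define \<alpha>' where "\<alpha>' v = \<alpha> v - (if v \<in> ?S then \<gamma> ?S else 0)" for v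
    have l: "layering \<alpha>' (\<gamma>(?S := 0))" "layering \<alpha>' (\<gamma>'(?S := 0))"
      using layering_remove[OF less.prems(1), of ?S] layering_remove[OF less.prems(2), of ?S]
      unfolding \<alpha>'_def eq by simp_all
    obtain v where "v \<in> ?S" "\<gamma> ?S = \<alpha> v"
      using layering_top[OF less.prems(1) False] by auto
    then have "v \<in> ?S - supp \<alpha>'"
      by (simp add: \<alpha>'_def supp_iff)
    moreover have "supp \<alpha>' \<subseteq> ?S"
      by (auto simp: \<alpha>'_def supp_iff split: if_splits)
    ultimately have "supp \<alpha>' \<subset> ?S"
      by blast
    then have "(\<gamma>(?S := 0)) T = (\<gamma>'(?S := 0)) T"
      using less.prems(3) finite_subset[OF \<open>supp \<alpha>' \<subseteq> ?S\<close>]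
      by (intro less.hyps[OF _ l] psubset_card_mono) auto
    then show ?thesis
      using eq by (auto split: if_splits)
  qed
qed

text \<open>Greedy construction: peel off the minimum over the support. The minimum is one of the
  values, so integrality is inherited and lattice points need no separate argument.\<close>

lemma layering_exists:
  assumes "finite (supp \<alpha>)" "\<And>v. 0 \<le> \<alpha> v"
  shows "\<exists>\<gamma>. layering \<alpha> \<gamma> \<and> \<gamma> {} = 0 \<and> ((\<forall>v. \<alpha> v \<in> \<int>) \<longrightarrow> (\<forall>S. \<gamma> S \<in> \<int>))"
  using assms
proof (induction "card (supp \<alpha>)" arbitrary: \<alpha> rule: less_induct)
  case less
  show ?case
  proof (cases "supp \<alpha> = {}")
    case True
    then have "\<alpha> = (\<lambda>_. 0)"
      by (auto simp: supp_def)
    then show ?thesis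
      by (intro exI[of _ "\<lambda>_. 0"]) (simp add: layering_def supp_def)
  next
    case False
    let ?S = "supp \<alpha>"
    define c where "c = Min (\<alpha> ` ?S)"
    have c: "c \<in> \<alpha> ` ?S" "\<And>v. v \<in> ?S \<Longrightarrow> c \<le> \<alpha> v"
      using False less.prems(1) by (simp_all add: c_def)
    then have "0 \<le> c"
      using less.prems(2) by auto
    define \<alpha>' where "\<alpha>' v = \<alpha> v - (if v \<in> ?S then c else 0)" for v
    obtain v where "v \<in> ?S" "c = \<alpha> v"
      using c by blast
    then have "v \<in> ?S - supp \<alpha>'"
      by (simp add: \<alpha>'_def supp_iff)
    moreover have "supp \<alpha>' \<subseteq> ?S"
      by (auto simp: \<alpha>'_def supp_iff split: if_splits)
    ultimately have sub: "supp \<alpha>' \<subset> ?S"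
      by blast
    then have "card (supp \<alpha>') < card ?S" "finite (supp \<alpha>')"
      using less.prems(1) by (auto intro: psubset_card_mono finite_subset)
    moreover have "0 \<le> \<alpha>' v" for v
      using c(2) less.prems(2) by (simp add: \<alpha>'_def)
    ultimately obtain \<gamma> where \<gamma>: "layering \<alpha>' \<gamma>" "\<gamma> {} = 0" "(\<forall>v. \<alpha>' v \<in> \<int>) \<longrightarrow> (\<forall>S. \<gamma> S \<in> \<int>)"
      using less.hyps[of \<alpha>'] by blast
    have "?S \<notin> supp \<gamma>"
      using layering_subset[OF \<gamma>(1), of ?S] sub by (meson leD)
    then have "\<gamma> ?S = 0"
      by (rule supp_notin)
    then have "layering (\<lambda>v. \<alpha>' v + (if v \<in> ?S then c else 0)) (\<gamma>(?S := c))"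
      using sub \<open>0 \<le> c\<close> by (intro layering_add \<gamma>(1)) auto
    then have "layering \<alpha> (\<gamma>(?S := c))"
      by (simp add: \<alpha>'_def)
    moreover have "(\<gamma>(?S := c)) T \<in> \<int>" if "\<forall>v. \<alpha> v \<in> \<int>" for T
    proof -
      have "c \<in> \<int>"
        using c(1) that by auto
      then have "\<forall>v. \<alpha>' v \<in> \<int>"
        using that by (simp add: \<alpha>'_def)
      then show ?thesis
        using \<gamma>(3) \<open>c \<in> \<int>\<close> by simp
    qed
    ultimately show ?thesis
      using \<gamma>(2) False by (intro exI[of _ "\<gamma>(?S := c)"]) auto
  qed
qed

lemma layering_total:
  assumes l: "layering \<alpha> \<gamma>" and fin: "finite (supp \<alpha>)"
  shows "(\<Sum>v\<in>supp \<alpha>. \<alpha> v) = (\<Sum>S\<in>supp \<gamma>. real (card S) * \<gamma> S)"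
proof -
  have "(\<Sum>v\<in>supp \<alpha>. \<alpha> v) = (\<Sum>v\<in>supp \<alpha>. \<Sum>S\<in>supp \<gamma>. if v \<in> S then \<gamma> S else 0)"
    using layeringD(4)[OF l] by (intro sum.cong) auto
  also have "\<dots> = (\<Sum>S\<in>supp \<gamma>. \<Sum>v\<in>supp \<alpha>. if v \<in> S then \<gamma> S else 0)"
    by (rule sum.swap)
  also have "\<dots> = (\<Sum>S\<in>supp \<gamma>. real (card S) * \<gamma> S)"
  proof (rule sum.cong[OF refl])
    fix S assume "S \<in> supp \<gamma>"
    then have "{v \<in> supp \<alpha>. v \<in> S} = S"
      using layering_subset[OF l] by blast
    then show "(\<Sum>v\<in>supp \<alpha>. if v \<in> S then \<gamma> S else 0) = real (card S) * \<gamma> S"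
      using fin by (simp flip: sum.inter_filter)
  qed
  finally show ?thesis .
qed

text \<open>The smallest member of the chain is nonempty, and a vertex in it lies in all members, so
  there \<alpha> equals the total weight.\<close>

lemma layering_sum_less:
  assumes l: "layering \<alpha> \<gamma>" and e: "\<gamma> {} = 0" and T: "0 < T" "\<And>v. \<alpha> v < T"
  shows "(\<Sum>S\<in>supp \<gamma>. \<gamma> S) < T"
proof (cases "supp \<gamma> = {}")
  case False
  then have "\<Inter>(supp \<gamma>) \<in> supp \<gamma>"
    using layeringD[OF l] by (intro Inter_in_finite_chain) auto
  moreover have "{} \<notin> supp \<gamma>"
    using e by (simp add: supp_iff)
  ultimately obtain v where "\<And>S. S \<in> supp \<gamma> \<Longrightarrow> v \<in> S"
    by (metis InterE all_not_in_conv)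
  then have "(\<Sum>S\<in>supp \<gamma>. \<gamma> S) = \<alpha> v"
    unfolding layeringD(4)[OF l, of v] by (intro sum.cong) auto
  then show ?thesis
    using T by simp
qed (use T in simp)

section \<open>Barycentric subdivision\<close>

lemma complexD:
  assumes "abstract_complex K"
  shows "finite K" "{} \<in> K" "F \<in> K \<Longrightarrow> finite F" "F \<in> K \<Longrightarrow> G \<subseteq> F \<Longrightarrow> G \<in> K"
  using assms by (auto simp: abstract_complex_def)

lemma abstract_complex_Pow: "finite S \<Longrightarrow> abstract_complex (Pow S)"
  by (auto simp: abstract_complex_def intro: finite_subset)

lemma mem_sd: "C \<in> sd K \<longleftrightarrow> C \<subseteq> K - {{}} \<and> (\<forall>S\<in>C. \<forall>T\<in>C. S \<subseteq> T \<or> T \<subseteq> S)"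
  by (simp add: sd_def subset_chain_def)

lemma abstract_complex_sd:
  assumes "abstract_complex K"
  shows "abstract_complex (sd K)"
proof -
  have sub: "sd K \<subseteq> Pow (K - {{}})"
    by (auto simp: mem_sd)
  have fin: "finite (K - {{}})"
    using complexD(1)[OF assms] by simp
  have "finite F" if "F \<in> sd K" for F
    using fin sub that by (meson PowD finite_subset subsetD)
  moreover have "finite (sd K)"
    using fin sub by (meson finite_Pow_iff finite_subset)
  moreover have "G \<in> sd K" if "F \<in> sd K" "G \<subseteq> F" for F G
    using that unfolding mem_sd by blast
  moreover have "{} \<in> sd K"
    by (simp add: mem_sd)
  ultimately show ?thesis
    unfolding abstract_complex_def by blast
qed

text \<open>A barycenter spreads the weight of \<open>S\<close> evenly over its vertices, so
  dividing by \<open>card S\<close> turns coordinates in the barycentric subdivision into layer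
  weights. Bijectivity then reduces to existence and uniqueness of layerings.\<close>

lemma layering_barycenter:
  assumes K: "abstract_complex K" and \<beta>: "\<beta> \<in> realization (sd K)"
  shows "layering (affine_extension barycenter \<beta>) (\<lambda>S. \<beta> S / real (card S))"
    and "supp (\<lambda>S. \<beta> S / real (card S)) = supp \<beta>"
proof -
  have C: "supp \<beta> \<in> sd K"
    using \<beta> by (simp add: realization_def)
  have card: "card S > 0" if "S \<in> supp \<beta>" for S
    using C that complexD(3)[OF K, of S] by (auto simp: mem_sd card_gt_0_iff)
  show eq: "supp (\<lambda>S. \<beta> S / real (card S)) = supp \<beta>"
    using card by (fastforce simp: supp_def)
  have "finite (supp \<beta>)"
    using complexD(3)[OF abstract_complex_sd[OF K] C] .
  then show "layering (affine_extension barycenter \<beta>) (\<lambda>S. \<beta> S / real (card S))"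
    unfolding layering_def eq using \<beta> C
    by (auto simp: mem_sd realization_def affine_extension_def barycenter_def intro!: sum.cong)
qed

lemma barycenter_realization:
  assumes K: "abstract_complex K" and \<beta>: "\<beta> \<in> realization (sd K)"
  shows "affine_extension barycenter \<beta> \<in> realization K"
    and "supp (affine_extension barycenter \<beta>) = \<Union>(supp \<beta>)"
proof -
  let ?\<alpha> = "affine_extension barycenter \<beta>" and ?\<gamma> = "\<lambda>S. \<beta> S / real (card S)"
  note l = layering_barycenter(1)[OF K \<beta>] and eq = layering_barycenter(2)[OF K \<beta>]
  have C: "supp \<beta> \<in> sd K"
    using \<beta> by (simp add: realization_def)
  have "supp \<beta> \<noteq> {}"
    using \<beta> by (auto simp: realization_def)
  then have "\<Union>(supp \<beta>) \<in> supp \<beta>"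
    using C complexD(3)[OF abstract_complex_sd[OF K] C]
    by (intro Union_in_finite_chain) (auto simp: mem_sd)
  then have UK: "\<Union>(supp \<beta>) \<in> K"
    using C unfolding mem_sd by blast
  show s: "supp ?\<alpha> = \<Union>(supp \<beta>)"
    using layering_Union[OF l] eq by simp
  have fin: "finite (supp ?\<alpha>)"
    unfolding s using complexD(3)[OF K UK] .
  have "(\<Sum>v\<in>supp ?\<alpha>. ?\<alpha> v) = (\<Sum>S\<in>supp \<beta>. real (card S) * ?\<gamma> S)"
    using layering_total[OF l fin] eq by simp
  also have "\<dots> = (\<Sum>S\<in>supp \<beta>. \<beta> S)"
    using C complexD(3)[OF K] by (intro sum.cong) (auto simp: mem_sd subset_iff)
  finally have "(\<Sum>v\<in>supp ?\<alpha>. ?\<alpha> v) = 1"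
    using \<beta> by (simp add: realization_def)
  moreover have "0 \<le> ?\<alpha> v" for v
    unfolding layeringD(4)[OF l] using layeringD(1)[OF l] by (intro sum_nonneg) auto
  ultimately show "?\<alpha> \<in> realization K"
    using UK s by (simp add: realization_def)
qed

lemma bij_betw_sd_realization:
  assumes K: "abstract_complex K"
  shows "bij_betw (affine_extension barycenter) (realization (sd K)) (realization K)"
  unfolding bij_betw_def
proof (intro conjI inj_onI equalityI subsetI)
  fix \<beta> \<beta>' assume \<beta>: "\<beta> \<in> realization (sd K)" "\<beta>' \<in> realization (sd K)"
    and eq: "affine_extension barycenter \<beta> = affine_extension barycenter \<beta>'"
  let ?\<alpha> = "affine_extension barycenter \<beta>"
  have fin: "finite (supp ?\<alpha>)"
    using barycenter_realization(1)[OF K \<beta>(1)] complexD(3)[OF K]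
    by (simp add: realization_def)
  show "\<beta> = \<beta>'"
  proof
    fix S
    show "\<beta> S = \<beta>' S"
    proof (cases "S \<in> supp \<beta> \<union> supp \<beta>'")
      case True
      then have "S \<in> K - {{}}"
        using \<beta> by (auto simp: realization_def mem_sd)
      then have S: "S \<noteq> {}" "card S > 0"
        using complexD(3)[OF K, of S] by (auto simp: card_gt_0_iff)
      then have "\<beta> S / real (card S) = \<beta>' S / real (card S)"
        using layering_unique[OF layering_barycenter(1)[OF K \<beta>(1)] _ fin S(1)]
          layering_barycenter(1)[OF K \<beta>(2)] eq by simp
      then show ?thesis
        using S by simp
    next
      case False
      then show ?thesis
        by (simp add: supp_iff)
    qed
  qed
next
  fix \<alpha> assume "\<alpha> \<in> affine_extension barycenter ` realization (sd K)"
  then show "\<alpha> \<in> realization K"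
    using barycenter_realization(1)[OF K] by blast
next
  fix \<alpha> assume \<alpha>: "\<alpha> \<in> realization K"
  then have fin: "finite (supp \<alpha>)" and nn: "\<And>v. 0 \<le> \<alpha> v" and sK: "supp \<alpha> \<in> K"
    and total: "(\<Sum>v\<in>supp \<alpha>. \<alpha> v) = 1"
    using complexD(3)[OF K] by (auto simp: realization_def)
  obtain \<gamma> where l: "layering \<alpha> \<gamma>" and e: "\<gamma> {} = 0"
    using layering_exists[OF fin nn] by blast
  define \<beta> where "\<beta> S = real (card S) * \<gamma> S" for S
  have card: "S \<in> K" "S \<noteq> {}" "card S > 0" if "S \<in> supp \<gamma>" for S
  proof -
    show "S \<in> K"
      using layering_subset[OF l that] complexD(4)[OF K sK] by blast
    then have "finite S"
      by (rule complexD(3)[OF K])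
    show "S \<noteq> {}"
      using e that by (auto simp: supp_iff)
    then show "card S > 0"
      using \<open>finite S\<close> by (simp add: card_gt_0_iff)
  qed
  have supp: "supp \<beta> = supp \<gamma>"
  proof
    show "supp \<gamma> \<subseteq> supp \<beta>"
    proof
      fix S assume "S \<in> supp \<gamma>"
      then show "S \<in> supp \<beta>"
        using card(3)[of S] by (simp add: \<beta>_def supp_iff)
    qed
  qed (auto simp: \<beta>_def supp_iff)
  have "supp \<beta> \<in> sd K"
    unfolding mem_sd supp using layeringD(3)[OF l] card by blast
  moreover have "(\<Sum>S\<in>supp \<beta>. \<beta> S) = 1"
    using layering_total[OF l fin] total unfolding supp \<beta>_def by simp
  ultimately have "\<beta> \<in> realization (sd K)"
    using layeringD(1)[OF l] by (simp add: realization_def \<beta>_def)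
  moreover have "affine_extension barycenter \<beta> = \<alpha>"
  proof
    fix v
    have "affine_extension barycenter \<beta> v = (\<Sum>S\<in>supp \<gamma>. if v \<in> S then \<gamma> S else 0)"
      unfolding affine_extension_def supp
      by (intro sum.cong) (use card(3) in \<open>auto simp: \<beta>_def barycenter_def\<close>)
    then show "affine_extension barycenter \<beta> v = \<alpha> v"
      using layeringD(4)[OF l, of v] by simp
  qed
  ultimately show "\<alpha> \<in> affine_extension barycenter ` realization (sd K)"
    by blast
qed

section \<open>Multichains as height functions\<close>

definition chain_heights :: "('a set \<Rightarrow> nat) \<Rightarrow> 'a \<Rightarrow> nat" where
  "chain_heights f v = (\<Sum>S\<in>supp f. if v \<in> S then f S else 0)"

lemma supp_of_nat [simp]: "supp (\<lambda>v. real (f v)) = supp f"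
  by (simp add: supp_def)

lemma layering_chain_heights:
  assumes K: "abstract_complex K" and f: "supp f \<in> sd K"
  shows "layering (\<lambda>v. real (chain_heights f v)) (\<lambda>S. real (f S))"
  using f complexD(3)[OF abstract_complex_sd[OF K] f]
  by (auto simp: layering_def mem_sd chain_heights_def intro!: sum.cong)

text \<open>The total multiplicity of a multichain is its largest height, attained on the smallest
  member, which is nonempty. Fixing the total therefore means fixing the maximum, and unique
  integral layerings recover the multichain.\<close>

lemma bij_betw_chain_heights:
  assumes K: "abstract_complex K" and n: "n > 0"
  shows "bij_betw chain_heights (esd_vertices n (sd K))
    {\<phi>. supp \<phi> \<in> K \<and> (\<forall>v. \<phi> v \<le> n) \<and> (\<exists>v. \<phi> v = n)}" (is "bij_betw _ _ ?B")
proof -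
  have max: "(\<forall>v. chain_heights f v \<le> (\<Sum>S\<in>supp f. f S)) \<and> (\<exists>v. chain_heights f v = (\<Sum>S\<in>supp f. f S))"
    if f: "supp f \<in> sd K" "supp f \<noteq> {}" for f
  proof (intro conjI allI)
    show "chain_heights f v \<le> (\<Sum>S\<in>supp f. f S)" for v
      unfolding chain_heights_def by (intro sum_mono) auto
    have "\<Inter>(supp f) \<in> supp f"
      using f complexD(3)[OF abstract_complex_sd[OF K] f(1)]
      by (intro Inter_in_finite_chain) (auto simp: mem_sd)
    then have "\<Inter>(supp f) \<noteq> {}"
      using f unfolding mem_sd by blast
    then obtain v where "\<And>S. S \<in> supp f \<Longrightarrow> v \<in> S"
      by blast
    then have "chain_heights f v = (\<Sum>S\<in>supp f. f S)"
      unfolding chain_heights_def by (intro sum.cong) auto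
    then show "\<exists>v. chain_heights f v = (\<Sum>S\<in>supp f. f S)" ..
  qed
  have Un: "supp (chain_heights f) = \<Union>(supp f)" if "supp f \<in> sd K" for f
    using layering_Union[OF layering_chain_heights[OF K that]] by simp
  have UK: "\<Union>(supp f) \<in> K" if f: "supp f \<in> sd K" "supp f \<noteq> {}" for f
  proof -
    have "\<Union>(supp f) \<in> supp f"
      using f complexD(3)[OF abstract_complex_sd[OF K] f(1)]
      by (intro Union_in_finite_chain) (auto simp: mem_sd)
    then show ?thesis
      using f unfolding mem_sd by blast
  qed
  have mem: "supp f \<in> sd K" "supp f \<noteq> {}" "(\<Sum>S\<in>supp f. f S) = n" if "f \<in> esd_vertices n (sd K)" for f
    using that n by (auto simp: esd_vertices_def)
  show ?thesis
    unfolding bij_betw_def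
  proof (intro conjI inj_onI equalityI subsetI)
    fix f g assume f: "f \<in> esd_vertices n (sd K)" and g: "g \<in> esd_vertices n (sd K)"
      and eq: "chain_heights f = chain_heights g"
    have fin: "finite (supp (\<lambda>v. real (chain_heights f v)))"
      using Un[OF mem(1)[OF f]] UK[OF mem(1,2)[OF f]] complexD(3)[OF K] by simp
    show "f = g"
    proof
      fix S
      show "f S = g S"
      proof (cases "S = {}")
        case True
        then have "S \<notin> supp f" "S \<notin> supp g"
          using mem(1)[OF f] mem(1)[OF g] by (auto simp: mem_sd)
        then show ?thesis
          by (simp add: supp_iff)
      next
        case False
        have "layering (\<lambda>v. real (chain_heights f v)) (\<lambda>S. real (g S))"
          unfolding eq by (rule layering_chain_heights[OF K mem(1)[OF g]])
        then have "real (f S) = real (g S)"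
          by (rule layering_unique[OF layering_chain_heights[OF K mem(1)[OF f]] _ fin False])
        then show ?thesis
          by simp
      qed
    qed
  next
    fix \<phi> assume "\<phi> \<in> chain_heights ` esd_vertices n (sd K)"
    then obtain f where f: "f \<in> esd_vertices n (sd K)" "\<phi> = chain_heights f"
      by blast
    then show "\<phi> \<in> ?B"
      using Un[OF mem(1)[OF f(1)]] UK[OF mem(1,2)[OF f(1)]] max[OF mem(1,2)[OF f(1)]] mem(3)[OF f(1)]
      by simp
  next
    fix \<phi> assume \<phi>: "\<phi> \<in> ?B"
    then have sK: "supp \<phi> \<in> K"
      by simp
    then have "finite (supp \<phi>)"
      by (rule complexD(3)[OF K])
    then obtain \<gamma> where l: "layering (\<lambda>v. real (\<phi> v)) \<gamma>" and e: "\<gamma> {} = 0" and int: "\<And>S. \<gamma> S \<in> \<int>"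
      using layering_exists[of "\<lambda>v. real (\<phi> v)"] by auto
    define f where "f S = nat \<lfloor>\<gamma> S\<rfloor>" for S
    have f: "real (f S) = \<gamma> S" for S
    proof -
      have "\<gamma> S = of_int \<lfloor>\<gamma> S\<rfloor>"
        using int[of S] by (auto elim: Ints_cases)
      moreover have "0 \<le> \<gamma> S"
        by (rule layeringD(1)[OF l])
      ultimately show ?thesis
        by (simp add: f_def)
    qed
    have supp: "supp f = supp \<gamma>"
      by (auto simp: supp_def simp flip: f)
    have sd: "supp f \<in> sd K"
      unfolding mem_sd supp
    proof (intro conjI subsetI ballI)
      fix S assume S: "S \<in> supp \<gamma>"
      then have "S \<in> K"
        using layering_subset[OF l S] complexD(4)[OF K sK] by simp
      moreover have "S \<noteq> {}"
        using e S by (auto simp: supp_iff)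
      ultimately show "S \<in> K - {{}}"
        by simp
    next
      fix S T assume "S \<in> supp \<gamma>" "T \<in> supp \<gamma>"
      then show "S \<subseteq> T \<or> T \<subseteq> S"
        by (rule layeringD(3)[OF l])
    qed
    have ch: "chain_heights f = \<phi>"
    proof
      fix v
      have "real (chain_heights f v) = (\<Sum>S\<in>supp \<gamma>. if v \<in> S then \<gamma> S else 0)"
        unfolding chain_heights_def supp by (simp add: f if_distrib cong: if_cong)
      then show "chain_heights f v = \<phi> v"
        using layeringD(4)[OF l, of v] by simp
    qed
    obtain v where v: "\<phi> v = n"
      using \<phi> by blast
    then have "supp \<phi> \<noteq> {}"
      using n by (auto simp: supp_def)
    then have ne: "supp f \<noteq> {}"
      using Un[OF sd] ch by auto
    obtain w where "\<phi> w = (\<Sum>S\<in>supp f. f S)"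
      using max[OF sd ne] ch by metis
    then have "(\<Sum>S\<in>supp f. f S) \<le> n"
      using \<phi> by (metis (mono_tags, lifting) mem_Collect_eq)
    moreover have "n \<le> (\<Sum>S\<in>supp f. f S)"
      using max[OF sd ne] ch v by metis
    ultimately have "f \<in> esd_vertices n (sd K)"
      using sd by (simp add: esd_vertices_def)
    then show "\<phi> \<in> chain_heights ` esd_vertices n (sd K)"
      using ch by blast
  qed
qed

section \<open>Counting height functions on a simplex and on its boundary\<close>

definition fun_space :: "'a set \<Rightarrow> nat set \<Rightarrow> ('a \<Rightarrow> nat) set" where
  "fun_space S B = {\<phi>. (\<forall>v\<in>S. \<phi> v \<in> B) \<and> (\<forall>v. v \<notin> S \<longrightarrow> \<phi> v = 0)}"

lemma fun_space_pos:
  "fun_space S (B \<inter> {0<..}) = {\<phi> \<in> fun_space S B. supp \<phi> = S}"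
proof (intro equalityI subsetI)
  fix \<phi> assume "\<phi> \<in> fun_space S (B \<inter> {0<..})"
  then have "\<phi> \<in> fun_space S B" "\<And>v. v \<in> S \<Longrightarrow> \<phi> v \<noteq> 0" "\<And>v. v \<notin> S \<Longrightarrow> \<phi> v = 0"
    by (auto simp: fun_space_def)
  then show "\<phi> \<in> {\<phi> \<in> fun_space S B. supp \<phi> = S}"
    by (metis (mono_tags, lifting) mem_Collect_eq set_eqI supp_iff)
next
  fix \<phi> assume "\<phi> \<in> {\<phi> \<in> fun_space S B. supp \<phi> = S}"
  then show "\<phi> \<in> fun_space S (B \<inter> {0<..})"
    by (auto simp: fun_space_def supp_iff)
qed

lemma card_fun_space:
  assumes "finite S" "finite B"
  shows "card (fun_space S B) = card B ^ card S" "finite (fun_space S B)"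
proof -
  have bij: "bij_betw (\<lambda>\<phi>. restrict \<phi> S) (fun_space S B) (S \<rightarrow>\<^sub>E B)"
    by (rule bij_betwI[where g = "\<lambda>\<phi> v. if v \<in> S then \<phi> v else 0"])
      (auto simp: fun_space_def restrict_def PiE_def extensional_def fun_eq_iff)
  show "card (fun_space S B) = card B ^ card S"
    using bij_betw_same_card[OF bij] assms by (simp add: card_PiE)
  show "finite (fun_space S B)"
    using bij_betw_finite[OF bij] assms by (simp add: finite_PiE)
qed

lemma card_esd_vertices_sd_Pow:
  assumes S: "finite S" and n: "n > 0"
  shows "real (card (esd_vertices n (sd (Pow S)))) = real (n + 1) ^ card S - real n ^ card S"
proof -
  have "{\<phi>. supp \<phi> \<in> Pow S \<and> (\<forall>v. \<phi> v \<le> n) \<and> (\<exists>v. \<phi> v = n)}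
      = fun_space S {0..n} - fun_space S {0..<n}"
    using n by (auto simp: fun_space_def supp_def order.order_iff_strict)
  then have "card (esd_vertices n (sd (Pow S))) = card (fun_space S {0..n} - fun_space S {0..<n})"
    using bij_betw_same_card[OF bij_betw_chain_heights[OF abstract_complex_Pow[OF S] n]] by simp
  also have "\<dots> = card (fun_space S {0..n}) - card (fun_space S {0..<n})"
    using S by (intro card_Diff_subset card_fun_space) (auto simp: fun_space_def)
  finally show ?thesis
    using S by (simp add: card_fun_space of_nat_diff power_mono)
qed

text \<open>Passing to the boundary discards the height functions of full support: all values in
  1..n with n attained, which is the count of the simplex with n lowered by one.\<close>

lemma card_esd_vertices_sd_boundary:
  assumes S: "finite S" "S \<noteq> {}" and n: "n > 0"
  shows "real (card (esd_vertices n (sd (Pow S - {S}))))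
    = (real (n + 1) ^ card S - real n ^ card S) - (real n ^ card S - real (n - 1) ^ card S)"
proof -
  let ?A = "fun_space S {0..n} - fun_space S {0..<n}" and ?B = "fun_space S {1..n} - fun_space S {1..<n}"
  have K: "abstract_complex (Pow S - {S})"
    using S by (auto simp: abstract_complex_def intro: finite_subset)
  have 1: "{\<phi>. supp \<phi> \<in> Pow S \<and> (\<forall>v. \<phi> v \<le> n) \<and> (\<exists>v. \<phi> v = n)} = ?A"
    using n by (auto simp: fun_space_def supp_def order.order_iff_strict)
  have "fun_space S {1..n} = {\<phi> \<in> fun_space S {0..n}. supp \<phi> = S}"
    "fun_space S {1..<n} = {\<phi> \<in> fun_space S {0..<n}. supp \<phi> = S}"
    by (simp_all flip: fun_space_pos) (auto intro!: arg_cong[of _ _ "fun_space S"])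
  then have 2: "?B = {\<phi> \<in> ?A. supp \<phi> = S}"
    by blast
  then have sub: "?B \<subseteq> ?A"
    by blast
  have fin: "finite ?A" "finite ?B"
    using S by (simp_all add: card_fun_space)
  have "{\<phi>. supp \<phi> \<in> Pow S - {S} \<and> (\<forall>v. \<phi> v \<le> n) \<and> (\<exists>v. \<phi> v = n)} = ?A - ?B"
    unfolding 2 1[symmetric] by auto
  then have "card (esd_vertices n (sd (Pow S - {S}))) = card (?A - ?B)"
    using bij_betw_same_card[OF bij_betw_chain_heights[OF K n]] by simp
  also have "\<dots> = card ?A - card ?B"
    using fin sub by (intro card_Diff_subset)
  finally have "real (card (esd_vertices n (sd (Pow S - {S})))) = real (card ?A) - real (card ?B)"
    using card_mono[OF fin(1) sub] by (simp add: of_nat_diff)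
  moreover have "card ?A = card (fun_space S {0..n}) - card (fun_space S {0..<n})"
    using S by (intro card_Diff_subset card_fun_space) (auto simp: fun_space_def)
  then have "real (card ?A) = real (n + 1) ^ card S - real n ^ card S"
    using S by (simp add: card_fun_space of_nat_diff power_mono)
  moreover have "card ?B = card (fun_space S {1..n}) - card (fun_space S {1..<n})"
    using S by (intro card_Diff_subset card_fun_space) (auto simp: fun_space_def)
  then have "real (card ?B) = real n ^ card S - real (n - 1) ^ card S"
    using S by (simp add: card_fun_space of_nat_diff power_mono)
  ultimately show ?thesis
    by linarith
qed

section \<open>Edgewise subdivision\<close>

text \<open>Unlike \<open>partial_sum\<close> this omits index \<open>j\<close>, so it starts at 0
  and \<open>j\<close> runs up to \<open>length vs\<close>. The type of values is left open because
  vertices are natural and points real.\<close>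

definition prefix_sum :: "'a list \<Rightarrow> ('a \<Rightarrow> 'b::comm_monoid_add) \<Rightarrow> nat \<Rightarrow> 'b" where
  "prefix_sum vs f j = (\<Sum>k<j. f (vs ! k))"

lemma prefix_sum_0 [simp]: "prefix_sum vs f 0 = 0"
  by (simp add: prefix_sum_def)

lemma prefix_sum_Suc: "prefix_sum vs f (Suc j) = prefix_sum vs f j + f (vs ! j)"
  by (simp add: prefix_sum_def)

lemma unit_step_iff:
  "unit_step vs f g \<longleftrightarrow> (\<forall>j\<le>length vs. prefix_sum vs f j = prefix_sum vs g j \<or>
     prefix_sum vs f j = prefix_sum vs g j + 1)" (is "_ \<longleftrightarrow> ?R")
proof -
  have eq: "partial_sum vs h j = int (prefix_sum vs h (Suc j))" for h j
    by (simp add: partial_sum_def prefix_sum_def lessThan_Suc_atMost)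
  have "unit_step vs f g \<longleftrightarrow> (\<forall>j<length vs. prefix_sum vs f (Suc j) = prefix_sum vs g (Suc j) \<or>
     prefix_sum vs f (Suc j) = prefix_sum vs g (Suc j) + 1)"
    unfolding unit_step_def eq by (auto; presburger)
  also have "\<dots> \<longleftrightarrow> ?R"
  proof
    assume *: "\<forall>j<length vs. prefix_sum vs f (Suc j) = prefix_sum vs g (Suc j) \<or>
      prefix_sum vs f (Suc j) = prefix_sum vs g (Suc j) + 1"
    show ?R
    proof (intro allI impI)
      fix j assume "j \<le> length vs"
      then show "prefix_sum vs f j = prefix_sum vs g j \<or> prefix_sum vs f j = prefix_sum vs g j + 1"
        using * by (cases j) auto
    qed
  qed auto
  finally show ?thesis .
qed

lemma sum_supp_eq_prefix_sum:
  fixes f :: "'a \<Rightarrow> 'b::comm_monoid_add"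
  assumes "distinct vs" "supp f \<subseteq> set vs"
  shows "(\<Sum>v\<in>supp f. f v) = prefix_sum vs f (length vs)"
proof -
  have "(\<Sum>v\<in>supp f. f v) = (\<Sum>v\<in>set vs. f v)"
    using assms(2) by (intro sum.mono_neutral_left) (auto simp: supp_iff)
  also have "\<dots> = prefix_sum vs f (length vs)"
    unfolding prefix_sum_def
    using bij_betw_nth[OF assms(1), of "{..<length vs}" "set vs"] by (simp add: sum.reindex_bij_betw)
  finally show ?thesis .
qed

lemma prefix_sum_eq_imp_eq:
  fixes f g :: "'a \<Rightarrow> nat"
  assumes "supp f \<subseteq> set vs" "supp g \<subseteq> set vs"
    and eq: "\<And>j. j \<le> length vs \<Longrightarrow> prefix_sum vs f j = prefix_sum vs g j"
  shows "f = g"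
proof
  fix v
  show "f v = g v"
  proof (cases "v \<in> set vs")
    case True
    then obtain k where k: "k < length vs" "v = vs ! k"
      by (metis in_set_conv_nth)
    then show ?thesis
      using eq[of k] eq[of "Suc k"] by (simp add: prefix_sum_Suc)
  next
    case False
    then have "v \<notin> supp f" "v \<notin> supp g"
      using assms by auto
    then show ?thesis
      by (simp add: supp_iff)
  qed
qed

lemma finite_esd_vertices:
  assumes L: "abstract_complex L"
  shows "finite (esd_vertices r L)"
proof -
  have "esd_vertices r L \<subseteq> (\<Union>F\<in>L. fun_space F {..r})"
  proof
    fix f assume f: "f \<in> esd_vertices r L"
    then have "f v \<le> r" if "v \<in> supp f" for v
      using member_le_sum[of v "supp f" f] that complexD(3)[OF L] by (auto simp: esd_vertices_def)
    then have "f \<in> fun_space (supp f) {..r}"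
      by (auto simp: fun_space_def supp_iff)
    then show "f \<in> (\<Union>F\<in>L. fun_space F {..r})"
      using f by (auto simp: esd_vertices_def)
  qed
  moreover have "finite (\<Union>F\<in>L. fun_space F {..r})"
    using complexD(1,3)[OF L] by (auto intro: card_fun_space)
  ultimately show ?thesis
    by (rule finite_subset)
qed

lemma abstract_complex_esd:
  assumes L: "abstract_complex L"
  shows "abstract_complex (esd vs r L)"
proof -
  have sub: "esd vs r L \<subseteq> Pow (esd_vertices r L)"
    by (auto simp: esd_def)
  have fin: "finite (esd_vertices r L)"
    by (rule finite_esd_vertices[OF L])
  have "finite F" if "F \<in> esd vs r L" for F
    using fin sub that by (meson PowD finite_subset subsetD)
  moreover have "finite (esd vs r L)"
    using fin sub by (meson finite_Pow_iff finite_subset)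
  moreover have "G \<in> esd vs r L" if F: "F \<in> esd vs r L" and G: "G \<subseteq> F" for F G
  proof -
    have "(\<Union>f\<in>G. supp f) \<subseteq> (\<Union>f\<in>F. supp f)"
      using G by blast
    then have "(\<Union>f\<in>G. supp f) \<in> L"
      using F complexD(4)[OF L] by (auto simp: esd_def)
    then show ?thesis
      using F G unfolding esd_def by blast
  qed
  moreover have "{} \<in> esd vs r L"
    using complexD(2)[OF L] by (simp add: esd_def)
  ultimately show ?thesis
    unfolding abstract_complex_def by blast
qed

text \<open>Both the points of the realization (\<open>T = 1\<close>) and the lattice points of the \<open>T\<close>-fold dilation
  arise as such combinations of vertices of the edgewise subdivision.\<close>

definition esd_combination ::
  "'a list \<Rightarrow> nat \<Rightarrow> 'a set set \<Rightarrow> real \<Rightarrow> (('a \<Rightarrow> nat) \<Rightarrow> real) \<Rightarrow> ('a \<Rightarrow> real) \<Rightarrow> bool" where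
  "esd_combination vs r L T \<beta> \<alpha> \<longleftrightarrow> (\<forall>f. 0 \<le> \<beta> f) \<and> supp \<beta> \<in> esd vs r L \<and>
     (\<Sum>f\<in>supp \<beta>. \<beta> f) = T \<and> (\<forall>v. \<alpha> v = (\<Sum>f\<in>supp \<beta>. \<beta> f * real (f v)))"

text \<open>On a face carrying \<alpha> every vertex has prefix sum either the floor of
  \<open>prefix_sum vs \<alpha> j / T\<close> or one more (\<open>combination_cases\<close>).
  Recording where it is one more encodes the vertex as a set of positions, and a face as a chain of
  such sets.\<close>

definition step_set :: "'a list \<Rightarrow> real \<Rightarrow> ('a \<Rightarrow> real) \<Rightarrow> ('a \<Rightarrow> nat) \<Rightarrow> nat set" where
  "step_set vs T \<alpha> f = {j. j \<le> length vs \<and> int (prefix_sum vs f j) = \<lfloor>prefix_sum vs \<alpha> j / T\<rfloor> + 1}"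

text \<open>T times the fractional part of the prefix sum over T; the value 0 beyond the list makes
  the support finite, as layerings require.\<close>

definition residue :: "'a list \<Rightarrow> real \<Rightarrow> ('a \<Rightarrow> real) \<Rightarrow> nat \<Rightarrow> real" where
  "residue vs T \<alpha> j = (if j \<le> length vs then prefix_sum vs \<alpha> j - T * \<lfloor>prefix_sum vs \<alpha> j / T\<rfloor> else 0)"

lemma finite_supp_residue: "finite (supp (residue vs T \<alpha>))"
proof (rule finite_subset)
  show "supp (residue vs T \<alpha>) \<subseteq> {..length vs}"
  proof
    fix j assume "j \<in> supp (residue vs T \<alpha>)"
    then have "residue vs T \<alpha> j \<noteq> 0"
      by (simp only: supp_iff simp_thms)
    then show "j \<in> {..length vs}"
      unfolding residue_def by (cases "j \<le> length vs") simp_all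
  qed
qed simp

lemma residue_bounds:
  assumes "T > 0"
  shows "0 \<le> residue vs T \<alpha> j" "residue vs T \<alpha> j < T"
proof -
  let ?y = "prefix_sum vs \<alpha> j"
  have "of_int \<lfloor>?y / T\<rfloor> * T \<le> ?y" "?y < (of_int \<lfloor>?y / T\<rfloor> + 1) * T"
    using assms floor_correct[of "?y / T"]
    by (simp_all only: pos_divide_less_eq[symmetric] pos_le_divide_eq[symmetric] of_int_add of_int_1)
  then show "0 \<le> residue vs T \<alpha> j" "residue vs T \<alpha> j < T"
    using assms by (simp_all add: residue_def algebra_simps)
qed

abbreviation scaled_extension :: "nat \<Rightarrow> (('a \<Rightarrow> nat) \<Rightarrow> real) \<Rightarrow> 'a \<Rightarrow> real" where
  "scaled_extension r \<equiv> affine_extension (\<lambda>f v. real (f v) / real r)"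

text \<open>Faces need only be contained in \<open>set vs\<close>, so the subdivision of a single
  face can use the vertex order of the whole complex.\<close>

locale esd_setup =
  fixes L :: "'a set set" and vs :: "'a list" and r :: nat
  assumes L: "abstract_complex L" and distinct: "distinct vs" and vertices: "\<And>F. F \<in> L \<Longrightarrow> F \<subseteq> set vs"
    and r_pos: "r > 0"
begin

lemma combinationD:
  assumes c: "esd_combination vs r L T \<beta> \<alpha>"
  shows "0 \<le> \<beta> f" "finite (supp \<beta>)" "f \<in> supp \<beta> \<Longrightarrow> 0 < \<beta> f" "f \<in> supp \<beta> \<Longrightarrow> supp f \<subseteq> set vs"
    "(\<Sum>f\<in>supp \<beta>. \<beta> f) = T" "\<alpha> v = (\<Sum>f\<in>supp \<beta>. \<beta> f * real (f v))"
    "f \<in> supp \<beta> \<Longrightarrow> f \<in> esd_vertices r L"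
    "f \<in> supp \<beta> \<Longrightarrow> g \<in> supp \<beta> \<Longrightarrow> unit_step vs f g \<or> unit_step vs g f"
proof -
  have E: "supp \<beta> \<in> esd vs r L"
    using c by (simp add: esd_combination_def)
  show "0 \<le> \<beta> f" "(\<Sum>f\<in>supp \<beta>. \<beta> f) = T" "\<alpha> v = (\<Sum>f\<in>supp \<beta>. \<beta> f * real (f v))"
    using c by (auto simp: esd_combination_def)
  then show "f \<in> supp \<beta> \<Longrightarrow> 0 < \<beta> f"
    by (simp add: supp_iff order.order_iff_strict)
  show "finite (supp \<beta>)"
    using complexD(3)[OF abstract_complex_esd[OF L] E] .
  show "f \<in> supp \<beta> \<Longrightarrow> f \<in> esd_vertices r L"
    using E by (auto simp: esd_def)
  then show "f \<in> supp \<beta> \<Longrightarrow> supp f \<subseteq> set vs"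
    using vertices by (simp add: esd_vertices_def)
  show "f \<in> supp \<beta> \<Longrightarrow> g \<in> supp \<beta> \<Longrightarrow> unit_step vs f g \<or> unit_step vs g f"
    using E by (auto simp: esd_def)
qed

lemma combination_supp:
  assumes c: "esd_combination vs r L T \<beta> \<alpha>"
  shows "supp \<alpha> = (\<Union>f\<in>supp \<beta>. supp f)" "supp \<alpha> \<in> L" "finite (supp \<alpha>)" "supp \<alpha> \<subseteq> set vs" "0 \<le> \<alpha> v"
proof -
  have "\<alpha> v \<noteq> 0 \<longleftrightarrow> (\<exists>f\<in>supp \<beta>. f v \<noteq> 0)" for v
    unfolding combinationD(6)[OF c, of v] using combinationD(1,2)[OF c]
    by (subst sum_nonneg_eq_0_iff) (auto simp: supp_iff)
  then show 1: "supp \<alpha> = (\<Union>f\<in>supp \<beta>. supp f)"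
    by (auto simp: supp_def)
  show 2: "supp \<alpha> \<in> L"
    unfolding 1 using c by (simp add: esd_combination_def esd_def)
  then show "finite (supp \<alpha>)" "supp \<alpha> \<subseteq> set vs"
    using complexD(3)[OF L] vertices by auto
  show "0 \<le> \<alpha> v"
    unfolding combinationD(6)[OF c, of v] using combinationD(1)[OF c] by (intro sum_nonneg) auto
qed

lemma combination_prefix_sum:
  assumes c: "esd_combination vs r L T \<beta> \<alpha>"
  shows "prefix_sum vs \<alpha> j = (\<Sum>f\<in>supp \<beta>. \<beta> f * real (prefix_sum vs f j))"
proof -
  have "prefix_sum vs \<alpha> j = (\<Sum>k<j. \<Sum>f\<in>supp \<beta>. \<beta> f * real (f (vs ! k)))"
    unfolding prefix_sum_def by (intro sum.cong refl combinationD(6)[OF c])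
  also have "\<dots> = (\<Sum>f\<in>supp \<beta>. \<Sum>k<j. \<beta> f * real (f (vs ! k)))"
    by (rule sum.swap)
  finally show ?thesis
    by (simp add: prefix_sum_def sum_distrib_left)
qed

lemma combination_total:
  assumes c: "esd_combination vs r L T \<beta> \<alpha>"
  shows "(\<Sum>v\<in>supp \<alpha>. \<alpha> v) = real r * T"
proof -
  have "(\<Sum>v\<in>supp \<alpha>. \<alpha> v) = prefix_sum vs \<alpha> (length vs)"
    using combination_supp[OF c] distinct by (intro sum_supp_eq_prefix_sum)
  also have "\<dots> = (\<Sum>f\<in>supp \<beta>. \<beta> f * real r)"
    unfolding combination_prefix_sum[OF c]
  proof (rule sum.cong[OF refl])
    fix f assume f: "f \<in> supp \<beta>"
    then have "prefix_sum vs f (length vs) = r"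
      using sum_supp_eq_prefix_sum[OF distinct combinationD(4)[OF c f]] combinationD(7)[OF c f]
      by (simp add: esd_vertices_def)
    then show "\<beta> f * real (prefix_sum vs f (length vs)) = \<beta> f * real r"
      by simp
  qed
  also have "\<dots> = real r * T"
    using combinationD(5)[OF c] by (simp add: sum_distrib_right[symmetric])
  finally show ?thesis .
qed

text \<open>The prefix sum of \<alpha> is the \<beta>-weighted sum of those of the vertices, which
  differ from that of \<open>f\<close> by at most 1. As \<open>f\<close> itself contributes
  difference 0 with positive weight, the upper bound is strict, and only two values of the floor
  remain.\<close>

lemma combination_cases:
  assumes c: "esd_combination vs r L T \<beta> \<alpha>" and T: "T > 0" and f: "f \<in> supp \<beta>" and j: "j \<le> length vs"
  shows "int (prefix_sum vs f j) = \<lfloor>prefix_sum vs \<alpha> j / T\<rfloor> + (if j \<in> step_set vs T \<alpha> f then 1 else 0)"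
proof -
  let ?y = "prefix_sum vs \<alpha> j" and ?u = "\<lambda>f. real (prefix_sum vs f j)"
  have step: "\<bar>?u g - ?u f\<bar> \<le> 1" if "g \<in> supp \<beta>" for g
    using combinationD(8)[OF c f that] j unfolding unit_step_iff by fastforce
  have "?y - T * ?u f = (\<Sum>g\<in>supp \<beta>. \<beta> g * (?u g - ?u f))"
    unfolding combination_prefix_sum[OF c] combinationD(5)[OF c, symmetric]
    by (simp add: right_diff_distrib sum_subtractf sum_distrib_right)
  also have "\<dots> < (\<Sum>g\<in>supp \<beta>. \<beta> g * 1)"
  proof (rule sum_strict_mono_ex1)
    show "\<forall>g\<in>supp \<beta>. \<beta> g * (?u g - ?u f) \<le> \<beta> g * 1"
    proof
      fix g assume "g \<in> supp \<beta>"
      then show "\<beta> g * (?u g - ?u f) \<le> \<beta> g * 1"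
        using combinationD(1)[OF c, of g] step[of g] by (intro mult_left_mono) auto
    qed
    show "\<exists>g\<in>supp \<beta>. \<beta> g * (?u g - ?u f) < \<beta> g * 1"
      using f combinationD(3)[OF c f] by (intro bexI[of _ f]) auto
  qed (rule combinationD(2)[OF c])
  finally have 1: "?y < T * (?u f + 1)"
    using combinationD(5)[OF c] by (simp add: algebra_simps)
  have "- T = (\<Sum>g\<in>supp \<beta>. \<beta> g * (-1))"
    using combinationD(5)[OF c] by (simp add: sum_negf)
  also have "\<dots> \<le> (\<Sum>g\<in>supp \<beta>. \<beta> g * (?u g - ?u f))"
  proof (rule sum_mono)
    fix g assume "g \<in> supp \<beta>"
    then show "\<beta> g * (-1) \<le> \<beta> g * (?u g - ?u f)"
      using combinationD(1)[OF c, of g] step[of g] by (intro mult_left_mono) auto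
  qed
  also have "\<dots> = ?y - T * ?u f"
    unfolding combination_prefix_sum[OF c] combinationD(5)[OF c, symmetric]
    by (simp add: right_diff_distrib sum_subtractf sum_distrib_right)
  finally have 2: "T * (?u f - 1) \<le> ?y"
    by (simp add: algebra_simps)
  have "?y / T < ?u f + 1" "?u f - 1 \<le> ?y / T"
    using 1 2 T by (simp_all add: field_simps)
  then have "\<lfloor>?y / T\<rfloor> = int (prefix_sum vs f j) \<or> \<lfloor>?y / T\<rfloor> + 1 = int (prefix_sum vs f j)"
    by linarith
  then show ?thesis
    using j by (auto simp: step_set_def)
qed

lemma step_set_inj:
  assumes c: "esd_combination vs r L T \<beta> \<alpha>" "esd_combination vs r L T \<beta>' \<alpha>" and T: "T > 0"
    and f: "f \<in> supp \<beta>" "g \<in> supp \<beta>'" and eq: "step_set vs T \<alpha> f = step_set vs T \<alpha> g"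
  shows "f = g"
proof (rule prefix_sum_eq_imp_eq)
  show "supp f \<subseteq> set vs" "supp g \<subseteq> set vs"
    using combinationD(4)[OF c(1) f(1)] combinationD(4)[OF c(2) f(2)] .
  fix j assume j: "j \<le> length vs"
  have "int (prefix_sum vs f j) = int (prefix_sum vs g j)"
    using combination_cases[OF c(1) T f(1) j] combination_cases[OF c(2) T f(2) j] eq
    by simp
  then show "prefix_sum vs f j = prefix_sum vs g j"
    by simp
qed

text \<open>Writing each prefix sum as the common floor plus 0 or 1 and summing with the weights of
  total T removes the floor: what is left of \<alpha> is the residue, layered by the step sets.
  Comparability under \<open>unit_step\<close> becomes inclusion.\<close>

lemma combination_layering:
  assumes c: "esd_combination vs r L T \<beta> \<alpha>" and T: "T > 0"
  shows "\<exists>\<gamma>. layering (residue vs T \<alpha>) \<gamma> \<and> supp \<gamma> = step_set vs T \<alpha> ` supp \<beta> \<and>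
    (\<forall>f\<in>supp \<beta>. \<gamma> (step_set vs T \<alpha> f) = \<beta> f)"
proof -
  let ?S = "step_set vs T \<alpha>" and ?E = "supp \<beta>"
  have inj: "inj_on ?S ?E"
    using step_set_inj[OF c c T] by (intro inj_onI)
  define \<gamma> where "\<gamma> S = (if S \<in> ?S ` ?E then \<beta> (the_inv_into ?E ?S S) else 0)" for S
  have \<gamma>: "\<gamma> (?S f) = \<beta> f" if "f \<in> ?E" for f
    using that inj by (simp add: \<gamma>_def the_inv_into_f_f)
  have supp: "supp \<gamma> = ?S ` ?E"
  proof
    show "supp \<gamma> \<subseteq> ?S ` ?E"
      by (auto simp: \<gamma>_def supp_iff split: if_splits)
    show "?S ` ?E \<subseteq> supp \<gamma>"
      using \<gamma> by (auto simp: supp_iff)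
  qed
  have "layering (residue vs T \<alpha>) \<gamma>"
    unfolding layering_def
  proof (intro conjI allI ballI)
    show "0 \<le> \<gamma> S" for S
      using combinationD(1)[OF c] by (simp add: \<gamma>_def)
    show "finite (supp \<gamma>)"
      unfolding supp using combinationD(2)[OF c] by simp
    fix S S' assume "S \<in> supp \<gamma>" "S' \<in> supp \<gamma>"
    then obtain f g where fg: "f \<in> ?E" "g \<in> ?E" "S = ?S f" "S' = ?S g"
      unfolding supp by blast
    have mono: "?S g \<subseteq> ?S f" if fg: "f \<in> ?E" "g \<in> ?E" and st: "unit_step vs f g" for f g
    proof
      fix j assume jg: "j \<in> ?S g"
      then have j: "j \<le> length vs"
        by (simp add: step_set_def)
      show "j \<in> ?S f"
      proof (rule ccontr)
        assume jf: "j \<notin> ?S f"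
        have "int (prefix_sum vs f j) + 1 = int (prefix_sum vs g j)"
          using combination_cases[OF c T fg(1) j] combination_cases[OF c T fg(2) j] jg jf
          by simp
        then show False
          using st j unfolding unit_step_iff by fastforce
      qed
    qed
    show "S \<subseteq> S' \<or> S' \<subseteq> S"
      using combinationD(8)[OF c fg(1,2)] mono fg by blast
  next
    fix j
    have sum: "(\<Sum>S\<in>supp \<gamma>. if j \<in> S then \<gamma> S else 0) = (\<Sum>f\<in>?E. if j \<in> ?S f then \<beta> f else 0)"
      unfolding supp using inj \<gamma> by (subst sum.reindex) (auto intro!: sum.cong)
    show "residue vs T \<alpha> j = (\<Sum>S\<in>supp \<gamma>. if j \<in> S then \<gamma> S else 0)"
    proof (cases "j \<le> length vs")
      case True
      let ?b = "real_of_int \<lfloor>prefix_sum vs \<alpha> j / T\<rfloor>"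
      have "prefix_sum vs \<alpha> j = (\<Sum>f\<in>?E. \<beta> f * ?b + (if j \<in> ?S f then \<beta> f else 0))"
        unfolding combination_prefix_sum[OF c, of j]
      proof (rule sum.cong[OF refl])
        fix f assume f: "f \<in> ?E"
        have "real (prefix_sum vs f j) = of_int (int (prefix_sum vs f j))"
          by simp
        also have "\<dots> = ?b + (if j \<in> ?S f then 1 else 0)"
          unfolding combination_cases[OF c T f True] by simp
        finally show "\<beta> f * real (prefix_sum vs f j)
            = \<beta> f * (of_int \<lfloor>(\<Sum>f\<in>?E. \<beta> f * real (prefix_sum vs f j)) / T\<rfloor>) + (if j \<in> ?S f then \<beta> f else 0)"
          unfolding combination_prefix_sum[OF c, of j] by (simp add: algebra_simps)
      qed
      also have "\<dots> = T * ?b + (\<Sum>f\<in>?E. if j \<in> ?S f then \<beta> f else 0)"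
        using combinationD(5)[OF c] by (simp add: sum.distrib sum_distrib_right[symmetric])
      finally show ?thesis
        using True by (simp add: residue_def sum)
    next
      case False
      then have "j \<notin> ?S f" for f
        by (simp add: step_set_def)
      then show ?thesis
        using False by (simp add: residue_def sum)
    qed
  qed
  then show ?thesis
    using supp \<gamma> by blast
qed

lemma combination_unique_step:
  assumes c: "esd_combination vs r L T \<beta> \<alpha>" "esd_combination vs r L T \<beta>' \<alpha>" and T: "T > 0"
    and f: "f \<in> supp \<beta>" and S: "step_set vs T \<alpha> f \<noteq> {}"
  shows "\<beta> f = \<beta>' f"
proof -
  let ?S = "step_set vs T \<alpha>"
  obtain \<gamma> where "layering (residue vs T \<alpha>) \<gamma> \<and> supp \<gamma> = ?S ` supp \<beta> \<and>
      (\<forall>f\<in>supp \<beta>. \<gamma> (?S f) = \<beta> f)"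
    using combination_layering[OF c(1) T] by (rule exE)
  then have \<gamma>: "layering (residue vs T \<alpha>) \<gamma>" "\<gamma> (?S f) = \<beta> f"
    using f by auto
  obtain \<gamma>' where "layering (residue vs T \<alpha>) \<gamma>' \<and> supp \<gamma>' = ?S ` supp \<beta>' \<and>
      (\<forall>f\<in>supp \<beta>'. \<gamma>' (?S f) = \<beta>' f)"
    using combination_layering[OF c(2) T] by (rule exE)
  then have \<gamma>': "layering (residue vs T \<alpha>) \<gamma>'" "supp \<gamma>' = ?S ` supp \<beta>'"
      "\<And>f. f \<in> supp \<beta>' \<Longrightarrow> \<gamma>' (?S f) = \<beta>' f"
    by auto
  have eq: "\<gamma>' (?S f) = \<beta> f"
    using layering_unique[OF \<gamma>(1) \<gamma>'(1) finite_supp_residue S] \<gamma>(2) by simp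
  then have "?S f \<in> supp \<gamma>'"
    using f by (simp add: supp_iff)
  then obtain g where g: "g \<in> supp \<beta>'" "?S f = ?S g"
    using \<gamma>'(2) by auto
  then have "f = g"
    using step_set_inj[OF c T f] by blast
  then show ?thesis
    using \<gamma>'(3)[OF g(1)] eq by simp
qed

text \<open>Layer weights are unique except at the empty set. Step sets determine vertices, so at
  most one vertex has the empty step set, and the total T fixes its weight.\<close>

lemma combination_unique:
  assumes c: "esd_combination vs r L T \<beta> \<alpha>" "esd_combination vs r L T \<beta>' \<alpha>" and T: "T > 0"
  shows "\<beta> = \<beta>'"
proof -
  let ?S = "step_set vs T \<alpha>"
  have ne: "\<beta> f = \<beta>' f" if "f \<in> supp \<beta> \<union> supp \<beta>'" "?S f \<noteq> {}" for f
    using that combination_unique_step[OF c T] combination_unique_step[OF c(2,1) T] by fastforce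
  define U where "U = supp \<beta> \<union> supp \<beta>'"
  have U: "finite U"
    using combinationD(2)[OF c(1)] combinationD(2)[OF c(2)] by (simp add: U_def)
  have inj: "f = g" if "f \<in> U" "g \<in> U" "?S f = ?S g" for f g
    using that step_set_inj[OF c T, of f g] step_set_inj[OF c(2,1) T, of f g]
      step_set_inj[OF c(1,1) T, of f g] step_set_inj[OF c(2,2) T, of f g]
    unfolding U_def by auto
  have "(\<Sum>f\<in>U. \<beta> f) = (\<Sum>f\<in>supp \<beta>. \<beta> f)" "(\<Sum>f\<in>U. \<beta>' f) = (\<Sum>f\<in>supp \<beta>'. \<beta>' f)"
    using U by (auto simp: U_def supp_iff intro!: sum.mono_neutral_right)
  then have tot: "(\<Sum>f\<in>U. \<beta> f) = T" "(\<Sum>f\<in>U. \<beta>' f) = T"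
    using combinationD(5)[OF c(1)] combinationD(5)[OF c(2)] by simp_all
  have "\<beta> f = \<beta>' f" if f: "f \<in> U" for f
  proof (cases "?S f = {}")
    case True
    have "(\<Sum>g\<in>U - {f}. \<beta> g) = (\<Sum>g\<in>U - {f}. \<beta>' g)"
    proof (rule sum.cong[OF refl])
      fix g assume g: "g \<in> U - {f}"
      then have "?S g \<noteq> {}"
        using inj[of f g] f True by auto
      then show "\<beta> g = \<beta>' g"
        using ne g by (simp add: U_def)
    qed
    then show ?thesis
      using sum.remove[OF U f, of \<beta>] sum.remove[OF U f, of \<beta>'] tot by simp
  next
    case False
    then show ?thesis
      using ne f by (simp add: U_def)
  qed
  moreover have "\<beta> f = \<beta>' f" if "f \<notin> U" for f
    using that by (simp add: U_def supp_iff)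
  ultimately show ?thesis
    by blast
qed

text \<open>Inverse construction: layer the residue, and let each member \<open>S\<close> of the
  chain define a vertex by its prefix sums, the floor plus one on \<open>S\<close> and the floor
  elsewhere.\<close>

lemma combination_exists:
  assumes T: "T > 0" and nn: "\<And>v. 0 \<le> \<alpha> v" and sL: "supp \<alpha> \<in> L"
    and total: "(\<Sum>v\<in>supp \<alpha>. \<alpha> v) = real r * T"
  shows "\<exists>\<beta>. esd_combination vs r L T \<beta> \<alpha> \<and> (T \<in> \<int> \<and> (\<forall>v. \<alpha> v \<in> \<int>) \<longrightarrow> (\<forall>f. \<beta> f \<in> \<int>))"
proof -
  define y b \<rho> where "y = prefix_sum vs \<alpha>" and "b j = \<lfloor>y j / T\<rfloor>" and "\<rho> = residue vs T \<alpha>" for j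
  have \<rho>: "\<rho> j = y j - T * b j" if "j \<le> length vs" for j
    using that by (simp add: \<rho>_def residue_def y_def b_def)
  have \<rho>_bd: "0 \<le> \<rho> j" "\<rho> j < T" for j
    using residue_bounds[OF T] by (simp_all add: \<rho>_def)
  obtain \<gamma> where l0: "layering \<rho> \<gamma>" and e0: "\<gamma> {} = 0"
    and int0: "(\<forall>j. \<rho> j \<in> \<int>) \<longrightarrow> (\<forall>S. \<gamma> S \<in> \<int>)"
    using layering_exists[of \<rho>] finite_supp_residue[of vs T \<alpha>] \<rho>_bd by (auto simp: \<rho>_def)
  \<comment> \<open>Residues stay below T, so the layers use up less than T. The positive remainder
    becomes the weight of the vertex with empty step set.\<close>
  define c where "c = T - (\<Sum>S\<in>supp \<gamma>. \<gamma> S)"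
  have c: "c > 0"
    using layering_sum_less[OF l0 e0 T \<rho>_bd(2)] by (simp add: c_def)
  define \<delta> where "\<delta> = \<gamma>({} := c)"
  have "layering (\<lambda>v. \<rho> v + (if v \<in> {} then c else 0)) \<delta>"
    unfolding \<delta>_def using c e0 by (intro layering_add[OF l0]) auto
  then have l: "layering \<rho> \<delta>"
    by simp
  have supp_\<delta>: "supp \<delta> = insert {} (supp \<gamma>)"
    using c by (auto simp: \<delta>_def supp_def)
  have "(\<Sum>S\<in>supp \<gamma>. \<delta> S) = (\<Sum>S\<in>supp \<gamma>. \<gamma> S)"
    using e0 by (intro sum.cong) (auto simp: \<delta>_def supp_iff)
  then have tot: "(\<Sum>S\<in>supp \<delta>. \<delta> S) = T"
    unfolding supp_\<delta> using layeringD(2)[OF l0] e0 by (simp add: supp_iff c_def \<delta>_def)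
  have int: "\<delta> S \<in> \<int>" if "T \<in> \<int>" "\<forall>v. \<alpha> v \<in> \<int>" for S
  proof -
    have "\<rho> j \<in> \<int>" for j
      using that by (auto simp: \<rho>_def residue_def prefix_sum_def intro!: Ints_sum Ints_diff Ints_mult)
    then show ?thesis
      using int0 that by (auto simp: \<delta>_def c_def intro!: Ints_diff Ints_sum)
  qed

  define u where "u S j = b j + (if j \<in> S then 1 else 0)" for S j
  have y_Suc: "y (Suc j) = y j + \<alpha> (vs ! j)" for j
    by (simp add: y_def prefix_sum_Suc)
  have y_nn: "0 \<le> y j" for j
    unfolding y_def prefix_sum_def using nn by (intro sum_nonneg) auto
  have b_mono: "b j \<le> b (Suc j)" for j
    unfolding b_def using y_Suc nn T by (intro floor_mono divide_right_mono) auto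
  have b_nn: "0 \<le> b j" for j
    using y_nn[of j] T by (simp add: b_def)
  have mem_le: "j \<le> length vs" if "S \<in> supp \<delta>" "j \<in> S" for S j
    using layering_subset[OF l that(1)] that(2) by (auto simp: \<rho>_def residue_def supp_iff split: if_splits)
  \<comment> \<open>Coordinates of the vertex must be nonnegative. If the floor does not change, the
    residue does not decrease and the superlevel set \<open>S\<close> retains the next position; if
    the floor rises, this compensates for leaving \<open>S\<close>.\<close>
  have u_mono: "u S j \<le> u S (Suc j)" if S: "S \<in> supp \<delta>" and j: "j < length vs" for S j
  proof (cases "b j = b (Suc j)")
    case True
    then have "\<rho> j \<le> \<rho> (Suc j)"
      using j y_Suc[of j] nn by (simp add: \<rho>)
    then have "j \<in> S \<Longrightarrow> Suc j \<in> S"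
      using layering_upclosed[OF l S] by blast
    then show ?thesis
      using True by (simp add: u_def)
  next
    case False
    then show ?thesis
      using b_mono[of j] by (simp add: u_def)
  qed
  \<comment> \<open>No coordinate may appear where \<alpha> vanishes, so that all vertices stay in
    the face \<open>supp \<alpha>\<close>.\<close>
  have u_eq: "u S j = u S (Suc j)" if S: "S \<in> supp \<delta>" and j: "j < length vs" and a: "\<alpha> (vs ! j) = 0" for S j
  proof -
    have "b j = b (Suc j)"
      using y_Suc[of j] a by (simp add: b_def)
    moreover from this have "\<rho> j = \<rho> (Suc j)"
      using j y_Suc[of j] a by (simp add: \<rho>)
    then have "j \<in> S \<longleftrightarrow> Suc j \<in> S"
      using layering_upclosed[OF l S, of j "Suc j"] layering_upclosed[OF l S, of "Suc j" j] by auto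
    ultimately show ?thesis
      by (simp add: u_def)
  qed
  have u_0: "u S 0 = 0" if "S \<in> supp \<delta>" for S
  proof -
    have "y 0 = 0" "b 0 = 0"
      by (simp_all add: y_def b_def)
    then have "0 \<notin> supp \<rho>"
      by (simp add: supp_iff \<rho>)
    then show ?thesis
      using layering_subset[OF l that] \<open>b 0 = 0\<close> by (auto simp: u_def)
  qed
  have sub: "supp \<alpha> \<subseteq> set vs"
    using sL vertices by blast
  have y_end: "y (length vs) = real r * T"
    using sum_supp_eq_prefix_sum[OF distinct sub] total by (simp add: y_def)
  have u_end: "u S (length vs) = int r" if "S \<in> supp \<delta>" for S
  proof -
    have "b (length vs) = int r"
      using y_end T by (simp add: b_def)
    then have "length vs \<notin> supp \<rho>"
      using y_end by (simp add: supp_iff \<rho>)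
    then show ?thesis
      using layering_subset[OF l that] \<open>b (length vs) = int r\<close> by (auto simp: u_def)
  qed

  define F where "F S v = (\<Sum>k<length vs. if vs ! k = v then nat (u S (Suc k) - u S k) else 0)" for S v
  have F_nth: "F S (vs ! k) = nat (u S (Suc k) - u S k)" if k: "k < length vs" for S k
  proof -
    have "F S (vs ! k) = (\<Sum>k'<length vs. if k' = k then nat (u S (Suc k') - u S k') else 0)"
      unfolding F_def using k distinct by (intro sum.cong) (auto simp: nth_eq_iff_index_eq)
    then show ?thesis
      using k by simp
  qed
  have F_out: "F S v = 0" if "v \<notin> set vs" for S v
    using that unfolding F_def by (intro sum.neutral) auto
  have F_prefix: "int (prefix_sum vs (F S) j) = u S j" if S: "S \<in> supp \<delta>" and j: "j \<le> length vs" for S j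
    using j
  proof (induction j)
    case 0
    then show ?case
      using u_0[OF S] by simp
  next
    case (Suc j)
    then show ?case
      using u_mono[OF S, of j] by (simp add: prefix_sum_Suc F_nth)
  qed
  have F_supp: "supp (F S) \<subseteq> supp \<alpha>" if S: "S \<in> supp \<delta>" for S
  proof
    fix v assume v: "v \<in> supp (F S)"
    then have "v \<in> set vs"
      using F_out[of v S] by (auto simp: supp_iff)
    then obtain k where k: "k < length vs" "v = vs ! k"
      by (metis in_set_conv_nth)
    then show "v \<in> supp \<alpha>"
      using v u_eq[OF S k(1)] by (auto simp: supp_iff F_nth)
  qed
  have F_vertex: "F S \<in> esd_vertices r L" if S: "S \<in> supp \<delta>" for S
  proof -
    have "supp (F S) \<in> L"
      using F_supp[OF S] complexD(4)[OF L sL] by blast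
    moreover have "(\<Sum>v\<in>supp (F S). F S v) = r"
      using sum_supp_eq_prefix_sum[OF distinct, of "F S"] F_supp[OF S] sub F_prefix[OF S, of "length vs"] u_end[OF S]
      by simp
    ultimately show ?thesis
      by (simp add: esd_vertices_def)
  qed
  have F_inj: "inj_on F (supp \<delta>)"
  proof (rule inj_onI)
    fix S S' assume S: "S \<in> supp \<delta>" "S' \<in> supp \<delta>" and eq: "F S = F S'"
    have "j \<in> S \<longleftrightarrow> j \<in> S'" if "j \<le> length vs" for j
      using F_prefix[OF S(1) that] F_prefix[OF S(2) that] eq by (auto simp: u_def split: if_splits)
    then show "S = S'"
      using mem_le S by blast
  qed
  define \<beta> where "\<beta> f = (if f \<in> F ` supp \<delta> then \<delta> (the_inv_into (supp \<delta>) F f) else 0)" for f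
  have \<beta>_F: "\<beta> (F S) = \<delta> S" if "S \<in> supp \<delta>" for S
    using that F_inj by (simp add: \<beta>_def the_inv_into_f_f)
  have supp_\<beta>: "supp \<beta> = F ` supp \<delta>"
  proof
    show "supp \<beta> \<subseteq> F ` supp \<delta>"
      by (auto simp: \<beta>_def supp_iff split: if_splits)
    show "F ` supp \<delta> \<subseteq> supp \<beta>"
      using \<beta>_F by (auto simp: supp_iff)
  qed
  have sum_\<beta>: "(\<Sum>f\<in>supp \<beta>. \<beta> f * h f) = (\<Sum>S\<in>supp \<delta>. \<delta> S * h (F S))" for h :: "('a \<Rightarrow> nat) \<Rightarrow> real"
    unfolding supp_\<beta> using F_inj \<beta>_F by (subst sum.reindex) (auto intro!: sum.cong)
  have step: "unit_step vs (F S) (F S') \<or> unit_step vs (F S') (F S)"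
    if S: "S \<in> supp \<delta>" "S' \<in> supp \<delta>" for S S'
  proof -
    have *: "unit_step vs (F S') (F S)" if "S \<in> supp \<delta>" "S' \<in> supp \<delta>" "S \<subseteq> S'" for S S'
      unfolding unit_step_iff
    proof (intro allI impI)
      fix j assume "j \<le> length vs"
      then have "int (prefix_sum vs (F S) j) = u S j" "int (prefix_sum vs (F S') j) = u S' j"
        using F_prefix that by auto
      moreover have "u S' j = u S j \<or> u S' j = u S j + 1"
        using that(3) by (auto simp: u_def)
      ultimately show "prefix_sum vs (F S') j = prefix_sum vs (F S) j \<or>
          prefix_sum vs (F S') j = prefix_sum vs (F S) j + 1"
        by linarith
    qed
    show ?thesis
      using layeringD(3)[OF l S] * S by blast
  qed
  have sum_u: "(\<Sum>S\<in>supp \<delta>. \<delta> S * real_of_int (u S j)) = y j" if j: "j \<le> length vs" for j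
  proof -
    have "(\<Sum>S\<in>supp \<delta>. \<delta> S * real_of_int (u S j)) = (\<Sum>S\<in>supp \<delta>. \<delta> S * b j + (if j \<in> S then \<delta> S else 0))"
      by (intro sum.cong) (auto simp: u_def algebra_simps)
    also have "\<dots> = T * b j + \<rho> j"
      unfolding sum.distrib sum_distrib_right[symmetric] tot layeringD(4)[OF l, of j] ..
    finally show ?thesis
      using \<rho>[OF j] by simp
  qed
  have "esd_combination vs r L T \<beta> \<alpha>"
    unfolding esd_combination_def
  proof (intro conjI allI)
    show "0 \<le> \<beta> f" for f
      using layeringD(1)[OF l] by (simp add: \<beta>_def)
    have "(\<Union>f\<in>supp \<beta>. supp f) \<subseteq> supp \<alpha>"
      unfolding supp_\<beta> using F_supp by blast
    then have "(\<Union>f\<in>supp \<beta>. supp f) \<in> L"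
      using complexD(4)[OF L sL] by blast
    moreover have "supp \<beta> \<subseteq> esd_vertices r L"
      unfolding supp_\<beta> using F_vertex by blast
    moreover have "\<forall>f\<in>supp \<beta>. \<forall>g\<in>supp \<beta>. unit_step vs f g \<or> unit_step vs g f"
      unfolding supp_\<beta> using step by blast
    ultimately show "supp \<beta> \<in> esd vs r L"
      by (simp add: esd_def)
    show "(\<Sum>f\<in>supp \<beta>. \<beta> f) = T"
      using sum_\<beta>[of "\<lambda>_. 1"] tot by simp
    fix v
    show "\<alpha> v = (\<Sum>f\<in>supp \<beta>. \<beta> f * real (f v))"
    proof (cases "v \<in> set vs")
      case True
      then obtain k where k: "k < length vs" "v = vs ! k"
        by (metis in_set_conv_nth)
      have "(\<Sum>f\<in>supp \<beta>. \<beta> f * real (f v)) = (\<Sum>S\<in>supp \<delta>. \<delta> S * real (F S v))"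
        by (rule sum_\<beta>)
      also have "\<dots> = (\<Sum>S\<in>supp \<delta>. \<delta> S * real_of_int (u S (Suc k)) - \<delta> S * real_of_int (u S k))"
        using u_mono[OF _ k(1)] by (intro sum.cong) (simp_all add: k F_nth of_nat_nat algebra_simps)
      also have "\<dots> = y (Suc k) - y k"
        unfolding sum_subtractf using sum_u k(1) by simp
      finally show ?thesis
        using y_Suc[of k] k(2) by simp
    next
      case False
      then have "\<alpha> v = 0"
        using sub by (auto simp: supp_iff)
      moreover have "(\<Sum>f\<in>supp \<beta>. \<beta> f * real (f v)) = 0"
        using F_out[OF False] by (intro sum.neutral) (auto simp: supp_\<beta>)
      ultimately show ?thesis
        by simp
    qed
  qed
  moreover have "\<beta> f \<in> \<int>" if "T \<in> \<int>" "\<forall>v. \<alpha> v \<in> \<int>" for f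
    using int[OF that] by (simp add: \<beta>_def)
  ultimately show ?thesis
    by blast
qed

lemma combination_affine_extension:
  assumes "\<beta> \<in> realization (esd vs r L)"
  shows "esd_combination vs r L 1 \<beta> (\<lambda>v. real r * scaled_extension r \<beta> v)"
proof -
  have "real r * (\<Sum>f\<in>supp \<beta>. \<beta> f * (real (f v) / real r)) = (\<Sum>f\<in>supp \<beta>. \<beta> f * real (f v))" for v
    unfolding sum_distrib_left using r_pos by (intro sum.cong) auto
  then show ?thesis
    using assms by (simp add: esd_combination_def realization_def affine_extension_def)
qed

lemma bij_betw_esd_realization:
  "bij_betw (scaled_extension r) (realization (esd vs r L)) (realization L)"
  unfolding bij_betw_def
proof (intro conjI inj_onI equalityI subsetI)
  fix \<beta> \<beta>' assume \<beta>: "\<beta> \<in> realization (esd vs r L)" "\<beta>' \<in> realization (esd vs r L)"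
    and eq: "scaled_extension r \<beta> = scaled_extension r \<beta>'"
  show "\<beta> = \<beta>'"
    using combination_unique[OF combination_affine_extension[OF \<beta>(1)], of \<beta>']
      combination_affine_extension[OF \<beta>(2)] eq by simp
next
  fix \<alpha> assume "\<alpha> \<in> scaled_extension r ` realization (esd vs r L)"
  then obtain \<beta> where \<beta>: "\<beta> \<in> realization (esd vs r L)" "\<alpha> = scaled_extension r \<beta>"
    by blast
  then have c: "esd_combination vs r L 1 \<beta> (\<lambda>v. real r * \<alpha> v)"
    using combination_affine_extension[OF \<beta>(1)] by simp
  have supp: "supp (\<lambda>v. real r * \<alpha> v) = supp \<alpha>"
    using r_pos by (simp add: supp_def)
  have "real r * (\<Sum>v\<in>supp \<alpha>. \<alpha> v) = real r * 1"
    using combination_total[OF c] unfolding supp by (simp add: sum_distrib_left)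
  then have "(\<Sum>v\<in>supp \<alpha>. \<alpha> v) = 1"
    using r_pos by simp
  moreover have "0 \<le> \<alpha> v" for v
    using combination_supp(5)[OF c, of v] r_pos by (simp add: zero_le_mult_iff)
  ultimately show "\<alpha> \<in> realization L"
    using combination_supp(2)[OF c] by (simp add: realization_def supp)
next
  fix \<alpha> assume \<alpha>: "\<alpha> \<in> realization L"
  have supp: "supp (\<lambda>v. real r * \<alpha> v) = supp \<alpha>"
    using r_pos by (simp add: supp_def)
  have "\<exists>\<beta>. esd_combination vs r L 1 \<beta> (\<lambda>v. real r * \<alpha> v) \<and>
      ((1::real) \<in> \<int> \<and> (\<forall>v. real r * \<alpha> v \<in> \<int>) \<longrightarrow> (\<forall>f. \<beta> f \<in> \<int>))"
    using \<alpha> r_pos by (intro combination_exists) (simp_all add: realization_def supp flip: sum_distrib_left)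
  then obtain \<beta> where c: "esd_combination vs r L 1 \<beta> (\<lambda>v. real r * \<alpha> v)"
    by blast
  then have \<beta>: "\<beta> \<in> realization (esd vs r L)"
    by (simp add: esd_combination_def realization_def)
  have "real r * \<alpha> v = real r * scaled_extension r \<beta> v" for v
    using combinationD(6)[OF c, of v] combinationD(6)[OF combination_affine_extension[OF \<beta>], of v] by simp
  then have "\<alpha> = scaled_extension r \<beta>"
    using r_pos by (simp add: fun_eq_iff)
  then show "\<alpha> \<in> scaled_extension r ` realization (esd vs r L)"
    using \<beta> by blast
qed

lemma affine_extension_supp:
  assumes "\<beta> \<in> realization (esd vs r L)"
  shows "supp (scaled_extension r \<beta>) = (\<Union>f\<in>supp \<beta>. supp f)"
proof -
  let ?\<alpha> = "scaled_extension r \<beta>"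
  have "supp ?\<alpha> = supp (\<lambda>v. real r * ?\<alpha> v)"
    using r_pos by (auto simp: supp_iff)
  then show ?thesis
    using combination_supp(1)[OF combination_affine_extension[OF assms]] by simp
qed

text \<open>Natural weights of total n on a face combine to a lattice point of total r n, and the
  two preceding results make this bijective. Edgewise subdivision thus only rescales the argument of
  the Hilbert function by r, whatever the order \<open>vs\<close>.\<close>

lemma card_esd_vertices_esd:
  assumes n: "n > 0"
  shows "card (esd_vertices n (esd vs r L)) = card (esd_vertices (r * n) L)"
proof -
  define \<Phi> where "\<Phi> g v = (\<Sum>f\<in>supp g. g f * f v)" for g :: "('a \<Rightarrow> nat) \<Rightarrow> nat" and v
  have comb: "esd_combination vs r L (real n) (\<lambda>f. real (g f)) (\<lambda>v. real (\<Phi> g v))"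
    if "g \<in> esd_vertices n (esd vs r L)" for g
    using that by (auto simp: esd_combination_def esd_vertices_def \<Phi>_def)
  have "bij_betw \<Phi> (esd_vertices n (esd vs r L)) (esd_vertices (r * n) L)"
    unfolding bij_betw_def
  proof (intro conjI inj_onI equalityI subsetI)
    fix g g' assume g: "g \<in> esd_vertices n (esd vs r L)" "g' \<in> esd_vertices n (esd vs r L)" "\<Phi> g = \<Phi> g'"
    then have "(\<lambda>f. real (g f)) = (\<lambda>f. real (g' f))"
      using combination_unique[OF comb[OF g(1)], of "\<lambda>f. real (g' f)"] comb[OF g(2)] n by simp
    then show "g = g'"
      by (simp add: fun_eq_iff)
  next
    fix \<phi> assume "\<phi> \<in> \<Phi> ` esd_vertices n (esd vs r L)"
    then obtain g where g: "g \<in> esd_vertices n (esd vs r L)" "\<phi> = \<Phi> g"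
      by blast
    have "real (\<Sum>v\<in>supp \<phi>. \<phi> v) = real (r * n)"
      using combination_total[OF comb[OF g(1)]] g(2) by simp
    moreover have "supp \<phi> \<in> L"
      using combination_supp(2)[OF comb[OF g(1)]] g(2) by simp
    ultimately show "\<phi> \<in> esd_vertices (r * n) L"
      by (simp only: esd_vertices_def of_nat_eq_iff mem_Collect_eq)
  next
    fix \<phi> assume \<phi>: "\<phi> \<in> esd_vertices (r * n) L"
    have "\<exists>\<beta>. esd_combination vs r L (real n) \<beta> (\<lambda>v. real (\<phi> v)) \<and>
        (real n \<in> \<int> \<and> (\<forall>v. real (\<phi> v) \<in> \<int>) \<longrightarrow> (\<forall>f. \<beta> f \<in> \<int>))"
      using \<phi> n by (intro combination_exists) (simp_all add: esd_vertices_def flip: of_nat_sum)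
    then obtain \<beta> where c: "esd_combination vs r L (real n) \<beta> (\<lambda>v. real (\<phi> v))" and int: "\<And>f. \<beta> f \<in> \<int>"
      by auto
    define g where "g f = nat \<lfloor>\<beta> f\<rfloor>" for f
    have g: "\<beta> f = real (g f)" for f
    proof -
      have "\<beta> f = of_int \<lfloor>\<beta> f\<rfloor>"
        using int[of f] by (auto elim: Ints_cases)
      then show ?thesis
        using combinationD(1)[OF c, of f] by (simp add: g_def)
    qed
    have \<beta>: "\<beta> = (\<lambda>f. real (g f))"
      using g by blast
    have "g \<in> esd_vertices n (esd vs r L)"
      using c unfolding \<beta> by (simp add: esd_combination_def esd_vertices_def flip: of_nat_sum)
    moreover have "\<Phi> g = \<phi>"
    proof
      fix v
      have "real (\<phi> v) = real (\<Phi> g v)"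
        using combinationD(6)[OF c, of v] unfolding \<beta> by (simp add: \<Phi>_def)
      then show "\<Phi> g v = \<phi> v"
        by simp
    qed
    ultimately show "\<phi> \<in> \<Phi> ` esd_vertices n (esd vs r L)"
      by blast
  qed
  then show ?thesis
    by (rule bij_betw_same_card)
qed

end

section \<open>Face numbers and Hilbert functions\<close>

text \<open>With face numbers as coefficients and m the rank this is the h-polynomial; leaving m
  free allows complexes to be compared before their ranks are known to agree.\<close>

definition bernstein_sum :: "nat \<Rightarrow> (nat \<Rightarrow> real) \<Rightarrow> real poly" where
  "bernstein_sum m a = (\<Sum>i\<le>m. smult (a i) ([:0, 1:] ^ i * [:1, -1:] ^ (m - i)))"

lemma poly_bernstein_sum: "poly (bernstein_sum m a) x = (\<Sum>i\<le>m. a i * (x ^ i * (1 - x) ^ (m - i)))"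
  by (simp add: bernstein_sum_def poly_sum)

lemma bernstein_sum_cong: "(\<And>i. i \<le> m \<Longrightarrow> a i = b i) \<Longrightarrow> bernstein_sum m a = bernstein_sum m b"
  unfolding bernstein_sum_def by (intro sum.cong) auto

lemma degree_bernstein_sum: "degree (bernstein_sum m a) \<le> m"
  unfolding bernstein_sum_def
proof (rule degree_sum_le)
  fix i assume "i \<in> {..m}"
  have "degree ([:0, 1::real:] ^ i * [:1, -1:] ^ (m - i))
      \<le> degree ([:0, 1::real:] ^ i) + degree ([:1, -1::real:] ^ (m - i))"
    by (rule degree_mult_le)
  also have "\<dots> \<le> i + (m - i)"
    using degree_power_le[of "[:0, 1::real:]" i] degree_power_le[of "[:1, -1::real:]" "m - i"] by simp
  finally show "degree (smult (a i) ([:0, 1:] ^ i * [:1, -1:] ^ (m - i))) \<le> m"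
    using \<open>i \<in> {..m}\<close> by (intro order.trans[OF degree_smult_le]) simp
qed simp

text \<open>The substitution y = x / (1-x) turns the sum, up to a power of 1+y, into an ordinary
  polynomial in y with the same coefficients.\<close>

lemma bernstein_sum_eq_0:
  assumes "bernstein_sum m a = 0" "i \<le> m"
  shows "a i = 0"
proof -
  define q where "q = (\<Sum>i\<le>m. monom (a i) i)"
  have "poly q y = 0" if "y > 0" for y
  proof -
    define x where "x = y / (1 + y)"
    have x: "y = x * (1 + y)" "1 - x = 1 / (1 + y)"
      using that by (simp_all add: x_def field_simps)
    have "poly q y = (\<Sum>i\<le>m. a i * y ^ i)"
      by (simp add: q_def poly_sum poly_monom)
    also have "\<dots> = (\<Sum>i\<le>m. (1 + y) ^ m * (a i * (x ^ i * (1 - x) ^ (m - i))))"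
    proof (rule sum.cong[OF refl])
      fix i assume "i \<in> {..m}"
      then have "(1 + y) ^ m = (1 + y) ^ i * (1 + y) ^ (m - i)"
        by (simp flip: power_add)
      moreover have "(1 + y) ^ (m - i) * (1 - x) ^ (m - i) = 1"
        using x(2) that by (simp flip: power_mult_distrib)
      moreover have "y ^ i = x ^ i * (1 + y) ^ i"
        using x(1) by (metis power_mult_distrib)
      ultimately show "a i * y ^ i = (1 + y) ^ m * (a i * (x ^ i * (1 - x) ^ (m - i)))"
        by (simp add: mult_ac)
    qed
    also have "\<dots> = (1 + y) ^ m * poly (bernstein_sum m a) x"
      by (simp add: poly_bernstein_sum sum_distrib_left)
    finally show ?thesis
      using assms(1) by simp
  qed
  then have "{0<..} \<subseteq> {y. poly q y = 0}"
    by auto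
  then have "infinite {y. poly q y = 0}"
    using infinite_Ioi finite_subset by blast
  then have "q = 0"
    using poly_roots_finite by blast
  then have "coeff q i = 0"
    by simp
  then show ?thesis
    using assms(2) by (simp add: q_def coeff_sum)
qed

lemma bernstein_sum_diff: "bernstein_sum m a - bernstein_sum m b = bernstein_sum m (\<lambda>i. a i - b i)"
  by (simp add: bernstein_sum_def sum_subtractf smult_diff_left)

lemma bernstein_sum_inject:
  assumes "bernstein_sum m a = bernstein_sum m b" "i \<le> m"
  shows "a i = b i"
  using bernstein_sum_eq_0[of m "\<lambda>i. a i - b i" i] assms bernstein_sum_diff[of m a b] by simp

text \<open>The usual passage from the h-vector back to the f-vector.\<close>

definition bernstein_coeff :: "nat \<Rightarrow> real poly \<Rightarrow> nat \<Rightarrow> real" where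
  "bernstein_coeff m p i = (\<Sum>k\<le>i. coeff p k * real ((m - k) choose (i - k)))"

lemma smult_sum_distrib: "smult c (\<Sum>i\<in>A. f i) = (\<Sum>i\<in>A. smult c (f i))"
  by (induction A rule: infinite_finite_induct) (simp_all add: smult_add_right)

text \<open>Each x^k is multiplied by (x + (1-x))^(m-k) = 1 and expanded.\<close>

lemma bernstein_expansion:
  assumes "degree p \<le> m"
  shows "p = bernstein_sum m (bernstein_coeff m p)"
proof -
  let ?B = "\<lambda>i. [:0, 1:] ^ i * [:1, -1::real:] ^ (m - i)"
  have mono: "[:0, 1:] ^ k = (\<Sum>i\<le>m. smult (if k \<le> i then real ((m - k) choose (i - k)) else 0) (?B i))"
    if k: "k \<le> m" for k
  proof -
    have "[:0, 1::real:] + [:1, -1:] = 1"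
      by (simp add: one_pCons)
    then have "[:0, 1::real:] ^ k = [:0, 1:] ^ k * ([:0, 1:] + [:1, -1:]) ^ (m - k)"
      by (simp only: power_one mult_1_right)
    also have "\<dots> = (\<Sum>l\<le>m - k. smult (real ((m - k) choose l)) (?B (k + l)))"
      unfolding binomial_ring sum_distrib_left
      by (intro sum.cong) (simp_all add: power_add of_nat_poly mult_ac)
    also have "\<dots> = (\<Sum>i=k..m. smult (real ((m - k) choose (i - k))) (?B i))"
      using k by (intro sum.reindex_bij_witness[of _ "\<lambda>i. i - k" "\<lambda>l. k + l"]) auto
    also have "\<dots> = (\<Sum>i\<in>{i \<in> {..m}. k \<le> i}. smult (real ((m - k) choose (i - k))) (?B i))"
      by (intro sum.cong) auto
    also have "\<dots> = (\<Sum>i\<le>m. if k \<le> i then smult (real ((m - k) choose (i - k))) (?B i) else 0)"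
      by (rule sum.inter_filter) simp
    finally show ?thesis
      by (simp add: if_distrib[of "\<lambda>c. smult c _"] cong: if_cong)
  qed
  have "p = (\<Sum>k\<le>m. smult (coeff p k) ([:0, 1:] ^ k))"
    using poly_as_sum_of_monoms'[OF assms] by (simp add: monom_altdef)
  also have "\<dots> = (\<Sum>k\<le>m. \<Sum>i\<le>m. smult (coeff p k * (if k
      \<le> i then real ((m - k) choose (i - k)) else 0)) (?B i))"
    by (intro sum.cong refl) (subst mono; simp add: smult_sum_distrib)
  also have "\<dots> = (\<Sum>i\<le>m. \<Sum>k\<le>m. smult (coeff p k * (if k
      \<le> i then real ((m - k) choose (i - k)) else 0)) (?B i))"
    by (rule sum.swap)
  also have "\<dots> = (\<Sum>i\<le>m. smult (bernstein_coeff m p i) (?B i))"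
  proof (rule sum.cong[OF refl])
    fix i assume i: "i \<in> {..m}"
    have "bernstein_coeff m p i = (\<Sum>k\<in>{k \<in> {..m}. k \<le> i}. coeff p k * real ((m - k) choose (i - k)))"
      unfolding bernstein_coeff_def using i by (intro sum.cong) auto
    also have "\<dots> = (\<Sum>k\<le>m. if k \<le> i then coeff p k * real ((m - k) choose (i - k)) else 0)"
      by (rule sum.inter_filter) simp
    also have "\<dots> = (\<Sum>k\<le>m. coeff p k * (if k \<le> i then real ((m - k) choose (i - k)) else 0))"
      by (intro sum.cong) auto
    finally show "(\<Sum>k\<le>m. smult (coeff p k * (if k \<le> i then real ((m - k) choose (i - k)) else 0)) (?B i))
        = smult (bernstein_coeff m p i) (?B i)"
      by (simp add: smult_sum)
  qed
  finally show ?thesis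
    by (simp add: bernstein_sum_def)
qed

section \<open>Hilbert series as sums over faces\<close>

definition pos_fps :: "real fps" where
  "pos_fps = Abs_fps (\<lambda>n. if n = 0 then 0 else 1)"

lemma pos_fps_mult: "(1 - fps_X) * pos_fps = fps_X"
  by (rule fps_ext) (auto simp: pos_fps_def left_diff_distrib)

definition positive_funs :: "'a set \<Rightarrow> nat \<Rightarrow> ('a \<Rightarrow> nat) set" where
  "positive_funs F n = {f. supp f = F \<and> (\<Sum>v\<in>F. f v) = n}"

lemma finite_positive_funs:
  assumes "finite F"
  shows "finite (positive_funs F n)"
proof (rule finite_subset)
  show "positive_funs F n \<subseteq> fun_space F {..n}"
  proof
    fix f assume f: "f \<in> positive_funs F n"
    then have "f v \<le> n" if "v \<in> F" for v
      using member_le_sum[of v F f] that assms by (auto simp: positive_funs_def)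
    then show "f \<in> fun_space F {..n}"
      using f by (auto simp: fun_space_def positive_funs_def supp_def)
  qed
  show "finite (fun_space F {..n})"
    using assms by (simp add: card_fun_space)
qed

lemma card_positive_funs_insert:
  assumes F: "finite F" "v \<notin> F"
  shows "card (positive_funs (insert v F) n) = (\<Sum>i=1..n. card (positive_funs F (n - i)))"
proof -
  have "bij_betw (\<lambda>(i, f). f(v := i)) (SIGMA i:{1..n}. positive_funs F (n - i)) (positive_funs (insert v F) n)"
  proof (rule bij_betwI[where g = "\<lambda>f. (f v, f(v := 0))"])
    have upd: "(\<Sum>w\<in>F. (f(v := c)) w) = (\<Sum>w\<in>F. f w)" for f :: "'a \<Rightarrow> nat" and c
      using F by (intro sum.cong) auto
    show "(\<lambda>(i, f). f(v := i)) \<in> (SIGMA i:{1..n}. positive_funs F (n - i)) \<rightarrow> positive_funs (insert v F) n"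
      using F upd by (auto simp: positive_funs_def supp_def split: if_splits)
    show "(\<lambda>f. (f v, f(v := 0))) \<in> positive_funs (insert v F) n \<rightarrow> (SIGMA i:{1..n}. positive_funs F (n - i))"
    proof
      fix f assume f: "f \<in> positive_funs (insert v F) n"
      then have supp: "supp f = insert v F" and n: "f v + (\<Sum>w\<in>F. f w) = n"
        using F by (auto simp: positive_funs_def)
      have "supp (f(v := 0)) = F"
        using supp F by (auto simp: supp_def)
      then have "f(v := 0) \<in> positive_funs F (n - f v)"
        using n upd by (simp add: positive_funs_def)
      moreover have "f v \<in> {1..n}"
      proof -
        have "f v \<noteq> 0"
          using supp by (auto simp: supp_def)
        then show ?thesis
          using n by simp
      qed
      ultimately show "(f v, f(v := 0)) \<in> (SIGMA i:{1..n}. positive_funs F (n - i))"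
        by simp
    qed
  next
    fix x assume "x \<in> (SIGMA i:{1..n}. positive_funs F (n - i))"
    then obtain i f where x: "x = (i, f)" "f \<in> positive_funs F (n - i)"
      by blast
    then have "f v = 0"
      using F by (auto simp: positive_funs_def supp_def)
    then show "((case x of (i, f) \<Rightarrow> f(v := i)) v, (case x of (i, f) \<Rightarrow> f(v := i))(v := 0)) = x"
      using x by (simp add: fun_upd_idem)
  qed auto
  then have "card (positive_funs (insert v F) n) = card (SIGMA i:{1..n}. positive_funs F (n - i))"
    by (simp add: bij_betw_same_card)
  also have "\<dots> = (\<Sum>i=1..n. card (positive_funs F (n - i)))"
    using finite_positive_funs[OF F(1)] by (intro card_SigmaI) auto
  finally show ?thesis .
qed

lemma fps_positive_funs:
  assumes "finite F"
  shows "Abs_fps (\<lambda>n. real (card (positive_funs F n))) = pos_fps ^ card F"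
  using assms
proof (induction F rule: finite_induct)
  case empty
  have eq: "positive_funs {} n = (if n = 0 then {\<lambda>_. 0} else {})" for n
    by (auto simp: positive_funs_def supp_def)
  have "real (card (positive_funs {} n)) = (if n = 0 then 1 else 0)" for n
    unfolding eq by simp
  then show ?case
    by (intro fps_ext) (simp only: fps_nth_Abs_fps card.empty power_0 fps_one_nth)
next
  case (insert v F)
  have "Abs_fps (\<lambda>n. real (card (positive_funs (insert v F) n)))
      = pos_fps * Abs_fps (\<lambda>n. real (card (positive_funs F n)))"
  proof (rule fps_ext)
    fix n
    have "(pos_fps * Abs_fps (\<lambda>n. real (card (positive_funs F n)))) $ n
        = (\<Sum>i=0..n. (if i = 0 then 0 else real (card (positive_funs F (n - i)))))"
      by (auto simp: fps_mult_nth pos_fps_def intro!: sum.cong)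
    also have "\<dots> = (\<Sum>i=1..n. real (card (positive_funs F (n - i))))"
      by (intro sum.mono_neutral_cong_right) auto
    finally show "Abs_fps (\<lambda>n. real (card (positive_funs (insert v F) n))) $ n
        = (pos_fps * Abs_fps (\<lambda>n. real (card (positive_funs F n)))) $ n"
      using card_positive_funs_insert[OF insert(1,2), of n] by simp
  qed
  then show ?case
    using insert by simp
qed

text \<open>The Hilbert series of the Stanley-Reisner ring: \<open>esd_vertices n K\<close> is the
  set of exponent vectors of degree n supported on a face.\<close>

definition hilbert_fps :: "'a set set \<Rightarrow> real fps" where
  "hilbert_fps K = Abs_fps (\<lambda>n. real (card (esd_vertices n K)))"

lemma hilbert_fps_eq:
  assumes K: "abstract_complex K" and M: "\<And>F. F \<in> K \<Longrightarrow> card F \<le> M"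
  shows "hilbert_fps K = (\<Sum>i\<le>M. fps_const (real (face_num K i)) * pos_fps ^ i)"
proof -
  have "esd_vertices n K = (\<Union>F\<in>K. positive_funs F n)" for n
    by (auto simp: esd_vertices_def positive_funs_def)
  then have "card (esd_vertices n K) = (\<Sum>F\<in>K. card (positive_funs F n))" for n
    using complexD(1,3)[OF K] finite_positive_funs
    by (simp, intro card_UN_disjoint) (blast, blast, auto simp: positive_funs_def)
  then have "hilbert_fps K = (\<Sum>F\<in>K. Abs_fps (\<lambda>n. real (card (positive_funs F n))))"
    by (auto simp: hilbert_fps_def fps_eq_iff fps_sum_nth)
  also have "\<dots> = (\<Sum>F\<in>K. pos_fps ^ card F)"
    using complexD(3)[OF K] by (intro sum.cong fps_positive_funs) auto
  also have "\<dots> = (\<Sum>i\<le>M. \<Sum>F\<in>{F \<in> K. card F = i}. pos_fps ^ card F)"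
    using complexD(1)[OF K] M by (intro sum.group[symmetric]) auto
  also have "\<dots> = (\<Sum>i\<le>M. fps_const (real (face_num K i)) * pos_fps ^ i)"
    by (intro sum.cong) (auto simp: face_num_def fps_of_nat)
  finally show ?thesis .
qed

lemma fps_of_poly_1_minus_x: "fps_of_poly [:1, -1:] = 1 - (fps_X :: real fps)"
  by (simp add: fps_of_poly_linear')

lemma fps_of_poly_bernstein_sum:
  assumes K: "abstract_complex K" and M: "\<And>F. F \<in> K \<Longrightarrow> card F \<le> M"
  shows "fps_of_poly (bernstein_sum M (\<lambda>i. real (face_num K i))) = (1 - fps_X) ^ M * hilbert_fps K"
proof -
  have "(1 - fps_X) ^ M * pos_fps ^ i = fps_X ^ i * (1 - fps_X) ^ (M - i)" if "i \<le> M" for i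
  proof -
    have "(1 - fps_X) ^ M * pos_fps ^ i = ((1 - fps_X) * pos_fps) ^ i * (1 - fps_X) ^ (M - i)"
      using that by (simp add: power_mult_distrib mult_ac flip: power_add)
    then show ?thesis
      by (simp only: pos_fps_mult)
  qed
  moreover have "hilbert_fps K = (\<Sum>i\<le>M. fps_const (real (face_num K i)) * pos_fps ^ i)"
    by (intro hilbert_fps_eq K M)
  ultimately show ?thesis
    unfolding bernstein_sum_def fps_of_poly_sum
    by (simp only: sum_distrib_left, intro sum.cong)
        (auto simp: fps_of_poly_smult fps_of_poly_mult fps_of_poly_power fps_of_poly_1_minus_x
        mult.left_commute[of _ "fps_const _"])
qed

lemma card_le_cx_rank:
  assumes "abstract_complex K" "F \<in> K"
  shows "card F \<le> cx_rank K"
  using assms(2) complexD(1)[OF assms(1)] by (simp add: cx_rank_def)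

lemma h_poly_eq_bernstein_sum: "h_poly K = bernstein_sum (cx_rank K) (\<lambda>i. real (face_num K i))"
  by (simp add: h_poly_def bernstein_sum_def of_nat_poly mult.assoc)

lemma fps_h_poly:
  assumes K: "abstract_complex K"
  shows "fps_of_poly (h_poly K) = (1 - fps_X) ^ cx_rank K * hilbert_fps K"
  unfolding h_poly_eq_bernstein_sum by (intro fps_of_poly_bernstein_sum[OF K] card_le_cx_rank[OF K])

text \<open>Equality of the ranks is not known beforehand, so both complexes are expanded in one
  Bernstein basis large enough for both, where coefficients are unique.\<close>

lemma face_num_of_hilbert_fps:
  assumes "abstract_complex K" "abstract_complex K'" "hilbert_fps K = hilbert_fps K'"
  shows "face_num K i = face_num K' i"
proof -
  define M where "M = max i (max (cx_rank K) (cx_rank K'))"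
  have le: "card F \<le> M" if "F \<in> K" for F
    using card_le_cx_rank[OF assms(1) that] by (simp add: M_def)
  have le': "card F \<le> M" if "F \<in> K'" for F
    using card_le_cx_rank[OF assms(2) that] by (simp add: M_def)
  have "fps_of_poly (bernstein_sum M (\<lambda>i. real (face_num K i)))
      = fps_of_poly (bernstein_sum M (\<lambda>i. real (face_num K' i)))"
    using fps_of_poly_bernstein_sum[OF assms(1) le] fps_of_poly_bernstein_sum[OF assms(2) le'] assms(3)
    by simp
  then have "real (face_num K i) = real (face_num K' i)"
    unfolding fps_of_poly_eq_iff by (rule bernstein_sum_inject) (simp add: M_def)
  then show ?thesis
    by simp
qed

text \<open>Reads dimension bounds off the generating function, without geometry. At x = 1 only the
  last Bernstein term survives, which gives the number of top faces.\<close>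

lemma face_num_top_of_hilbert_fps:
  assumes K: "abstract_complex K" and P: "(1 - fps_X) ^ j * hilbert_fps K = fps_of_poly P" "degree P \<le> j"
  shows "j < i \<Longrightarrow> face_num K i = 0" and "real (face_num K j) = poly P 1"
proof -
  define a where "a i = (if i \<le> j then bernstein_coeff j P i else 0)" for i
  have *: "real (face_num K i) = a i" for i
  proof -
    define M where "M = max (max i j) (cx_rank K)"
    have le: "card F \<le> M" if "F \<in> K" for F
      using card_le_cx_rank[OF K that] by (simp add: M_def)
    have jM: "j \<le> M"
      by (simp add: M_def)
    have "fps_of_poly (bernstein_sum M (\<lambda>i. real (face_num K i)))
        = (1 - fps_X) ^ (M - j) * ((1 - fps_X) ^ j * hilbert_fps K)"
      using fps_of_poly_bernstein_sum[OF K le] jM by (simp flip: mult.assoc power_add)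
    also have "\<dots> = fps_of_poly ([:1, -1:] ^ (M - j) * P)"
      by (simp add: P fps_of_poly_mult fps_of_poly_power fps_of_poly_1_minus_x)
    finally have "bernstein_sum M (\<lambda>i. real (face_num K i)) = [:1, -1:] ^ (M - j) * P"
      by (simp only: fps_of_poly_eq_iff)
    also have "\<dots> = [:1, -1:] ^ (M - j) * bernstein_sum j (bernstein_coeff j P)"
      using bernstein_expansion[OF P(2)] by simp
    also have "\<dots> = (\<Sum>i\<le>j. smult (a i) ([:0, 1:] ^ i * [:1, -1:] ^ (M - i)))"
      unfolding bernstein_sum_def sum_distrib_left
    proof (rule sum.cong[OF refl])
      fix i assume "i \<in> {..j}"
      then have "M - i = (M - j) + (j - i)"
        using jM by simp
      then show "[:1, -1:] ^ (M - j) * smult (bernstein_coeff j P i) ([:0, 1:] ^ i * [:1, -1:] ^ (j - i)) =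
          smult (a i) ([:0, 1:] ^ i * [:1, -1:] ^ (M - i))"
        using \<open>i \<in> {..j}\<close> unfolding \<open>M - i = (M - j) + (j - i)\<close> power_add
        by (simp add: a_def mult_ac del: diff_add_assoc2)
    qed
    also have "\<dots> = bernstein_sum M a"
      unfolding bernstein_sum_def using jM by (intro sum.mono_neutral_left) (auto simp: a_def)
    finally show ?thesis
      by (rule bernstein_sum_inject) (simp add: M_def)
  qed
  show "j < i \<Longrightarrow> face_num K i = 0"
    using *[of i] by (simp add: a_def)
  have "poly P 1 = poly (bernstein_sum j (bernstein_coeff j P)) 1"
    using bernstein_expansion[OF P(2)] by simp
  also have "\<dots> = (\<Sum>i\<le>j. if i = j then bernstein_coeff j P i else 0)"
    unfolding poly_bernstein_sum by (intro sum.cong) (auto simp: power_0_left)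
  also have "\<dots> = bernstein_coeff j P j"
    by simp
  finally show "real (face_num K j) = poly P 1"
    using *[of j] by (simp add: a_def)
qed

section \<open>Uniform triangulations\<close>

definition carrier_face :: "('b \<Rightarrow> 'a \<Rightarrow> real) \<Rightarrow> 'b set \<Rightarrow> 'a set" where
  "carrier_face p G = (\<Union>v\<in>G. supp (p v))"

text \<open>The number of faces with \<open>i\<close> vertices in the interior of a face with \<open>s\<close> vertices.\<close>

fun interior_num :: "(nat \<Rightarrow> nat \<Rightarrow> nat) \<Rightarrow> nat \<Rightarrow> nat \<Rightarrow> real" where
  "interior_num F i s = real (F i s) - (\<Sum>t<s. real (s choose t) * interior_num F i t)"

declare interior_num.simps [simp del]

lemma uniform_triangulationD:
  assumes "uniform_triangulation F p K' K"
  shows "abstract_complex K'" "abstract_complex K" "G \<in> K' \<Longrightarrow> carrier_face p G \<in> K"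
    "S \<in> K \<Longrightarrow> face_num (restriction p K' S) i = F i (card S)"
proof -
  show 1: "abstract_complex K'" "abstract_complex K"
    and "S \<in> K \<Longrightarrow> face_num (restriction p K' S) i = F i (card S)"
    using assms by (auto simp: uniform_triangulation_def geom_triangulation_def)
  assume "G \<in> K'"
  then obtain F where "F \<in> K" "carrier_face p G \<subseteq> F"
    using assms by (fastforce simp: uniform_triangulation_def geom_triangulation_def carrier_face_def)
  then show "carrier_face p G \<in> K"
    using complexD(4)[OF 1(2)] by blast
qed

lemma restriction_conv_carrier: "restriction p K' S = {G \<in> K'. carrier_face p G \<subseteq> S}"
  by (auto simp: restriction_def carrier_face_def)

text \<open>The faces inside \<open>S\<close> are sorted by carrier. By induction the proper subsets
  contribute according to their size only, so what remains for \<open>S\<close> itself depends only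
  on its size.\<close>

lemma card_interior_faces:
  assumes u: "uniform_triangulation F p K' K" and S: "S \<in> K"
  shows "real (card {G \<in> K'. card G = i \<and> carrier_face p G = S}) = interior_num F i (card S)"
  using S
proof (induction "card S" arbitrary: S rule: less_induct)
  case less
  let ?N = "\<lambda>T. card {G \<in> K'. card G = i \<and> carrier_face p G = T}"
  have finK: "finite K'"
    using complexD(1)[OF uniform_triangulationD(1)[OF u]] .
  have finS: "finite S"
    using complexD(3)[OF uniform_triangulationD(2)[OF u] less.prems] .
  have "{G \<in> restriction p K' S. card G = i} = (\<Union>T\<in>Pow S. {G \<in> K'. card G = i \<and> carrier_face p G = T})"
    unfolding restriction_conv_carrier by auto
  then have "face_num (restriction p K' S) i = (\<Sum>T\<in>Pow S. ?N T)"
    unfolding face_num_def using finK finS by (simp, intro card_UN_disjoint) auto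
  also have "\<dots> = ?N S + (\<Sum>T\<in>Pow S - {S}. ?N T)"
    using finS by (intro sum.remove) auto
  finally have "real (F i (card S)) = real (?N S) + (\<Sum>T\<in>Pow S - {S}. real (?N T))"
    using uniform_triangulationD(4)[OF u less.prems, of i] by simp
  also have "(\<Sum>T\<in>Pow S - {S}. real (?N T)) = (\<Sum>T\<in>Pow S - {S}. interior_num F i (card T))"
  proof (rule sum.cong[OF refl])
    fix T assume T: "T \<in> Pow S - {S}"
    then have "card T < card S"
      using finS by (intro psubset_card_mono) auto
    moreover have "T \<in> K"
      using T complexD(4)[OF uniform_triangulationD(2)[OF u] less.prems] by blast
    ultimately show "real (?N T) = interior_num F i (card T)"
      by (rule less.hyps)
  qed
  also have "\<dots> = (\<Sum>t<card S. \<Sum>T\<in>{T \<in> Pow S - {S}. card T = t}. interior_num F i (card T))"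
    using finS by (intro sum.group[symmetric]) (auto intro: psubset_card_mono)
  also have "\<dots> = (\<Sum>t<card S. real (card S choose t) * interior_num F i t)"
  proof (rule sum.cong[OF refl])
    fix t assume "t \<in> {..<card S}"
    then have "{T \<in> Pow S - {S}. card T = t} = {T. T \<subseteq> S \<and> card T = t}"
      by auto
    then show "(\<Sum>T\<in>{T \<in> Pow S - {S}. card T = t}. interior_num F i (card T))
        = real (card S choose t) * interior_num F i t"
      using n_subsets[OF finS, of t] by simp
  qed
  finally show ?case
    using interior_num.simps[of F i "card S"] by simp
qed

text \<open>Every face of the triangulation is interior to exactly one face, its carrier. The
  f-vector thus transforms linearly with coefficients from \<open>F\<close> alone, which is why an
  operator exists.\<close>

lemma face_num_uniform_triangulation:
  assumes u: "uniform_triangulation F p K' K" and M: "\<And>S. S \<in> K \<Longrightarrow> card S \<le> M"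
  shows "real (face_num K' i) = (\<Sum>j\<le>M. interior_num F i j * real (face_num K j))"
proof -
  let ?N = "\<lambda>T. card {G \<in> K'. card G = i \<and> carrier_face p G = T}"
  have finK': "finite K'" and finK: "finite K"
    using complexD(1) uniform_triangulationD(1,2)[OF u] by blast+
  have "{G \<in> K'. card G = i} = (\<Union>T\<in>K. {G \<in> K'. card G = i \<and> carrier_face p G = T})"
    using uniform_triangulationD(3)[OF u] by auto
  then have "face_num K' i = (\<Sum>T\<in>K. ?N T)"
    unfolding face_num_def using finK finK' by (simp, intro card_UN_disjoint) auto
  then have "real (face_num K' i) = (\<Sum>T\<in>K. interior_num F i (card T))"
    using card_interior_faces[OF u] by simp
  also have "\<dots> = (\<Sum>j\<le>M. \<Sum>T\<in>{T \<in> K. card T = j}. interior_num F i (card T))"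
    using finK M by (intro sum.group[symmetric]) auto
  also have "\<dots> = (\<Sum>j\<le>M. interior_num F i j * real (face_num K j))"
    by (intro sum.cong) (auto simp: face_num_def)
  finally show ?thesis .
qed

text \<open>An h-polynomial involves the rank of its complex. These two conditions make uniform
  triangulations preserve the rank, a combinatorial replacement for invariance of dimension.\<close>

definition top_supported :: "(nat \<Rightarrow> nat \<Rightarrow> nat) \<Rightarrow> bool" where
  "top_supported F \<longleftrightarrow> (\<forall>i j. j < i \<longrightarrow> F i j = 0) \<and> (\<forall>j. 0 < F j j)"

lemma cx_rank_uniform_triangulation:
  assumes u: "uniform_triangulation F p K' K" and F: "top_supported F"
  shows "cx_rank K' = cx_rank K"
proof -
  have K: "abstract_complex K" "finite K" "K \<noteq> {}" and K': "abstract_complex K'" "finite K'"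
    using complexD(1,2) uniform_triangulationD(1,2)[OF u] by blast+
  have le: "card G \<le> cx_rank K" if G: "G \<in> K'" for G
  proof -
    let ?S = "carrier_face p G"
    have S: "?S \<in> K"
      using uniform_triangulationD(3)[OF u G] .
    have "G \<in> {H \<in> restriction p K' ?S. card H = card G}"
      using G by (simp add: restriction_conv_carrier)
    moreover have "finite {H \<in> restriction p K' ?S. card H = card G}"
      using K' by (simp add: restriction_conv_carrier)
    ultimately have "face_num (restriction p K' ?S) (card G) \<noteq> 0"
      unfolding face_num_def by (metis card_0_eq empty_iff)
    then have "card G \<le> card ?S"
      using uniform_triangulationD(4)[OF u S, of "card G"] F unfolding top_supported_def
      by (metis not_le)
    then show ?thesis
      using card_le_cx_rank[OF K(1) S] by linarith
  qed
  have "cx_rank K \<in> card ` K"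
    unfolding cx_rank_def using K by (intro Max_in) auto
  then obtain S where S: "S \<in> K" "card S = cx_rank K"
    by auto
  then have "0 < face_num (restriction p K' S) (cx_rank K)"
    using uniform_triangulationD(4)[OF u S(1), of "cx_rank K"] F by (simp add: top_supported_def)
  then have "{H \<in> restriction p K' S. card H = cx_rank K} \<noteq> {}"
    unfolding face_num_def by (metis card.empty less_irrefl)
  then obtain G where "G \<in> K'" "card G = cx_rank K"
    by (auto simp: restriction_def)
  then show ?thesis
    unfolding cx_rank_def[of K'] using le K' by (intro Max_eqI) (auto intro: rev_image_eqI)
qed

text \<open>A witness for the choice behind \<open>h_operator\<close>: pass from h-vector to
  f-vector, apply the interior numbers, and return.\<close>

definition f_operator :: "(nat \<Rightarrow> nat \<Rightarrow> nat) \<Rightarrow> nat \<Rightarrow> real poly \<Rightarrow> real poly" where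
  "f_operator F m p = bernstein_sum m (\<lambda>i. \<Sum>j\<le>m. interior_num F i j * bernstein_coeff m p j)"

lemma bernstein_coeff_add: "bernstein_coeff m (p + q) i = bernstein_coeff m p i + bernstein_coeff m q i"
  by (simp add: bernstein_coeff_def algebra_simps sum.distrib)

lemma bernstein_coeff_smult: "bernstein_coeff m (smult c p) i = c * bernstein_coeff m p i"
  by (simp add: bernstein_coeff_def sum_distrib_left mult_ac)

lemma bernstein_coeff_bernstein_sum:
  assumes "i \<le> m"
  shows "bernstein_coeff m (bernstein_sum m a) i = a i"
  by (rule bernstein_sum_inject[OF _ assms, symmetric]) (rule bernstein_expansion[OF degree_bernstein_sum])

lemma bernstein_sum_add: "bernstein_sum m a + bernstein_sum m b = bernstein_sum m (\<lambda>i. a i + b i)"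
  by (simp add: bernstein_sum_def sum.distrib smult_add_left)

lemma bernstein_sum_smult: "smult c (bernstein_sum m a) = bernstein_sum m (\<lambda>i. c * a i)"
  by (simp add: bernstein_sum_def smult_sum_distrib)

lemma is_h_operator_f_operator:
  assumes F: "top_supported F"
  shows "is_h_operator F m (f_operator F m)"
  unfolding is_h_operator_def
proof (intro conjI allI impI)
  show "degree (f_operator F m p) \<le> m" for p
    unfolding f_operator_def by (rule degree_bernstein_sum)
  show "f_operator F m (p + q) = f_operator F m p + f_operator F m q" for p q
    unfolding f_operator_def bernstein_sum_add bernstein_coeff_add by (simp add: distrib_left sum.distrib)
  show "f_operator F m (smult c p) = smult c (f_operator F m p)" for c p
    unfolding f_operator_def bernstein_sum_smult bernstein_coeff_smult
    by (simp add: sum_distrib_left mult.left_commute)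
  fix K K' :: "nat set set" and p
  assume "cx_rank K = m \<and> uniform_triangulation F p K' K"
  then have m: "cx_rank K = m" and u: "uniform_triangulation F p K' K"
    by auto
  have "real (face_num K' i) = (\<Sum>j\<le>m. interior_num F i j * bernstein_coeff m (h_poly K) j)" for i
  proof -
    have "real (face_num K' i) = (\<Sum>j\<le>m. interior_num F i j * real (face_num K j))"
      using card_le_cx_rank[OF uniform_triangulationD(2)[OF u]] m
      by (intro face_num_uniform_triangulation[OF u]) auto
    also have "\<dots> = (\<Sum>j\<le>m. interior_num F i j * bernstein_coeff m (h_poly K) j)"
      unfolding h_poly_eq_bernstein_sum m by (intro sum.cong) (auto simp: bernstein_coeff_bernstein_sum)
    finally show ?thesis .
  qed
  then show "h_poly K' = f_operator F m (h_poly K)"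
    unfolding h_poly_eq_bernstein_sum[of K'] f_operator_def cx_rank_uniform_triangulation[OF u F] m
    by (intro bernstein_sum_cong) auto
qed

text \<open>Any admissible choice of operator gives the same result: it is linear up to degree m and
  sends the h-polynomial of \<open>K\<close> to that of \<open>K'\<close>, and
  \<open>h_uniform\<close> merely evaluates it through monomials.\<close>

lemma h_uniform_eq_h_poly_nat:
  fixes K K' :: "nat set set"
  assumes u: "uniform_triangulation F p K' K" and F: "top_supported F"
  shows "h_uniform F K = h_poly K'"
proof -
  define m where "m = cx_rank K"
  define D where "D = h_operator F m"
  have D: "is_h_operator F m D"
    unfolding D_def h_operator_def
    using is_h_operator_f_operator[OF F, of m] by (rule someI[where P = "is_h_operator F m"])
  then have add: "\<And>p q. degree p \<le> m \<Longrightarrow> degree q \<le> m \<Longrightarrow> D (p + q) = D p + D q"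
    and smult: "\<And>c p. degree p \<le> m \<Longrightarrow> D (smult c p) = smult c (D p)"
    by (auto simp: is_h_operator_def)
  have "\<forall>(K :: nat set set) (K' :: nat set set) p. cx_rank K = m \<and> uniform_triangulation F p K' K \<longrightarrow>
      h_poly K' = D (h_poly K)"
    using D unfolding is_h_operator_def by (elim conjE)
  then have tri: "h_poly K' = D (h_poly K)"
    using u m_def by metis
  have deg: "degree (\<Sum>k\<le>n. monom (coeff (h_poly K) k) k) \<le> m" if "n \<le> m" for n
    using that by (intro degree_sum_le) (auto intro: order.trans[OF degree_monom_le])
  have "D (\<Sum>k\<le>n. monom (coeff (h_poly K) k) k) = (\<Sum>k\<le>n. smult (coeff (h_poly K) k) (D (monom 1 k)))"
    if "n \<le> m" for n
    using that
  proof (induction n)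
    case 0
    have "D (smult (coeff (h_poly K) 0) (monom 1 0)) = smult (coeff (h_poly K) 0) (D (monom 1 0))"
      by (rule smult) simp
    then show ?case
      by (simp add: smult_monom monom_0)
  next
    case (Suc n)
    have mono: "degree (monom 1 (Suc n) :: real poly) \<le> m"
      using Suc.prems by (intro order.trans[OF degree_monom_le])
    have "D (monom (coeff (h_poly K) (Suc n)) (Suc n))
        = D (smult (coeff (h_poly K) (Suc n)) (monom 1 (Suc n)))"
      by (simp add: smult_monom)
    also have "\<dots> = smult (coeff (h_poly K) (Suc n)) (D (monom 1 (Suc n)))"
      by (rule smult[OF mono])
    finally show ?case
      using Suc add[OF deg[of n] order.trans[OF degree_monom_le Suc.prems], of "coeff (h_poly K) (Suc n)"]
      by simp
  qed
  from this[of m] have "D (\<Sum>k\<le>m. monom (coeff (h_poly K) k) k) = h_uniform F K"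
    by (simp add: h_uniform_def D_def m_def)
  moreover have "degree (h_poly K) \<le> m"
    unfolding h_poly_eq_bernstein_sum m_def by (rule degree_bernstein_sum)
  then have "(\<Sum>k\<le>m. monom (coeff (h_poly K) k) k) = h_poly K"
    by (rule poly_as_sum_of_monoms')
  ultimately show ?thesis
    using tri by simp
qed

text \<open>\<open>is_h_operator\<close> speaks only of triangulations with natural numbers as
  vertices, whereas the vertices of the colored subdivision are functions. An injection on the
  finite vertex set transports everything.\<close>

lemma uniform_triangulation_relabel:
  fixes K' :: "'b set set" and K :: "'a set set"
  assumes u: "uniform_triangulation F p K' K"
  shows "\<exists>q (K'' :: nat set set). uniform_triangulation F q K'' K \<and> (\<forall>i. face_num K'' i = face_num K' i)"
proof -
  define V where "V = \<Union>K'"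
  have K': "abstract_complex K'" and K: "abstract_complex K"
    using uniform_triangulationD(1,2)[OF u] .
  have "finite V"
    unfolding V_def using complexD(1,3)[OF K'] by auto
  then obtain \<phi> :: "'b \<Rightarrow> nat" where \<phi>: "inj_on \<phi> V"
    using finite_imp_inj_to_nat_seg by blast
  define \<psi> where "\<psi> = the_inv_into V \<phi>"
  have \<psi>: "\<psi> (\<phi> v) = v" if "v \<in> V" for v
    using that \<phi> by (simp add: \<psi>_def the_inv_into_f_f)
  define q where "q w = p (\<psi> w)" for w
  define K'' where "K'' = (`) \<phi> ` K'"
  have sub: "G \<subseteq> V" if "G \<in> K'" for G
    using that by (auto simp: V_def)
  have inj: "inj_on \<phi> G" if "G \<in> K'" for G
    using inj_on_subset[OF \<phi> sub[OF that]] .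
  have inj2: "inj_on ((`) \<phi>) K'"
    using inj_on_image_eq_iff[OF \<phi>] sub by (intro inj_onI) auto
  have \<psi>_im: "\<psi> ` \<phi> ` G = G" if "G \<in> K'" for G
    using \<psi> sub[OF that] by (force simp: image_image)
  have "abstract_complex K''"
    unfolding abstract_complex_def
  proof (intro conjI ballI allI impI)
    show "finite K''" "{} \<in> K''"
      using complexD(1,2)[OF K'] by (auto simp: K''_def)
    show "finite H" if "H \<in> K''" for H
      using that complexD(3)[OF K'] by (auto simp: K''_def)
    fix H H' assume "H \<in> K''" and H': "H' \<subseteq> H"
    then obtain G where G: "G \<in> K'" "H = \<phi> ` G"
      by (auto simp: K''_def)
    then obtain G' where "G' \<subseteq> G" "H' = \<phi> ` G'"
      using H' by (meson subset_imageE)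
    then show "H' \<in> K''"
      using complexD(4)[OF K' G(1)] by (auto simp: K''_def)
  qed
  moreover have "\<forall>H\<in>K''. \<exists>S\<in>K. \<forall>w\<in>H. q w \<in> realization K \<and> supp (q w) \<subseteq> S"
  proof
    fix H assume "H \<in> K''"
    then obtain G where G: "G \<in> K'" "H = \<phi> ` G"
      by (auto simp: K''_def)
    then obtain S where "S \<in> K" "\<forall>v\<in>G. p v \<in> realization K \<and> supp (p v) \<subseteq> S"
      using u by (auto simp: uniform_triangulation_def geom_triangulation_def)
    then show "\<exists>S\<in>K. \<forall>w\<in>H. q w \<in> realization K \<and> supp (q w) \<subseteq> S"
      using G \<psi> sub[OF G(1)] by (intro bexI[of _ S]) (auto simp: q_def subset_iff)
  qed
  moreover have "bij_betw (affine_extension q) (realization K'') (realization K)"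
  proof -
    \<comment> \<open>\<open>R\<close> pulls weights back along the relabelling and
      \<open>R'\<close> pushes them forward; both are 0 off the vertex set, which makes them
      mutually inverse on the realizations.\<close>
    define R where "R \<beta> v = (if v \<in> V then \<beta> (\<phi> v) else 0)" for \<beta> :: "nat \<Rightarrow> real" and v
    define R' where "R' \<beta> w = (if w \<in> \<phi> ` V then \<beta> (\<psi> w) else 0)" for \<beta> :: "'b \<Rightarrow> real" and w
    have suppR: "supp \<beta> = \<phi> ` supp (R \<beta>) \<and> supp (R \<beta>) \<in> K'"
      if \<beta>: "\<beta> \<in> realization K''" for \<beta>
    proof -
      obtain G where G: "G \<in> K'" "supp \<beta> = \<phi> ` G"
        using \<beta> by (auto simp: realization_def K''_def)
      have "supp (R \<beta>) = G"
      proof (rule set_eqI)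
        fix v
        have "v \<in> supp (R \<beta>) \<longleftrightarrow> v \<in> V \<and> \<phi> v \<in> \<phi> ` G"
          using G(2) by (auto simp: R_def supp_def set_eq_iff)
        also have "\<dots> \<longleftrightarrow> v \<in> G"
          using sub[OF G(1)] inj_on_image_mem_iff[OF \<phi>, of v G] by blast
        finally show "v \<in> supp (R \<beta>) \<longleftrightarrow> v \<in> G" .
      qed
      then show ?thesis
        using G by simp
    qed
    have suppR': "supp (R' \<beta>) = \<phi> ` supp \<beta>" if "supp \<beta> \<in> K'" for \<beta>
    proof (rule set_eqI)
      fix w
      show "w \<in> supp (R' \<beta>) \<longleftrightarrow> w \<in> \<phi> ` supp \<beta>"
      proof
        assume "w \<in> supp (R' \<beta>)"
        then have "w \<in> \<phi> ` V" "\<beta> (\<psi> w) \<noteq> 0"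
          by (auto simp: R'_def supp_iff split: if_splits)
        then show "w \<in> \<phi> ` supp \<beta>"
          using \<psi> by (auto simp: supp_iff)
      next
        assume "w \<in> \<phi> ` supp \<beta>"
        then obtain v where v: "v \<in> supp \<beta>" "w = \<phi> v"
          by blast
        then have "v \<in> V"
          using sub[OF that] by blast
        then show "w \<in> supp (R' \<beta>)"
          using v \<psi> by (simp add: R'_def supp_iff)
      qed
    qed
    have R'_\<phi>: "R' \<beta> (\<phi> v) = \<beta> v" if "v \<in> V" for \<beta> v
      using that \<psi> by (simp add: R'_def)
    have sum: "(\<Sum>w\<in>\<phi> ` G. h w) = (\<Sum>v\<in>G. h (\<phi> v))" if "G \<in> K'" for G and h :: "nat \<Rightarrow> real"
      using inj[OF that] by (simp add: sum.reindex)
    have bijR: "bij_betw R (realization K'') (realization K')"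
    proof (rule bij_betwI[where g = R'])
      show "R \<in> realization K'' \<rightarrow> realization K'"
      proof
        fix \<beta> assume \<beta>: "\<beta> \<in> realization K''"
        have "(\<Sum>v\<in>supp (R \<beta>). R \<beta> v) = (\<Sum>v\<in>supp (R \<beta>). \<beta> (\<phi> v))"
          using sub[OF conjunct2[OF suppR[OF \<beta>]]] by (intro sum.cong) (auto simp: R_def)
        also have "\<dots> = (\<Sum>w\<in>supp \<beta>. \<beta> w)"
          using suppR[OF \<beta>] sum[of "supp (R \<beta>)" \<beta>] by simp
        finally show "R \<beta> \<in> realization K'"
          using \<beta> suppR[OF \<beta>] by (simp add: realization_def R_def[of \<beta>])
      qed
      show "R' \<in> realization K' \<rightarrow> realization K''"
      proof
        fix \<beta> assume \<beta>: "\<beta> \<in> realization K'"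
        then have G: "supp \<beta> \<in> K'"
          by (simp add: realization_def)
        have "(\<Sum>w\<in>supp (R' \<beta>). R' \<beta> w) = (\<Sum>v\<in>supp \<beta>. R' \<beta> (\<phi> v))"
          unfolding suppR'[OF G] by (rule sum[OF G])
        also have "\<dots> = (\<Sum>v\<in>supp \<beta>. \<beta> v)"
          using sub[OF G] R'_\<phi> by (intro sum.cong) auto
        finally show "R' \<beta> \<in> realization K''"
          using \<beta> G suppR'[OF G] by (auto simp: realization_def R'_def K''_def)
      qed
      show "R' (R \<beta>) = \<beta>" if "\<beta> \<in> realization K''" for \<beta>
      proof
        fix w
        show "R' (R \<beta>) w = \<beta> w"
        proof (cases "w \<in> \<phi> ` V")
          case True
          then obtain v where v: "v \<in> V" "w = \<phi> v"
            by blast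
          then show ?thesis
            using R'_\<phi>[OF v(1)] by (simp add: R_def)
        next
          case False
          then have "w \<notin> supp \<beta>"
            using suppR[OF that] sub by blast
          then show ?thesis
            using False by (simp add: R'_def supp_iff)
        qed
      qed
      show "R (R' \<beta>) = \<beta>" if "\<beta> \<in> realization K'" for \<beta>
      proof
        fix v
        show "R (R' \<beta>) v = \<beta> v"
        proof (cases "v \<in> V")
          case True
          then show ?thesis
            using R'_\<phi> by (simp add: R_def)
        next
          case False
          then have "v \<notin> supp \<beta>"
            using that sub by (auto simp: realization_def)
          then show ?thesis
            using False by (simp add: R_def supp_iff)
        qed
      qed
    qed
    have "bij_betw (affine_extension p \<circ> R) (realization K'') (realization K)"
      using u
      by (intro bij_betw_trans[OF bijR]) (simp add: uniform_triangulation_def geom_triangulation_def)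
    moreover have "(affine_extension p \<circ> R) \<beta> = affine_extension q \<beta>" if \<beta>: "\<beta> \<in> realization K''" for \<beta>
    proof
      fix a
      have G: "supp (R \<beta>) \<in> K'"
        using suppR[OF \<beta>] by simp
      have "affine_extension q \<beta> a = (\<Sum>w\<in>\<phi> ` supp (R \<beta>). \<beta> w * q w a)"
        using suppR[OF \<beta>] by (simp add: affine_extension_def)
      also have "\<dots> = (\<Sum>v\<in>supp (R \<beta>). \<beta> (\<phi> v) * q (\<phi> v) a)"
        by (rule sum[OF G])
      also have "\<dots> = (\<Sum>v\<in>supp (R \<beta>). R \<beta> v * p v a)"
        using sub[OF G] \<psi> by (intro sum.cong) (auto simp: R_def q_def)
      finally show "(affine_extension p \<circ> R) \<beta> a = affine_extension q \<beta> a"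
        by (simp add: affine_extension_def)
    qed
    ultimately show ?thesis
      using bij_betw_cong[of "realization K''" "affine_extension p \<circ> R" "affine_extension q"] by simp
  qed
  ultimately have geom: "geom_triangulation q K'' K"
    using K by (simp add: geom_triangulation_def)
  have face: "face_num ((`) \<phi> ` A) i = face_num A i" if A: "A \<subseteq> K'" for A i
  proof -
    have "card (\<phi> ` G) = card G" if "G \<in> A" for G
      using card_image[OF inj] that A by blast
    then have "{H \<in> (`) \<phi> ` A. card H = i} = (`) \<phi> ` {G \<in> A. card G = i}"
      by auto
    moreover have "inj_on ((`) \<phi>) {G \<in> A. card G = i}"
      using A by (intro inj_on_subset[OF inj2]) auto
    ultimately show ?thesis
      by (simp add: face_num_def card_image)
  qed
  have "restriction q K'' S = (`) \<phi> ` restriction p K' S" for S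
  proof -
    have "(\<forall>w\<in>\<phi> ` G. supp (q w) \<subseteq> S) \<longleftrightarrow> (\<forall>v\<in>G. supp (p v) \<subseteq> S)" if "G \<in> K'" for G
      using \<psi> sub[OF that] by (auto simp: q_def subset_iff)
    then show ?thesis
      unfolding restriction_def K''_def by blast
  qed
  then have "face_num (restriction q K'' S) i = face_num (restriction p K' S) i" for S i
    using face[of "restriction p K' S" i] by (auto simp: restriction_def)
  then have "uniform_triangulation F q K'' K"
    using geom uniform_triangulationD(4)[OF u] by (simp add: uniform_triangulation_def)
  moreover have "face_num K'' i = face_num K' i" for i
    unfolding K''_def by (rule face) simp
  ultimately show ?thesis
    by blast
qed

lemma h_uniform_eq_h_poly:
  fixes K :: "nat set set" and K' :: "'b set set"
  assumes u: "uniform_triangulation F p K' K" and F: "top_supported F"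
  shows "h_uniform F K = h_poly K'"
proof -
  obtain q and K'' :: "nat set set" where q: "uniform_triangulation F q K'' K" "\<And>i. face_num K'' i
      = face_num K' i"
    using uniform_triangulation_relabel[OF u] by blast
  then show ?thesis
    using h_uniform_eq_h_poly_nat[OF q(1) F]
    by (simp add: h_poly_eq_bernstein_sum cx_rank_uniform_triangulation[OF q(1) F]
        cx_rank_uniform_triangulation[OF u F])
qed

section \<open>The colored barycentric subdivision\<close>

lemma esd_vertex_scaled:
  assumes "f \<in> esd_vertices r L" "r > 0"
  shows "(\<lambda>v. real (f v) / real r) \<in> realization L" "supp (\<lambda>v. real (f v) / real r) = supp f"
proof -
  show supp: "supp (\<lambda>v. real (f v) / real r) = supp f"
    using assms(2) by (auto simp: supp_def)
  have "(\<Sum>v\<in>supp f. real (f v) / real r) = real (\<Sum>v\<in>supp f. f v) / real r"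
    by (simp add: sum_divide_distrib)
  also have "\<dots> = 1"
    using assms by (simp add: esd_vertices_def del: of_nat_sum)
  finally show "(\<lambda>v. real (f v) / real r) \<in> realization L"
    using assms by (simp add: realization_def supp esd_vertices_def)
qed

lemma placement_realization:
  assumes "abstract_complex K" "f \<in> esd_vertices r (sd K)" "r > 0"
  shows "colored_sd_placement r f \<in> realization K" "supp (colored_sd_placement r f) = \<Union>(supp f)"
  unfolding colored_sd_placement_def
  using barycenter_realization[OF assms(1) esd_vertex_scaled(1)[OF assms(2,3)]]
    esd_vertex_scaled(2)[OF assms(2,3)] by simp_all

lemma sd_Union_in:
  assumes K: "abstract_complex K" and C: "C \<in> sd K"
  shows "\<Union>C \<in> K"
proof (cases "C = {}")
  case True
  then show ?thesis
    using complexD(2)[OF K] by simp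
next
  case False
  have "\<Union>C \<in> C"
    using False C complexD(3)[OF abstract_complex_sd[OF K] C]
    by (intro Union_in_finite_chain) (auto simp: mem_sd)
  then show ?thesis
    using C by (auto simp: mem_sd)
qed

lemma mem_sd_Pow:
  assumes "abstract_complex K" "S \<in> K"
  shows "C \<in> sd (Pow S) \<longleftrightarrow> C \<in> sd K \<and> \<Union>C \<subseteq> S"
  using complexD(4)[OF assms] by (auto simp: mem_sd)

locale colored_subdivision =
  fixes K :: "'a set set" and vs :: "'a set list" and r :: nat
  assumes K: "abstract_complex K" and distinct: "distinct vs" and vs: "set vs = K - {{}}" and r_pos: "r > 0"
begin

sublocale esd_setup "sd K" vs r
  using K distinct vs r_pos by unfold_locales (auto intro: abstract_complex_sd simp: mem_sd)

lemma esd_setup_Pow: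
  assumes "S \<in> K"
  shows "esd_setup (sd (Pow S)) vs r"
  using assms K distinct vs r_pos complexD(3,4)[OF K]
  by unfold_locales (auto intro!: abstract_complex_sd abstract_complex_Pow simp: mem_sd subset_iff)

text \<open>Affine extension is linear in the weights, so interchanging two sums factors the
  placement through the realization of \<open>sd K\<close>. Bijectivity then follows from the two
  stages separately.\<close>

lemma affine_extension_placement:
  assumes \<beta>: "\<beta> \<in> realization (colored_sd vs r K)"
  shows "affine_extension (colored_sd_placement r) \<beta> =
    affine_extension barycenter (scaled_extension r \<beta>)"
proof
  fix a
  let ?A = "scaled_extension r \<beta>"
  have \<beta>': "\<beta> \<in> realization (esd vs r (sd K))"
    using \<beta> by (simp add: colored_sd_def)
  have supp: "supp ?A = (\<Union>f\<in>supp \<beta>. supp f)"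
    by (rule affine_extension_supp[OF \<beta>'])
  have fin: "finite (supp ?A)"
    using combination_supp(3)[OF combination_affine_extension[OF \<beta>']] r_pos by (simp add: supp_def)
  have "affine_extension (colored_sd_placement r) \<beta> a
      = (\<Sum>f\<in>supp \<beta>. \<beta> f * (\<Sum>S\<in>supp ?A. real (f S) / real r * barycenter S a))"
    unfolding affine_extension_def[of "colored_sd_placement r"] colored_sd_placement_def
  proof (rule sum.cong[OF refl])
    fix f assume f: "f \<in> supp \<beta>"
    have "affine_extension barycenter (\<lambda>S. real (f S) / real r) a
        = (\<Sum>S\<in>supp ?A. real (f S) / real r * barycenter S a)"
      unfolding affine_extension_def[of barycenter]
      using fin f supp by (intro sum.mono_neutral_left) (auto simp: supp_def)
    then show "\<beta> f * affine_extension barycenter (\<lambda>S. real (f S) / real r) a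
        = \<beta> f * (\<Sum>S\<in>supp ?A. real (f S) / real r * barycenter S a)"
      by simp
  qed
  also have "\<dots> = (\<Sum>f\<in>supp \<beta>. \<Sum>S\<in>supp ?A. \<beta> f * (real (f S) / real r) * barycenter S a)"
    by (simp add: sum_distrib_left mult.assoc)
  also have "\<dots> = (\<Sum>S\<in>supp ?A. \<Sum>f\<in>supp \<beta>. \<beta> f * (real (f S) / real r) * barycenter S a)"
    by (rule sum.swap)
  also have "\<dots> = (\<Sum>S\<in>supp ?A. ?A S * barycenter S a)"
    by (intro sum.cong refl) (simp add: affine_extension_def[of "\<lambda>f S. real (f S) / real r"] sum_distrib_right)
  finally show "affine_extension (colored_sd_placement r) \<beta> a = affine_extension barycenter ?A a"
    by (simp add: affine_extension_def[of barycenter])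
qed

lemma geom_triangulation_colored_sd:
  "geom_triangulation (colored_sd_placement r) (colored_sd vs r K) K"
  unfolding geom_triangulation_def
proof (intro conjI ballI)
  show "abstract_complex (colored_sd vs r K)"
    unfolding colored_sd_def by (rule abstract_complex_esd[OF L])
  show "abstract_complex K"
    by (rule K)
  fix G assume G: "G \<in> colored_sd vs r K"
  then have U: "\<Union>(\<Union>f\<in>G. supp f) \<in> K" and V: "G \<subseteq> esd_vertices r (sd K)"
    using sd_Union_in[OF K, of "\<Union>f\<in>G. supp f"] by (auto simp: colored_sd_def esd_def)
  show "\<exists>F\<in>K. \<forall>v\<in>G. colored_sd_placement r v \<in> realization K \<and> supp (colored_sd_placement r v) \<subseteq> F"
  proof (intro bexI[OF _ U] ballI conjI)
    fix f assume f: "f \<in> G"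
    then have "f \<in> esd_vertices r (sd K)"
      using V by blast
    note p = placement_realization[OF K this r_pos]
    show "colored_sd_placement r f \<in> realization K"
      by (rule p(1))
    show "supp (colored_sd_placement r f) \<subseteq> \<Union>(\<Union>f\<in>G. supp f)"
      unfolding p(2) using f by blast
  qed
next
  have "bij_betw (affine_extension barycenter \<circ> scaled_extension r)
      (realization (colored_sd vs r K)) (realization K)"
    unfolding colored_sd_def
    by (rule bij_betw_trans[OF bij_betw_esd_realization bij_betw_sd_realization[OF K]])
  then show "bij_betw (affine_extension (colored_sd_placement r)) (realization (colored_sd vs r K)) (realization K)"
    using bij_betw_cong[of "realization (colored_sd vs r K)" "affine_extension (colored_sd_placement r)"
        "affine_extension barycenter \<circ> scaled_extension r"]
      affine_extension_placement by simp
qed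

lemma restriction_colored_sd:
  assumes S: "S \<in> K"
  shows "restriction (colored_sd_placement r) (colored_sd vs r K) S = esd vs r (sd (Pow S))"
proof (intro equalityI subsetI)
  fix G assume "G \<in> restriction (colored_sd_placement r) (colored_sd vs r K) S"
  then have G: "G \<in> esd vs r (sd K)" and sub: "\<And>f. f \<in> G \<Longrightarrow> supp (colored_sd_placement r f) \<subseteq> S"
    by (auto simp: restriction_def colored_sd_def)
  have V: "f \<in> esd_vertices r (sd K)" if "f \<in> G" for f
    using G that by (auto simp: esd_def)
  have f: "\<Union>(supp f) \<subseteq> S" if "f \<in> G" for f
    using sub[OF that] placement_realization(2)[OF K V[OF that] r_pos] by simp
  then have "G \<subseteq> esd_vertices r (sd (Pow S))"
    using V by (auto simp: esd_vertices_def mem_sd_Pow[OF K S])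
  moreover have "(\<Union>f\<in>G. supp f) \<in> sd (Pow S)"
    using G f unfolding mem_sd_Pow[OF K S] esd_def by blast
  ultimately show "G \<in> esd vs r (sd (Pow S))"
    using G by (simp add: esd_def)
next
  fix G assume G: "G \<in> esd vs r (sd (Pow S))"
  then have "G \<in> esd vs r (sd K)"
    by (auto simp: esd_def esd_vertices_def mem_sd_Pow[OF K S])
  moreover have "supp (colored_sd_placement r f) \<subseteq> S" if "f \<in> G" for f
  proof -
    have f: "f \<in> esd_vertices r (sd (Pow S))"
      using G that by (auto simp: esd_def)
    then have "f \<in> esd_vertices r (sd K)"
      by (auto simp: esd_vertices_def mem_sd_Pow[OF K S])
    then show ?thesis
      using f placement_realization(2)[OF K _ r_pos] by (auto simp: esd_vertices_def mem_sd_Pow[OF K S])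
  qed
  ultimately show "G \<in> restriction (colored_sd_placement r) (colored_sd vs r K) S"
    by (simp add: restriction_def colored_sd_def)
qed

end

section \<open>Hilbert series of the subdivided simplex and of its boundary\<close>

lemma card_esd_vertices_0:
  assumes "abstract_complex L"
  shows "card (esd_vertices 0 L) = 1"
proof -
  have "esd_vertices 0 L = {\<lambda>_. 0}"
  proof (intro equalityI subsetI)
    fix f assume "f \<in> esd_vertices 0 L"
    then have "supp f = {}"
      using complexD(3)[OF assms] by (auto simp: esd_vertices_def supp_def)
    then show "f \<in> {\<lambda>_. 0}"
      by (auto simp: supp_def)
  qed (use complexD(2)[OF assms] in \<open>auto simp: esd_vertices_def supp_def\<close>)
  then show ?thesis
    by simp
qed

lemma gap_seq_block:
  assumes "q \<le> m"
  shows "gap_seq m (n * (r * (m + 1)) + q) = power_gap m (n * r) q"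
proof -
  have "(n * r * (m + 1) + q) div (m + 1) = n * r" "(n * r * (m + 1) + q) mod (m + 1) = q"
    using assms by (simp_all only: div_mod_mult_add less_Suc_eq_le Suc_eq_plus1[symmetric])
  then show ?thesis
    unfolding gap_seq_def by (simp only: mult.assoc)
qed

text \<open>Index k = m is the position q = m in block N = n r, and for N > 0 that power gap is (n r
  + 1)^m - (n r)^m. The coefficient n = 0 is checked apart, as the count by heights requires a
  positive total.\<close>

lemma fps_col_eulerian_diagonal:
  assumes e: "esd_setup (sd (Pow S)) vs r" and S: "finite S"
  shows "(1 - fps_X) ^ card S * hilbert_fps (esd vs r (sd (Pow S)))
      = fps_of_poly (col_eulerian r (card S) (card S))"
proof -
  interpret esd_setup "sd (Pow S)" vs r
    by (rule e)
  let ?m = "card S"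
  have "real (card (esd_vertices n (esd vs r (sd (Pow S))))) = gap_seq ?m (n * (r * (?m + 1)) + ?m)" for n
  proof (cases "n = 0")
    case True
    then show ?thesis
      using card_esd_vertices_0[OF abstract_complex_esd[OF L]] gap_seq_block[of ?m ?m 0 r]
      by (simp add: power_gap_def)
  next
    case False
    then have "card (esd_vertices n (esd vs r (sd (Pow S)))) = card (esd_vertices (r * n) (sd (Pow S)))"
      by (intro card_esd_vertices_esd) simp
    then show ?thesis
      unfolding gap_seq_block[OF order_refl]
      using card_esd_vertices_sd_Pow[OF S, of "r * n"] False r_pos by (simp add: power_gap_def mult.commute)
  qed
  then have "hilbert_fps (esd vs r (sd (Pow S))) = Abs_fps (\<lambda>n. gap_seq ?m (n * (r * (?m + 1)) + ?m))"
    by (simp add: hilbert_fps_def)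
  then show ?thesis
    using fps_col_eulerian[OF less_mult_Suc[OF r_pos]] by simp
qed

text \<open>Positions q = 0, ..., m of the block N = n r count facets of the boundary with m-q of
  their own facets removed, as in a shelling. Their sum telescopes to the second difference found
  for the boundary.\<close>

lemma fps_col_eulerian_boundary:
  assumes e: "esd_setup (sd (Pow S - {S})) vs r" and S: "finite S" "card S = Suc m"
  shows "(1 - fps_X) ^ m * hilbert_fps (esd vs r (sd (Pow S - {S})))
    = fps_of_poly (\<Sum>i=0..<m + 1. col_eulerian r m i)"
proof -
  interpret esd_setup "sd (Pow S - {S})" vs r
    by (rule e)
  have ne: "S \<noteq> {}"
    using S by auto
  have sum: "(\<Sum>q=0..<m + 1. gap_seq m (n * (r * (m + 1)) + q))
      = power_gap (Suc m) (n * r) (m + 1) - power_gap (Suc m) (n * r) 0" for n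
  proof -
    have "(\<Sum>q=0..<m + 1. gap_seq m (n * (r * (m + 1)) + q))
        = (\<Sum>l=n * r * (m + 1)..<n * r * (m + 1) + (m + 1). gap_seq m l)"
      unfolding sum_shift by (simp only: mult.assoc add_0_right)
    also have "\<dots> = (\<Sum>l<n * r * (m + 1) + (m + 1). gap_seq m l) - (\<Sum>l<n * r * (m + 1) + 0. gap_seq m l)"
      using sum.atLeastLessThan_concat[of 0 "n * r * (m + 1)" "n * r * (m + 1) + (m + 1)" "gap_seq m"]
      unfolding lessThan_atLeast0 by (simp only: add_0_right le0 le_add1) simp
    also have "\<dots> = power_gap (Suc m) (n * r) (m + 1) - power_gap (Suc m) (n * r) 0"
      by (simp only: sum_gap_seq le0 order_refl)
    finally show ?thesis .
  qed
  have "real (card (esd_vertices n (esd vs r (sd (Pow S - {S})))))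
      = (\<Sum>q=0..<m + 1. gap_seq m (n * (r * (m + 1)) + q))" for n
  proof (cases "n = 0")
    case True
    then show ?thesis
      unfolding sum using card_esd_vertices_0[OF abstract_complex_esd[OF L]] by (simp add: power_gap_def)
  next
    case False
    then have "card (esd_vertices n (esd vs r (sd (Pow S - {S}))))
        = card (esd_vertices (r * n) (sd (Pow S - {S})))"
      by (intro card_esd_vertices_esd) simp
    then show ?thesis
      unfolding sum using card_esd_vertices_sd_boundary[OF S(1) ne, of "r * n"] S(2) False r_pos
      by (simp add: power_gap_def mult.commute)
  qed
  then have H: "hilbert_fps (esd vs r (sd (Pow S - {S})))
      = (\<Sum>q=0..<m + 1. Abs_fps (\<lambda>n. gap_seq m (n * (r * (m + 1)) + q)))"
    by (intro fps_ext) (simp only: hilbert_fps_def fps_nth_Abs_fps fps_sum_nth)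
  then show ?thesis
    unfolding H fps_of_poly_sum sum_distrib_left using less_mult_Suc[OF r_pos, of m]
    by (intro sum.cong refl fps_col_eulerian[symmetric]) auto
qed

text \<open>An arbitrary vertex order, fixed only to write down the f-triangle; the counts turn out
  not to depend on it.\<close>

definition face_enum :: "nat \<Rightarrow> nat set list" where
  "face_enum j = (SOME vs. distinct vs \<and> set vs = Pow {..<j} - {{}})"

lemma face_enum: "distinct (face_enum j)" "set (face_enum j) = Pow {..<j} - {{}}"
proof -
  have "\<exists>vs. distinct vs \<and> set vs = Pow {..<j} - {{}}"
    using finite_distinct_list[of "Pow {..<j} - {{}}"] by auto
  then have "distinct (face_enum j) \<and> set (face_enum j) = Pow {..<j} - {{}}"
    unfolding face_enum_def by (rule someI_ex)
  then show "distinct (face_enum j)" "set (face_enum j) = Pow {..<j} - {{}}"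
    by auto
qed

lemma colored_subdivision_simplex: "0 < r \<Longrightarrow> colored_subdivision (Pow {..<j}) (face_enum j) r"
  using face_enum by unfold_locales (auto intro: abstract_complex_Pow)

definition simplex_face_num :: "nat \<Rightarrow> nat \<Rightarrow> nat \<Rightarrow> nat" where
  "simplex_face_num r i j = face_num (esd (face_enum j) r (sd (Pow {..<j}))) i"

text \<open>For any order of the vertices, (1-x)^m times the Hilbert series is the same polynomial;
  cancelling the power and reading off face numbers removes the dependence on order and on
  \<open>K\<close>.\<close>

lemma face_num_restriction_colored_sd:
  assumes c: "colored_subdivision K vs r" and S: "S \<in> K"
  shows "face_num (restriction (colored_sd_placement r) (colored_sd vs r K) S) i
      = simplex_face_num r i (card S)"
proof -
  interpret colored_subdivision K vs r
    by (rule c)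
  let ?m = "card S"
  have fin: "finite S"
    using complexD(3)[OF K S] .
  have e: "esd_setup (sd (Pow S)) vs r"
    by (rule esd_setup_Pow[OF S])
  have e': "esd_setup (sd (Pow {..<?m})) (face_enum ?m) r"
    by (rule colored_subdivision.esd_setup_Pow[OF colored_subdivision_simplex[OF r_pos]]) simp
  have "(1 - fps_X) ^ ?m * hilbert_fps (esd vs r (sd (Pow S)))
      = (1 - fps_X) ^ ?m * hilbert_fps (esd (face_enum ?m) r (sd (Pow {..<?m})))"
    using fps_col_eulerian_diagonal[OF e fin] fps_col_eulerian_diagonal[OF e'] by simp
  moreover have "(1 - fps_X :: real fps) \<noteq> 0"
    by (auto simp: fps_eq_iff intro!: exI[of _ 0])
  ultimately have "hilbert_fps (esd vs r (sd (Pow S)))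
      = hilbert_fps (esd (face_enum ?m) r (sd (Pow {..<?m})))"
    by simp
  then show ?thesis
    unfolding restriction_colored_sd[OF S] simplex_face_num_def
    using esd_setup.L[OF e] esd_setup.L[OF e'] by (intro face_num_of_hilbert_fps abstract_complex_esd)
qed

lemma uniform_triangulation_colored_sd:
  assumes c: "colored_subdivision K vs r"
  shows "uniform_triangulation (simplex_face_num r) (colored_sd_placement r) (colored_sd vs r K) K"
  unfolding uniform_triangulation_def
  using colored_subdivision.geom_triangulation_colored_sd[OF c] face_num_restriction_colored_sd[OF c]
  by blast

text \<open>Uniqueness holds because the entry at (i, j) can be read from the simplex on j vertices,
  restricted to its largest face.\<close>

lemma colored_f_triangle_eq:
  assumes r: "r > 0"
  shows "colored_f_triangle r = simplex_face_num r"
  unfolding colored_f_triangle_def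
proof (rule the_equality)
  show "\<forall>(K :: nat set set) vs. abstract_complex K \<and> distinct vs \<and> set vs = K - {{}} \<longrightarrow>
      uniform_triangulation (simplex_face_num r) (colored_sd_placement r) (colored_sd vs r K) K"
    using r by (intro allI impI uniform_triangulation_colored_sd) (simp add: colored_subdivision_def)
next
  fix F assume F: "\<forall>(K :: nat set set) vs. abstract_complex K \<and> distinct vs \<and> set vs = K - {{}} \<longrightarrow>
      uniform_triangulation F (colored_sd_placement r) (colored_sd vs r K) K"
  show "F = simplex_face_num r"
  proof (intro ext)
    fix i j
    have "uniform_triangulation F (colored_sd_placement r) (colored_sd (face_enum j) r (Pow {..<j})) (Pow {..<j})"
      using face_enum[of j] abstract_complex_Pow[of "{..<j}"] by (intro F[rule_format]) simp
    then have "face_num (restriction (colored_sd_placement r) (colored_sd (face_enum j) r (Pow {..<j})) {..<j}) i = F i j"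
      using uniform_triangulationD(4)[of F _ _ "Pow {..<j}" "{..<j}" i] by simp
    then show "F i j = simplex_face_num r i j"
      using face_num_restriction_colored_sd[OF colored_subdivision_simplex[OF r], of "{..<j}" j i] by simp
  qed
qed

text \<open>The polynomial of index j at level j has degree at most j, and its value at 1 is
  positive because its coefficients are nonnegative and not all 0.\<close>

lemma top_supported_simplex_face_num:
  assumes r: "r > 0"
  shows "top_supported (simplex_face_num r)"
proof -
  have "(j < i \<longrightarrow> simplex_face_num r i j = 0) \<and> 0 < simplex_face_num r j j" for i j
  proof -
    let ?P = "col_eulerian r j j"
    have e: "esd_setup (sd (Pow {..<j})) (face_enum j) r"
      by (rule colored_subdivision.esd_setup_Pow[OF colored_subdivision_simplex[OF r]]) simp
    note j = less_mult_Suc[OF r, of j]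
    have deg: "degree ?P \<le> j"
      using coeff_col_eulerian_eq_0[OF j] by (intro degree_le) auto
    have "\<exists>d. 0 < coeff ?P d"
    proof (cases j)
      case (Suc m)
      then show ?thesis
        using coeff_col_eulerian_pos[of j r m] j by auto
    qed (use r in auto)
    then obtain d where d: "0 < coeff ?P d"
      by blast
    then have "d \<le> degree ?P"
      by (intro le_degree) simp
    then have "coeff ?P d \<le> (\<Sum>i\<le>degree ?P. coeff ?P i)"
      using coeff_col_eulerian_nonneg[OF j] by (intro member_le_sum) auto
    then have "0 < poly ?P 1"
      using d by (simp add: poly_altdef)
    moreover have P: "(1 - fps_X) ^ j * hilbert_fps (esd (face_enum j) r (sd (Pow {..<j})))
        = fps_of_poly ?P"
      using fps_col_eulerian_diagonal[OF e] by simp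
    ultimately show ?thesis
      using face_num_top_of_hilbert_fps[OF abstract_complex_esd[OF esd_setup.L[OF e]] P deg]
      by (simp add: simplex_face_num_def)
  qed
  then show ?thesis
    by (simp add: top_supported_def)
qed

section \<open>The polynomials of the simplex, of its boundary, and their difference\<close>

lemma h_uniform_colored:
  fixes K :: "nat set set"
  assumes c: "colored_subdivision K vs r" and r: "r > 0"
    and P: "(1 - fps_X) ^ cx_rank K * hilbert_fps (esd vs r (sd K)) = fps_of_poly P"
  shows "h_uniform (colored_f_triangle r) K = P"
proof -
  have u: "uniform_triangulation (simplex_face_num r) (colored_sd_placement r) (colored_sd vs r K) K"
    by (rule uniform_triangulation_colored_sd[OF c])
  note F = top_supported_simplex_face_num[OF r]
  have "h_uniform (simplex_face_num r) K = h_poly (colored_sd vs r K)"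
    by (rule h_uniform_eq_h_poly[OF u F])
  moreover have "fps_of_poly (h_poly (colored_sd vs r K)) = fps_of_poly P"
    using fps_h_poly[OF uniform_triangulationD(1)[OF u]] P
    unfolding cx_rank_uniform_triangulation[OF u F] by (simp add: colored_sd_def)
  ultimately show ?thesis
    by (simp add: colored_f_triangle_eq[OF r] fps_of_poly_eq_iff)
qed

lemma h_uniform_full_simplex:
  assumes r: "r > 0"
  shows "h_uniform (colored_f_triangle r) (full_simplex m) = col_eulerian r m m"
  unfolding full_simplex_def
proof (rule h_uniform_colored[OF colored_subdivision_simplex[OF r] r])
  have "esd_setup (sd (Pow {..<m})) (face_enum m) r"
    by (rule colored_subdivision.esd_setup_Pow[OF colored_subdivision_simplex[OF r]]) simp
  moreover have "cx_rank (Pow {..<m}) = m"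
    unfolding cx_rank_def
  proof (rule Max_eqI)
    show "m \<in> card ` Pow {..<m}"
      by (intro image_eqI[of _ _ "{..<m}"]) auto
    show "n \<le> m" if "n \<in> card ` Pow {..<m}" for n
      using that card_mono[of "{..<m}"] by auto
  qed simp
  ultimately show "(1 - fps_X) ^ cx_rank (Pow {..<m}) * hilbert_fps (esd (face_enum m) r (sd (Pow {..<m})))
      = fps_of_poly (col_eulerian r m m)"
    using fps_col_eulerian_diagonal[of "{..<m}"] by simp
qed

lemma h_uniform_boundary_simplex:
  assumes r: "r > 0"
  shows "h_uniform (colored_f_triangle r) (boundary_simplex (Suc m)) = (\<Sum>i=0..<m + 1. col_eulerian r m i)"
proof -
  let ?S = "{..<Suc m}"
  let ?K = "Pow ?S - {?S}"
  have K: "abstract_complex ?K"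
    by (auto simp: abstract_complex_def intro: finite_subset)
  obtain vs where vs: "distinct vs" "set vs = ?K - {{}}"
    using finite_distinct_list[of "?K - {{}}"] by auto
  have c: "colored_subdivision ?K vs r"
    using K vs r by unfold_locales
  have "cx_rank ?K = m"
    unfolding cx_rank_def
  proof (rule Max_eqI)
    show "m \<in> card ` ?K"
      by (intro image_eqI[of _ _ "{..<m}"]) auto
    show "n \<le> m" if n: "n \<in> card ` ?K" for n
    proof -
      obtain T where "T \<subset> ?S" "n = card T"
        using n by auto
      then show ?thesis
        using psubset_card_mono[of ?S T] by simp
    qed
  qed simp
  moreover have "esd_setup (sd ?K) vs r"
  proof -
    interpret colored_subdivision ?K vs r
      by (rule c)
    show ?thesis
      by (rule esd_setup_axioms)
  qed
  ultimately show ?thesis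
    unfolding boundary_simplex_def using fps_col_eulerian_boundary[of ?S vs r m]
    by (intro h_uniform_colored[OF c r]) simp
qed

text \<open>At index m+1 the cut is m+1, so the part of the recursion below the cut is precisely the
  polynomial of the boundary; \<theta> is the part that carries the factor x.\<close>

lemma theta_colored:
  assumes r: "r > 0"
  shows "theta (colored_f_triangle r) (Suc m) = [:0, 1:] * (\<Sum>i=m + 1..<r * (m + 1). col_eulerian r m i)"
proof -
  have "Suc m < r * (m + 2)"
    using less_mult_Suc[OF r, of "Suc m"] by simp
  moreover have "cut_index m (Suc m) = m + 1"
    by (simp add: cut_index_def)
  ultimately have "col_eulerian r (Suc m) (Suc m) = (\<Sum>i=0..<m + 1. col_eulerian r m i)
      + [:0, 1:] * (\<Sum>i=m + 1..<r * (m + 1). col_eulerian r m i)"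
    using col_eulerian_Suc[of "Suc m" r m] by (simp only:)
  then show ?thesis
    unfolding theta_def h_uniform_full_simplex[OF r] h_uniform_boundary_simplex[OF r]
    by (simp only: add_diff_cancel_left')
qed

theorem theorem5p3:
  fixes r n :: nat
  assumes "0 < r"
  shows "strong_interlacing (colored_f_triangle r) n"
  unfolding strong_interlacing_def
proof (intro conjI allI impI)
  fix m assume "2 \<le> m \<and> m < n"
  then show "real_rooted (h_uniform (colored_f_triangle r) (full_simplex m))"
    unfolding h_uniform_full_simplex[OF assms] using assms less_mult_Suc[OF assms, of m]
    by (intro real_rooted_col_eulerian) auto
next
  fix m assume "2 \<le> m \<and> m \<le> n"
  then obtain k where m: "m = Suc k" "k > 0"
    by (cases m) auto
  let ?\<theta> = "theta (colored_f_triangle r) m"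
  note \<theta> = theta_colored[OF assms, of k, folded m(1)]
  show "?\<theta> = 0 \<or> real_rooted ?\<theta> \<and> degree ?\<theta> = m - 1 \<and> (\<forall>k. 0 \<le> coeff ?\<theta> k) \<and>
      interlaces (h_uniform (colored_f_triangle r) (full_simplex (m - 1))) ?\<theta>"
  \<comment> \<open>For r = 1, plain barycentric subdivision, the range of the sum in
    \<open>theta_colored\<close> is empty: the simplex and its boundary have equal
    polynomials.\<close>
  proof (cases "r = 1")
    case True
    then show ?thesis
      using \<theta> by simp
  next
    case False
    then have r: "r > 1"
      using assms by simp
    note * = col_eulerian_interlaces[OF r m(2), folded \<theta>]
    have "real_rooted ?\<theta>"
      using *(1) by (simp add: interlaces_def)
    then show ?thesis
      unfolding h_uniform_full_simplex[OF assms] using * m by simp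
  qed
qed

end
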